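(* Let $N\ge 1$, $D_1>0$, $D_2>0$, $0<p\le q$ with $pq>1$, and $0<T<\infty$. Let $(u,v)$ be a solution in $\mathbf{R}^N\times(0,T)$ to the system $$\partial_t u=D_1\Delta u+v^p,\qquad \partial_t v=D_2\Delta v+u^q,\qquad u,v\ge 0\qquad\text{in }\mathbf{R}^N\times(0,T).$$ Then there exists a unique pair of Radon measures $(\mu,\nu)$ in $\mathbf{R}^N$ such that $$\operatorname*{ess\,lim}_{t\to+0}\int_{\mathbf{R}^N}u(y,t)\phi(y)\,dy=\int_{\mathbf{R}^N}\phi(y)\,d\mu(y),\qquad \operatorname*{ess\,lim}_{t\to+0}\int_{\mathbf{R}^N}v(y,t)\phi(y)\,dy=\int_{\mathbf{R}^N}\phi(y)\,d\nu(y)$$ for all $\phi\in C_0(\mathbf{R}^N)$. Furthermore, there exists a positive constant $\gamma$ depending only on $N$, $D_1$, $D_2$, $p$ and $q$ such that $$\sup_{x\in\mathbf{R}^N}\mu(B(x,\sigma))\le\gamma\,\sigma^{N-\frac{2(p+1)}{pq-1}},\qquad \sup_{x\in\mathbf{R}^N}\nu(B(x,\sigma))\le\gamma\,\sigma^{N-\frac{2(q+1)}{pq-1}}$$ for all $0<\sigma\le T^{1/2}$.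
   Context: Radon measures are nonnegative. $B(x,r)$ is the ball of center $x$ and radius $r$ in $\mathbf{R}^N$. $C_0(\mathbf{R}^N)$ is the space of continuous functions with compact support. $\operatorname{ess\,lim}_{t\to+0}$ is the limit as $t\to+0$ outside a null set of times. Let $G(x,t)=(4\pi t)^{-N/2}\exp(-|x|^2/(4t))$; for a Radon measure $\mu$ set $[S(t)\mu](x)=\int_{\mathbf{R}^N}G(x-y,t)\,d\mu(y)$, and for a nonnegative measurable function $\mu$ set $[S(t)\mu](x)=\int_{\mathbf{R}^N}G(x-y,t)\mu(y)\,dy$. Definition of solution: a pair $(u,v)$ of nonnegative measurable functions in $\mathbf{R}^N\times(0,T)$ is a solution to the system in $\mathbf{R}^N\times(0,T)$ if $u(x,t)<\infty$, $v(x,t)<\infty$ and $$u(x,t)=[S(D_1(t-\tau))u(\tau)](x)+\int_\tau^t[S(D_1(t-s))v(s)^p](x)\,ds,$$ $$v(x,t)=[S(D_2(t-\tau))v(\tau)](x)+\int_\tau^t[S(D_2(t-s))u(s)^q](x)\,ds$$ for almost all $x\in\mathbf{R}^N$ and $0<\tau<t<T$. *)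

theory Defs
  imports "HOL-Analysis.Analysis"
begin

(* Real powers on [0,\<infinity>], with \<infinity>^p = \<infinity>; only used for exponents p > 0. *)
definition ennpowr :: "ennreal \<Rightarrow> real \<Rightarrow> ennreal"
  where "ennpowr a p = (if a = \<infinity> then \<infinity> else ennreal (enn2real a powr p))"

definition heat_kernel :: "'a::euclidean_space \<Rightarrow> real \<Rightarrow> real"
  where "heat_kernel x t =
    (4 * pi * t) powr (- (real DIM('a) / 2)) * exp (- ((norm x)\<^sup>2 / (4 * t)))"

definition heat_flow :: "real \<Rightarrow> ('a::euclidean_space \<Rightarrow> ennreal) \<Rightarrow> 'a \<Rightarrow> ennreal"
  where "heat_flow t f x = (\<integral>\<^sup>+ y. ennreal (heat_kernel (x - y) t) * f y \<partial>lebesgue)"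

(* Solutions are [0,\<infinity>]-valued and the integral equations are identities in [0,\<infinity>].
   "Almost all x and 0 < \<tau> < t < T" refers to Lebesgue measure in the joint variable (x, \<tau>, t).
   Values u x t with t outside (0,T) are irrelevant. *)
definition is_solution ::
  "real \<Rightarrow> real \<Rightarrow> real \<Rightarrow> real \<Rightarrow> real \<Rightarrow>
    ('a::euclidean_space \<Rightarrow> real \<Rightarrow> ennreal) \<Rightarrow> ('a \<Rightarrow> real \<Rightarrow> ennreal) \<Rightarrow> bool"
  where "is_solution D1 D2 p q T u v \<longleftrightarrow>
    (\<lambda>(x, t). u x t) \<in> borel_measurable (lebesgue_on (UNIV \<times> {0<..<T})) \<and>
    (\<lambda>(x, t). v x t) \<in> borel_measurable (lebesgue_on (UNIV \<times> {0<..<T})) \<and>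
    (AE (x, \<tau>, t) in lebesgue. 0 < \<tau> \<and> \<tau> < t \<and> t < T \<longrightarrow>
      u x t < \<infinity> \<and> v x t < \<infinity> \<and>
      u x t = heat_flow (D1 * (t - \<tau>)) (\<lambda>y. u y \<tau>) x +
        (\<integral>\<^sup>+ s\<in>{\<tau><..<t}. heat_flow (D1 * (t - s)) (\<lambda>y. ennpowr (v y s) p) x \<partial>lebesgue) \<and>
      v x t = heat_flow (D2 * (t - \<tau>)) (\<lambda>y. v y \<tau>) x +
        (\<integral>\<^sup>+ s\<in>{\<tau><..<t}. heat_flow (D2 * (t - s)) (\<lambda>y. ennpowr (u y s) q) x \<partial>lebesgue))"

definition radon_measure :: "'a::euclidean_space measure \<Rightarrow> bool"
  where "radon_measure M \<longleftrightarrow>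
    sets M = sets borel \<and>
    (\<forall>K. compact K \<longrightarrow> emeasure M K < \<infinity>) \<and>
    (\<forall>A\<in>sets borel. emeasure M A = (SUP K\<in>{K. compact K \<and> K \<subseteq> A}. emeasure M K))"

definition compactly_supported_continuous :: "('a::euclidean_space \<Rightarrow> real) \<Rightarrow> bool"
  where "compactly_supported_continuous \<phi> \<longleftrightarrow>
    continuous_on UNIV \<phi> \<and> compact (closure {x. \<phi> x \<noteq> 0})"

(* M is the essential limit of u(.,t) as t \<rightarrow> +0, tested against compactly supported continuous
   functions; Z is the exceptional null set of times.  The Bochner integral of a non-integrable
   function is 0 in HOL-Analysis, so integrability for the times involved in the limit is required
   explicitly.  enn2real \<infinity> = 0 is harmless: a solution has u(x,t) < \<infinity> for almost all (x,t). *)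
definition is_initial_trace ::
  "('a::euclidean_space \<Rightarrow> real \<Rightarrow> ennreal) \<Rightarrow> 'a measure \<Rightarrow> bool"
  where "is_initial_trace u M \<longleftrightarrow>
    (\<forall>\<phi>. compactly_supported_continuous \<phi> \<longrightarrow>
      (\<exists>Z\<in>null_sets lebesgue.
        (\<forall>\<^sub>F t in at 0 within {0<..} - Z. integrable lebesgue (\<lambda>y. enn2real (u y t) * \<phi> y)) \<and>
        ((\<lambda>t. LINT y|lebesgue. enn2real (u y t) * \<phi> y) \<longlongrightarrow> (LINT y|M. \<phi> y))
          (at 0 within {0<..} - Z)))"

end

theory Submission
  imports Defs "HOL-Probability.Distributions"
begin

text \<open>
  The theorem rests on an a priori bound for the local mass of a solution and on the existence of
  a limit as time tends to zero.

  \<^bold>\<open>A priori bound.\<close> Let the integral equations hold from time \<open>\<tau>\<close> on, and let \<open>M\<close> be the mass of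
  \<open>u(\<tau>)\<close> in a ball of radius \<open>r\<close>. By time \<open>\<tau> + r\<^sup>2/16\<close> diffusion has spread this mass over the
  ball, so that \<open>u \<ge> c r\<^sup>-\<^sup>N M\<close> there (\<open>initial_lower_bound\<close>). Up to times of order \<open>r\<^sup>2\<close> the heat
  flow of the indicator of a ball stays above a positive constant on the whole ball
  (\<open>heat_mass_in_ball\<close>). Hence \<open>u \<ge> A\<close> on the ball after some time gives \<open>v \<ge> c s A\<^sup>q\<close> on the
  ball a time \<open>s\<close> later, and the first equation turns this into a lower bound for \<open>u\<close> of order
  \<open>A\<^bsup>pq\<^esup>\<close> (\<open>source_lower_bound\<close>). As \<open>pq > 1\<close>, a large initial \<open>A\<close> makes these lower bounds
  grow without bound along time steps that decrease geometrically, and \<open>u\<close> would be infinite at a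
  positive time. How large it may be is fixed by scaling, and the outcome is
  \<open>M \<le> \<gamma> r\<^bsup>N - 2(p+1)/(pq-1)\<^esup>\<close> (\<open>local_mass_bound\<close>). Powers enter only through their
  monotonicity, so exponents below 1 are covered. The bound for \<open>v\<close> is the same statement with the
  roles of the two components exchanged.

  \<^bold>\<open>Existence of the trace.\<close> Each component solves a linear heat equation with a nonnegative source.
  Its finiteness at one point \<open>(x\<^sub>0, t\<^sub>0)\<close> with \<open>t\<^sub>0 > T/2\<close> bounds the integrals of the solution
  at almost all times below \<open>T/4\<close>, and of the source over all these times, against one Gaussian weight
  \<open>g\<close> centred at \<open>x\<^sub>0\<close> (\<open>gaussian_weight_bound\<close>). For a test function \<open>\<phi>\<close> and small \<open>h\<close> the heat
  flow of \<open>\<phi>\<close> up to time \<open>h\<close> differs from \<open>\<phi>\<close> by at most \<open>\<epsilon> g\<close> (\<open>heat_flow_test_function\<close>). Moving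
  the heat flow from the solution to \<open>\<phi>\<close> therefore shows that the integrals of the solution
  against \<open>\<phi>\<close> form a Cauchy family as the time tends to zero outside a null set of times that does
  not depend on \<open>\<phi>\<close> (\<open>test_integrals_Cauchy\<close>). The limit is a positive linear functional of \<open>\<phi>\<close>, and
  the Riesz representation theorem, proved here with an outer measure, provides the trace.

  \<^bold>\<open>Uniqueness and bound.\<close> A Radon measure is determined by its integrals of test functions
  (\<open>radon_measure_eqI\<close>), and a null set of times leaves points arbitrarily close to zero, so traces
  are unique. The a priori bound on balls of radius \<open>2\<sigma>\<close> passes to the trace of a ball of radius
  \<open>\<sigma>\<close> by testing with a cutoff function between the two balls (\<open>trace_ball_bound\<close>).
\<close>

section \<open>Compactly supported continuous functions\<close>

abbreviation csc :: "('a::euclidean_space \<Rightarrow> real) \<Rightarrow> bool" where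
  "csc \<equiv> compactly_supported_continuous"

text \<open>In a Euclidean space bounded support and compact support agree; the bounded form is the one that is easy to check for the functions built below.\<close>
lemma csc_iff:
  fixes f :: "'a::euclidean_space \<Rightarrow> real"
  shows "csc f \<longleftrightarrow>
    continuous_on UNIV f \<and> (\<exists>R. \<forall>x. f x \<noteq> 0 \<longrightarrow> norm x \<le> R)"
proof -
  have "compact (closure {x. f x \<noteq> 0}) \<longleftrightarrow> bounded {x. f x \<noteq> 0}"
    by (simp add: compact_closure)
  then show ?thesis
    unfolding compactly_supported_continuous_def bounded_iff by auto
qed

lemma csc_add:
  assumes "csc f" "csc g"
  shows "csc (\<lambda>x. f x + g x)"
proof -
  obtain R S where "\<And>x. f x \<noteq> 0 \<Longrightarrow> norm x \<le> R" "\<And>x. g x \<noteq> 0 \<Longrightarrow> norm x \<le> S"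
    using assms by (auto simp: csc_iff)
  then have "\<forall>x. f x + g x \<noteq> 0 \<longrightarrow> norm x \<le> max R S"
    by (metis add.right_neutral le_max_iff_disj)
  then show ?thesis using assms by (auto simp: csc_iff intro: continuous_on_add)
qed

lemma csc_compose:
  assumes "csc f" "continuous_on UNIV h" "h 0 = 0"
  shows "csc (\<lambda>x. h (f x))"
proof -
  obtain R where "\<And>x. f x \<noteq> 0 \<Longrightarrow> norm x \<le> R" using assms by (auto simp: csc_iff)
  then have "\<forall>x. h (f x) \<noteq> 0 \<longrightarrow> norm x \<le> R" using assms(3) by metis
  moreover have "continuous_on UNIV (\<lambda>x. h (f x))"
    using assms by (auto simp: csc_iff intro: continuous_on_compose2[of UNIV h])
  ultimately show ?thesis by (auto simp: csc_iff)
qed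

lemma csc_scale: "csc f \<Longrightarrow> csc (\<lambda>x. c * f x)"
  by (rule csc_compose[where h = "\<lambda>x. c * x"]) (auto intro!: continuous_intros)

lemma csc_pos: "csc f \<Longrightarrow> csc (\<lambda>x. max 0 (f x))"
  by (rule csc_compose[where h = "\<lambda>x. max 0 x"]) (auto intro!: continuous_intros)

lemma csc_diff:
  assumes "csc f" "csc g"
  shows "csc (\<lambda>x. f x - g x)"
  using csc_add[OF assms(1) csc_scale[OF assms(2), of "-1"]] by simp

lemma csc_zero: "csc (\<lambda>x. 0)"
  by (auto simp: csc_iff)

lemma csc_sum:
  assumes "\<And>i. i \<in> I \<Longrightarrow> csc (f i)"
  shows "csc (\<lambda>x. \<Sum>i\<in>I. f i x)"
  using assms by (induction I rule: infinite_finite_induct) (auto intro: csc_zero csc_add)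

definition plateau :: "real \<Rightarrow> 'a::euclidean_space \<Rightarrow> real" where
  "plateau R x = max 0 (min 1 (R + 1 - norm x))"

lemma plateau: "csc (plateau R)" "0 \<le> plateau R x" "norm x \<le> R \<Longrightarrow> plateau R x = 1"
proof -
  show "csc (plateau R)"
    unfolding csc_iff by (auto simp: plateau_def intro!: continuous_intros exI[of _ "R+1"])
qed (auto simp: plateau_def)

text \<open>The subtraction of 1 makes the support of \<open>inner_cutoff U n\<close> a compact subset of \<open>U\<close>: on it the
  distance to the complement of \<open>U \<inter> ball 0 n\<close> is at least \<open>1/n\<close>. The intersection with a ball
  also keeps that complement nonempty, where \<^const>\<open>infdist\<close> is a true distance (to the empty set
  it is 0 by convention).\<close>
definition inner_cutoff :: "'a::euclidean_space set \<Rightarrow> nat \<Rightarrow> 'a \<Rightarrow> real" where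
  "inner_cutoff U n x = min 1 (max 0 (real n * infdist x (- (U \<inter> ball 0 (real n))) - 1))"

lemma compl_Int_ball_nonempty: "- (U \<inter> ball (0::'a::euclidean_space) r) \<noteq> {}"
proof -
  have "bounded (U \<inter> ball 0 r)" by (meson bounded_Int bounded_ball)
  then show ?thesis using not_bounded_UNIV by (metis Compl_UNIV_eq double_complement)
qed

lemma inner_cutoff_range: "0 \<le> inner_cutoff U n x" "inner_cutoff U n x \<le> 1"
  by (auto simp: inner_cutoff_def)

lemma inner_cutoff_outside: "x \<notin> U \<inter> ball 0 (real n) \<Longrightarrow> inner_cutoff U n x = 0"
  by (auto simp: inner_cutoff_def)

lemma inner_cutoff_le_indicator: "inner_cutoff U n x \<le> indicator U x"
  using inner_cutoff_range[of U n x] inner_cutoff_outside[of x U n] by (auto simp: indicator_def)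

lemma csc_inner_cutoff: "csc (inner_cutoff U n)"
proof -
  have "continuous_on UNIV (inner_cutoff U n)"
    unfolding inner_cutoff_def by (intro continuous_intros)
  moreover have "\<forall>x. inner_cutoff U n x \<noteq> 0 \<longrightarrow> norm x \<le> real n"
  proof (intro allI impI)
    fix x :: 'a assume "inner_cutoff U n x \<noteq> 0"
    then have "x \<in> U \<inter> ball 0 (real n)" by (metis inner_cutoff_outside)
    then show "norm x \<le> real n" by simp
  qed
  ultimately show ?thesis by (auto simp: csc_iff)
qed

lemma inner_cutoff_mono:
  assumes "m \<le> n" shows "inner_cutoff U m x \<le> inner_cutoff U n x"
proof -
  have "infdist x (- (U \<inter> ball 0 (real m))) \<le> infdist x (- (U \<inter> ball 0 (real n)))"
    using assms by (intro infdist_mono compl_Int_ball_nonempty) auto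
  then have "real m * infdist x (- (U \<inter> ball 0 (real m))) \<le> real n * infdist x (- (U \<inter> ball 0 (real n)))"
    using assms by (intro mult_mono) (auto simp: infdist_nonneg)
  then show ?thesis by (auto simp: inner_cutoff_def)
qed

text \<open>Together with monotonicity in \<open>n\<close>, this exhibits the indicator of every open set as an increasing limit of test functions.\<close>
lemma inner_cutoff_eventually_1:
  assumes "open U" "x \<in> U"
  shows "\<forall>\<^sub>F n in sequentially. inner_cutoff U n x = 1"
proof -
  obtain d where d: "d > 0" "ball x d \<subseteq> U" using assms openE by blast
  obtain n0 :: nat where n0: "real n0 \<ge> norm x + d" using real_arch_simple by blast
  obtain n1 :: nat where n1: "real n1 \<ge> 2 / d" using real_arch_simple by blast
  have "inner_cutoff U n x = 1" if n: "n \<ge> max n0 n1" for n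
  proof -
    have "d \<le> infdist x (- (U \<inter> ball 0 (real n)))"
      unfolding infdist_notempty[OF compl_Int_ball_nonempty]
    proof (rule cINF_greatest)
      fix y assume y: "y \<in> - (U \<inter> ball 0 (real n))"
      show "d \<le> dist x y"
      proof (rule ccontr)
        assume "\<not> d \<le> dist x y"
        then have *: "dist x y < d" by simp
        then have "y \<in> U" using d by auto
        moreover have "norm y < real n"
          using * n n0 norm_triangle_ineq2[of y x] by (simp add: dist_norm norm_minus_commute)
        ultimately show False using y by auto
      qed
    qed (rule compl_Int_ball_nonempty)
    moreover have "2 \<le> real n * d" using n n1 d by (simp add: field_simps) (smt (verit) mult_left_mono of_nat_le_iff)
    ultimately have "2 \<le> real n * infdist x (- (U \<inter> ball 0 (real n)))"
      by (smt (verit) mult_left_mono of_nat_0_le_iff)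
    then show ?thesis by (auto simp: inner_cutoff_def)
  qed
  then show ?thesis unfolding eventually_sequentially by blast
qed

section \<open>The Riesz representation theorem\<close>

locale positive_functional =
  fixes L :: "('a::euclidean_space \<Rightarrow> real) \<Rightarrow> real"
  assumes L_add: "csc f \<Longrightarrow> csc g \<Longrightarrow>
      L (\<lambda>x. f x + g x) = L f + L g"
    and L_scale: "csc f \<Longrightarrow> L (\<lambda>x. c * f x) = c * L f"
    and L_nonneg: "csc f \<Longrightarrow> (\<And>x. 0 \<le> f x) \<Longrightarrow> 0 \<le> L f"
begin

lemma L_diff:
  "csc f \<Longrightarrow> csc g \<Longrightarrow>
    L (\<lambda>x. f x - g x) = L f - L g"
  using L_add[of f "\<lambda>x. -1 * g x"] L_scale[of g "-1"] csc_scale[of g "-1"] by simp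

lemma L_mono:
  assumes "csc f" "csc g" "\<And>x. f x \<le> g x"
  shows "L f \<le> L g"
  using L_nonneg[OF csc_diff[OF assms(2,1)]] L_diff[OF assms(2,1)] assms(3) by simp

lemma L_zero: "L (\<lambda>x. 0) = 0"
  using L_scale[OF csc_zero, of 0] by simp

lemma L_sum:
  assumes "\<And>i. i \<in> I \<Longrightarrow> csc (f i)"
  shows "L (\<lambda>x. \<Sum>i\<in>I. f i x) = (\<Sum>i\<in>I. L (f i))"
  using assms by (induction I rule: infinite_finite_induct) (auto simp: L_zero L_add csc_sum)

text \<open>Dini's argument: on the compact support of \<open>f 0\<close> the convergence is uniform, hence \<open>f n \<le> e h\<close>
  with one test function \<open>h\<close>, and the functional is monotone. This is the only source of countable
  additivity of the representing measure.\<close>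
lemma L_Dini:
  assumes csc: "\<And>n. csc (f n)"
    and nonneg: "\<And>n x. 0 \<le> f n x"
    and dec: "\<And>m n x. m \<le> n \<Longrightarrow> f n x \<le> f m x"
    and lim: "\<And>x. (\<lambda>n. f n x) \<longlonglongrightarrow> 0"
  shows "(\<lambda>n. L (f n)) \<longlonglongrightarrow> 0"
proof (rule LIMSEQ_I)
  fix r :: real assume "r > 0"
  obtain R where R: "\<And>x. f 0 x \<noteq> 0 \<Longrightarrow> norm x \<le> R" using csc[of 0] by (auto simp: csc_iff)
  define h :: "'a \<Rightarrow> real" where "h = plateau R"
  have h: "csc h" "\<And>x. 0 \<le> h x" "\<And>x. norm x \<le> R \<Longrightarrow> h x = 1"
    unfolding h_def by (auto simp: plateau)
  have Lh: "0 \<le> L h" using h by (intro L_nonneg) auto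
  define e where "e = r / (2 * (L h + 1))"
  have e: "e > 0" using \<open>r > 0\<close> Lh by (simp add: e_def)
  have fopen: "open {x. f n x < e}" for n
    using csc[of n] by (intro open_Collect_less) (auto simp: csc_iff)
  have cover: "cball 0 R \<subseteq> (\<Union>n\<in>UNIV. {x. f n x < e})"
  proof
    fix x have "\<forall>\<^sub>F n in sequentially. f n x < e" using lim[of x] e by (rule order_tendstoD)
    then show "x \<in> (\<Union>n\<in>UNIV. {x. f n x < e})" by (auto simp: eventually_sequentially)
  qed
  obtain F where F: "finite F" "cball 0 R \<subseteq> (\<Union>n\<in>F. {x. f n x < e})"
    by (rule compactE_image[OF compact_cball _ cover]) (use fopen in auto)
  define N where "N = Max (insert 0 F)"
  have small: "f n x \<le> e * h x" if "n \<ge> N" for n x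
  proof (cases "norm x \<le> R")
    case True
    then obtain m where "m \<in> F" "f m x < e" using F by auto
    moreover from this have "m \<le> n" using F that by (auto simp: N_def)
    ultimately have "f n x < e" using dec[of m n x] by linarith
    then show ?thesis using h(3)[OF True] by simp
  next
    case False
    then have "f 0 x = 0" using R by blast
    then have "f n x \<le> 0" using dec[of 0 n x] by simp
    then show ?thesis using e h(2)[of x] by (smt (verit) mult_nonneg_nonneg)
  qed
  have "norm (L (f n) - 0) < r" if "n \<ge> N" for n
  proof -
    have "L (f n) \<le> e * L h"
      using L_mono[OF csc[of n] csc_scale[OF h(1)] small[OF that]] L_scale[OF h(1)] by simp
    also have "\<dots> < r" using \<open>r > 0\<close> Lh by (simp add: e_def field_simps add_nonneg_pos)
    finally show ?thesis using L_nonneg[OF csc[of n] nonneg] by simp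
  qed
  then show "\<exists>no. \<forall>n\<ge>no. norm (L (f n) - 0) < r" by blast
qed

text \<open>The cutoffs increase to the indicator of \<open>U\<close>, so this is the value that any representing measure must have on an open set \<open>U\<close>.\<close>
definition content_open :: "'a set \<Rightarrow> ennreal" where
  "content_open U = (SUP n. ennreal (L (inner_cutoff U n)))"

text \<open>Countable subadditivity on open sets, in functional form: the part of \<open>f\<close> that is not yet covered
  by the first \<open>m\<close> cutoffs decreases to 0 pointwise, so Dini's argument applies to it.\<close>
lemma L_le_suminf_content:
  assumes f: "csc f"
    and le: "\<And>x. f x \<le> indicator (\<Union>i. U i) x" and opn: "\<And>i::nat. open (U i)"
  shows "ennreal (L f) \<le> (\<Sum>i. content_open (U i))"
proof -
  define s where "s m x = (\<Sum>i<m. inner_cutoff (U i) m x)" for m x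
  define g where "g m x = max 0 (f x - s m x)" for m x
  have cs: "csc (s m)" for m
    unfolding s_def by (intro csc_sum csc_inner_cutoff)
  have cg: "csc (g m)" for m
    unfolding g_def by (intro csc_pos csc_diff f cs)
  have s_mono: "s m x \<le> s n x" if "m \<le> n" for m n x
  proof -
    have "s m x \<le> (\<Sum>i<m. inner_cutoff (U i) n x)"
      unfolding s_def by (intro sum_mono inner_cutoff_mono that)
    also have "\<dots> \<le> s n x"
      unfolding s_def using that by (intro sum_mono2) (auto simp: inner_cutoff_range)
    finally show ?thesis .
  qed
  have s_nonneg: "0 \<le> s m x" for m x unfolding s_def by (intro sum_nonneg) (auto simp: inner_cutoff_range)
  have lim: "(\<lambda>m. g m x) \<longlonglongrightarrow> 0" for x
  proof (cases "x \<in> (\<Union>i. U i)")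
    case True
    then obtain j where j: "x \<in> U j" by auto
    have "\<forall>\<^sub>F m in sequentially. g m x = 0"
      using inner_cutoff_eventually_1[OF opn j] eventually_gt_at_top[of j]
    proof eventually_elim
      case (elim m)
      have "inner_cutoff (U j) m x \<le> s m x"
        unfolding s_def using elim by (intro member_le_sum) (auto simp: inner_cutoff_range)
      then have "f x \<le> s m x" using elim le[of x] True by (simp add: indicator_def)
      then show ?case by (simp add: g_def)
    qed
    then show ?thesis by (rule tendsto_eventually)
  next
    case False
    then have "f x \<le> 0" using le[of x] by simp
    then have "g m x = 0" for m using s_nonneg[of m x] by (auto simp: g_def)
    then show ?thesis by simp
  qed
  have Lg: "(\<lambda>m. L (g m)) \<longlonglongrightarrow> 0"
  proof (rule L_Dini[OF cg _ _ lim])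
    show "0 \<le> g n x" for n x by (simp add: g_def)
    show "g n x \<le> g m x" if "m \<le> n" for m n x using s_mono[OF that, of x] by (simp add: g_def)
  qed
  have bound: "ennreal (L f) \<le> (\<Sum>i. content_open (U i)) + ennreal (L (g m))" for m
  proof -
    have "L f \<le> L (\<lambda>x. s m x + g m x)"
      by (rule L_mono[OF f csc_add[OF cs cg]]) (auto simp: g_def)
    also have "\<dots> = (\<Sum>i<m. L (inner_cutoff (U i) m)) + L (g m)"
      unfolding L_add[OF cs cg] unfolding s_def by (simp add: L_sum csc_inner_cutoff)
    finally have "ennreal (L f) \<le> ennreal ((\<Sum>i<m. L (inner_cutoff (U i) m)) + L (g m))"
      by (rule ennreal_leI)
    also have "\<dots> = (\<Sum>i<m. ennreal (L (inner_cutoff (U i) m))) + ennreal (L (g m))"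
    proof -
      have nn: "0 \<le> L (inner_cutoff (U i) m)" for i
        by (intro L_nonneg csc_inner_cutoff inner_cutoff_range)
      have "0 \<le> L (g m)" by (intro L_nonneg cg) (simp add: g_def)
      then show ?thesis using nn by (simp add: ennreal_plus sum_nonneg sum_ennreal)
    qed
    also have "\<dots> \<le> (\<Sum>i<m. content_open (U i)) + ennreal (L (g m))"
      by (intro add_right_mono sum_mono) (auto simp: content_open_def intro: SUP_upper)
    also have "\<dots> \<le> (\<Sum>i. content_open (U i)) + ennreal (L (g m))"
      by (intro add_right_mono sum_le_suminf) auto
    finally show ?thesis .
  qed
  have "(\<lambda>m. (\<Sum>i. content_open (U i)) + ennreal (L (g m))) \<longlonglongrightarrow> (\<Sum>i. content_open (U i)) + ennreal 0"
    by (intro tendsto_add tendsto_const tendsto_ennrealI Lg)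
  then show ?thesis using bound by (intro LIMSEQ_le_const) auto
qed

lemma content_open_empty: "content_open {} = 0"
proof -
  have "inner_cutoff {} n = (\<lambda>x::'a. 0)" for n by (auto simp: inner_cutoff_outside)
  then show ?thesis by (simp add: content_open_def L_zero)
qed

lemma L_le_content:
  assumes "csc f" "\<And>x. f x \<le> indicator U x" "open U"
  shows "ennreal (L f) \<le> content_open U"
proof -
  have "ennreal (L f) \<le> (\<Sum>i. content_open (if i = 0 then U else {}))"
  proof (rule L_le_suminf_content[OF assms(1)])
    have "(\<Union>i. if i = (0::nat) then U else {}) = U" by auto
    then show "f x \<le> indicator (\<Union>i. if i = (0::nat) then U else {}) x" for x
      using assms(2)[of x] by simp
  qed (use assms in auto)
  also have "\<dots> = content_open U"
    by (subst suminf_finite[of "{0}"]) (auto simp: content_open_empty)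
  finally show ?thesis .
qed

lemma content_le_L:
  assumes "csc f" "\<And>x. indicator U x \<le> f x"
  shows "content_open U \<le> ennreal (L f)"
  unfolding content_open_def
  by (intro SUP_least ennreal_leI L_mono csc_inner_cutoff assms(1))
    (meson assms(2) inner_cutoff_le_indicator order_trans)

lemma content_open_mono:
  assumes "U \<subseteq> V" "open V" shows "content_open U \<le> content_open V"
  unfolding content_open_def[of U]
proof (intro SUP_least L_le_content csc_inner_cutoff assms(2))
  fix n x show "inner_cutoff U n x \<le> indicator V x"
    by (rule order_trans[OF inner_cutoff_le_indicator]) (use assms(1) in \<open>auto simp: indicator_def\<close>)
qed

lemma content_open_UN:
  assumes "\<And>i::nat. open (U i)"
  shows "content_open (\<Union>i. U i) \<le> (\<Sum>i. content_open (U i))"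
  unfolding content_open_def[of "\<Union>i. U i"]
  by (intro SUP_least L_le_suminf_content csc_inner_cutoff assms inner_cutoff_le_indicator)

definition outer_content :: "'a set \<Rightarrow> ennreal" where
  "outer_content A = (INF U\<in>{U. open U \<and> A \<subseteq> U}. content_open U)"

lemma outer_content_le: "open U \<Longrightarrow> A \<subseteq> U \<Longrightarrow> outer_content A \<le> content_open U"
  unfolding outer_content_def by (rule INF_lower) auto

lemma outer_content_open: "open U \<Longrightarrow> outer_content U = content_open U"
  by (intro antisym outer_content_le) (auto simp: outer_content_def intro!: INF_greatest content_open_mono)

lemma outer_content_mono: "A \<subseteq> B \<Longrightarrow> outer_content A \<le> outer_content B"
  unfolding outer_content_def by (rule INF_superset_mono) auto

lemma outer_content_UN:
  fixes A :: "nat \<Rightarrow> 'a set"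
  shows "outer_content (\<Union>i. A i) \<le> (\<Sum>i. outer_content (A i))"
proof (cases "\<exists>i. outer_content (A i) = \<infinity>")
  case True
  then obtain i where "outer_content (A i) = \<infinity>" by auto
  moreover have "outer_content (A i) \<le> (\<Sum>i. outer_content (A i))"
    using sum_le_suminf[of "\<lambda>i. outer_content (A i)" "{i}"] by simp
  ultimately show ?thesis by (simp add: top_unique)
next
  case False
  show ?thesis
  proof (rule ennreal_le_epsilon)
    fix e :: real assume e: "0 < e"
    have "\<exists>U. open U \<and> A i \<subseteq> U \<and> content_open U \<le> outer_content (A i) + ennreal (e * (1/2) ^ Suc i)" for i
    proof -
      have "0 < ennreal (e * (1/2) ^ Suc i)" using e by simp
      then have "\<exists>U\<in>{U. open U \<and> A i \<subseteq> U}. content_open U < outer_content (A i) + ennreal (e * (1/2) ^ Suc i)"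
        using False by (intro INF_approx_ennreal) (auto simp: outer_content_def)
      then show ?thesis by (auto intro: less_imp_le)
    qed
    then obtain U where U: "\<And>i. open (U i)" "\<And>i. A i \<subseteq> U i"
      "\<And>i. content_open (U i) \<le> outer_content (A i) + ennreal (e * (1/2) ^ Suc i)" by metis
    have "outer_content (\<Union>i. A i) \<le> content_open (\<Union>i. U i)"
      using U by (intro outer_content_le) blast+
    also have "\<dots> \<le> (\<Sum>i. content_open (U i))" by (intro content_open_UN U)
    also have "\<dots> \<le> (\<Sum>i. outer_content (A i) + ennreal (e * (1/2) ^ Suc i))"
      by (intro suminf_le U) auto
    also have "\<dots> = (\<Sum>i. outer_content (A i)) + (\<Sum>i. ennreal (e * (1/2) ^ Suc i))"
      by (intro suminf_add[symmetric]) auto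
    also have "(\<Sum>i. ennreal (e * (1/2) ^ Suc i)) = ennreal e"
      using sums_mult[OF power_half_series, of e] e by (intro suminf_ennreal_eq) auto
    finally show "outer_content (\<Union>i. A i) \<le> (\<Sum>i. outer_content (A i)) + ennreal e" .
  qed
qed

lemma outer_measure_space_outer_content: "outer_measure_space (Pow UNIV) outer_content"
  unfolding outer_measure_space_def
proof (intro conjI)
  show "positive (Pow UNIV) outer_content"
    by (simp add: positive_def outer_content_open content_open_empty)
  show "increasing (Pow UNIV) outer_content"
    by (auto simp: increasing_def intro: outer_content_mono)
  show "countably_subadditive (Pow UNIV) outer_content"
    by (auto simp: countably_subadditive_def intro: outer_content_UN)
qed

text \<open>This is the additivity that makes open sets measurable in Caratheodory's sense. A cutoff of
  \<open>W \<inter> U\<close> is supported in a closed set \<open>K \<subseteq> W \<inter> U\<close>, while \<open>W - K\<close> is open and contains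
  \<open>W - U\<close>; a cutoff of \<open>W - K\<close> may be added without exceeding the indicator of \<open>W\<close>.\<close>
lemma content_open_split:
  assumes U: "open U" and W: "open W"
  shows "content_open (W \<inter> U) + outer_content (W - U) \<le> content_open W"
proof -
  have "ennreal (L (inner_cutoff (W \<inter> U) n)) + outer_content (W - U) \<le> content_open W" for n
  proof -
    let ?V = "W \<inter> U"
    define K where "K = {x. 1 \<le> real n * infdist x (- (?V \<inter> ball 0 (real n)))}"
    have "closed K" unfolding K_def by (intro closed_Collect_le continuous_intros)
    have KV: "K \<subseteq> ?V"
    proof
      fix x assume "x \<in> K"
      then have "infdist x (- (?V \<inter> ball 0 (real n))) \<noteq> 0" by (auto simp: K_def)
      then show "x \<in> ?V" by (metis ComplI IntE infdist_zero)
    qed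
    have out: "inner_cutoff ?V n x = 0" if "x \<notin> K" for x using that by (auto simp: K_def inner_cutoff_def)
    have "open (W - K)" using W \<open>closed K\<close> by (rule open_Diff)
    have "ennreal (L (inner_cutoff ?V n)) + ennreal (L (inner_cutoff (W - K) m)) \<le> content_open W" for m
    proof -
      have "ennreal (L (\<lambda>x. inner_cutoff ?V n x + inner_cutoff (W - K) m x)) \<le> content_open W"
      proof (rule L_le_content[OF csc_add[OF csc_inner_cutoff csc_inner_cutoff] _ W])
        fix x
        show "inner_cutoff ?V n x + inner_cutoff (W - K) m x \<le> indicator W x"
        proof (cases "x \<in> K")
          case True
          then show ?thesis using inner_cutoff_outside[of x "W - K" m] KV inner_cutoff_range[of ?V n x]
            by (auto simp: indicator_def)
        next
          case False
          then show ?thesis using out[OF False] inner_cutoff_le_indicator[of "W - K" m x]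
            by (auto simp: indicator_def)
        qed
      qed
      then show ?thesis
        by (simp add: L_add csc_inner_cutoff L_nonneg inner_cutoff_range flip: ennreal_plus)
    qed
    then have "ennreal (L (inner_cutoff ?V n)) + content_open (W - K) \<le> content_open W"
      unfolding content_open_def[of "W - K"]
      by (subst ennreal_SUP_add_right) (auto intro!: SUP_least)
    moreover have "outer_content (W - U) \<le> content_open (W - K)"
      using KV \<open>open (W - K)\<close> by (intro outer_content_le) auto
    ultimately show ?thesis by (meson add_left_mono order_trans)
  qed
  then show ?thesis
    unfolding content_open_def[of "W \<inter> U"]
    by (subst ennreal_SUP_add_left[symmetric]) (auto intro!: SUP_least)
qed

lemma open_in_lambda_system:
  assumes U: "open U" shows "U \<in> lambda_system UNIV (Pow UNIV) outer_content"
proof -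
  have "outer_content (U \<inter> A) + outer_content ((UNIV - U) \<inter> A) = outer_content A" for A
  proof (rule antisym)
    show "outer_content (U \<inter> A) + outer_content ((UNIV - U) \<inter> A) \<le> outer_content A"
      unfolding outer_content_def[of A]
    proof (rule INF_greatest, clarify)
      fix W assume W: "open W" "A \<subseteq> W"
      have "outer_content (U \<inter> A) + outer_content ((UNIV - U) \<inter> A) \<le> content_open (W \<inter> U) + outer_content (W - U)"
        using W U by (intro add_mono outer_content_le outer_content_mono) auto
      also have "\<dots> \<le> content_open W" by (rule content_open_split[OF U W(1)])
      finally show "outer_content (U \<inter> A) + outer_content ((UNIV - U) \<inter> A) \<le> content_open W" .
    qed
    define B where "B i = (if i = 0 then U \<inter> A else if i = Suc 0 then (UNIV - U) \<inter> A else {})" for i :: nat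
    have "outer_content A \<le> outer_content (\<Union>i. B i)"
    proof (rule outer_content_mono)
      have "U \<inter> A \<subseteq> B 0" "(UNIV - U) \<inter> A \<subseteq> B (Suc 0)" by (auto simp: B_def)
      then show "A \<subseteq> (\<Union>i. B i)" by blast
    qed
    also have "\<dots> \<le> (\<Sum>i. outer_content (B i))" by (rule outer_content_UN)
    also have "\<dots> = outer_content (U \<inter> A) + outer_content ((UNIV - U) \<inter> A)"
      by (subst suminf_finite[of "{0, Suc 0}"]) (auto simp: B_def outer_content_open content_open_empty)
    finally show "outer_content A \<le> outer_content (U \<inter> A) + outer_content ((UNIV - U) \<inter> A)" .
  qed
  then show ?thesis by (auto simp: lambda_system_def)
qed

definition riesz_measure :: "'a measure" where
  "riesz_measure = measure_of UNIV (sets borel) outer_content"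

lemma riesz_measure_sets: "sets riesz_measure = sets borel"
  unfolding riesz_measure_def by (metis sets.sets_measure_of_eq space_borel)

text \<open>Open sets are Caratheodory measurable and generate the Borel sets, so the outer measure is a measure there.\<close>
lemma riesz_measure_open: assumes "open U" shows "emeasure riesz_measure U = content_open U"
proof -
  interpret sigma_algebra UNIV "Pow (UNIV::'a set)" by (rule sigma_algebra_Pow)
  have ms: "measure_space UNIV (lambda_system UNIV (Pow UNIV) outer_content) outer_content"
    by (rule caratheodory_lemma[OF outer_measure_space_outer_content])
  then have sa: "sigma_algebra UNIV (lambda_system UNIV (Pow UNIV) outer_content)"
    by (simp add: measure_space_def)
  have "sigma_sets UNIV (Collect open) \<subseteq> lambda_system UNIV (Pow UNIV) outer_content"
    by (intro sigma_algebra.sigma_sets_subset[OF sa]) (use open_in_lambda_system in blast)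
  then have "sets borel \<subseteq> lambda_system UNIV (Pow UNIV) outer_content"
    unfolding borel_def by (simp add: sets_measure_of)
  then have "measure_space UNIV (sets borel) outer_content"
    using measure_down[OF ms _] sets.sigma_algebra_axioms[of borel] by (simp add: space_borel)
  then have "emeasure riesz_measure U = outer_content U"
    unfolding riesz_measure_def using assms
    by (intro emeasure_measure_of_sigma) (auto simp: measure_space_def)
  then show ?thesis using assms by (simp add: outer_content_open)
qed

text \<open>Cutting \<open>f\<close> into horizontal slices of height \<open>d\<close> encloses \<open>L f\<close> between two sums that depend only on
  the values of \<open>m\<close> on the superlevel sets of \<open>f\<close> and that differ by at most \<open>d\<close> times one of these
  values. Two functionals with the same \<open>m\<close> therefore agree. The lemma is applied to the given
  functional and to integration with respect to its measure.\<close>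
lemma layer_cake_bounds:
  fixes m :: "'a set \<Rightarrow> real"
  assumes upper: "\<And>U f. open U \<Longrightarrow> bounded U \<Longrightarrow> csc f \<Longrightarrow>
      (\<And>x. f x \<le> indicator U x) \<Longrightarrow> L f \<le> m U"
    and lower: "\<And>U f. open U \<Longrightarrow> bounded U \<Longrightarrow> csc f \<Longrightarrow>
      (\<And>x. indicator U x \<le> f x) \<Longrightarrow> m U \<le> L f"
    and f: "csc f" "\<And>x. 0 \<le> f x" and d: "d > 0" and n: "\<And>x. f x \<le> real n * d"
  shows "L f \<le> (\<Sum>k<n. d * m {x. f x > real k * d})"
    and "(\<Sum>k<n. d * m {x. f x > real (Suc k) * d}) \<le> L f"
proof -
  define g where "g k x = min d (max 0 (f x - real k * d))" for k x
  have cg: "csc (g k)" for k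
    unfolding g_def using d
    by (intro csc_compose[OF f(1), where h = "\<lambda>y. min d (max 0 (y - real k * d))"] continuous_intros) auto
  have sum_g: "(\<Sum>k<j. g k x) = min (f x) (real j * d)" for j x
  proof (induction j)
    case 0 then show ?case using f(2)[of x] by simp
  next
    case (Suc j) then show ?case using d by (auto simp: g_def algebra_simps min_def max_def)
  qed
  have "f = (\<lambda>x. \<Sum>k<n. g k x)" using sum_g n by (auto simp: min_def fun_eq_iff intro: antisym)
  then have Lf: "L f = (\<Sum>k<n. L (g k))" using L_sum[of "{..<n}" g] cg by simp
  have opn: "open {x. f x > real k * d}" for k
    using f(1) by (intro open_Collect_less) (auto simp: csc_iff)
  have bnd: "bounded {x. f x > real k * d}" for k
  proof -
    obtain R where R: "\<And>x. f x \<noteq> 0 \<Longrightarrow> norm x \<le> R" using f(1) by (auto simp: csc_iff)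
    have "norm x \<le> R" if "f x > real k * d" for x
      using that d by (intro R) (smt (verit) mult_nonneg_nonneg of_nat_0_le_iff)
    then show ?thesis unfolding bounded_iff by auto
  qed
  have gd: "csc (\<lambda>x. 1 / d * g k x)" "L (\<lambda>x. 1 / d * g k x) = L (g k) / d" for k
    using csc_scale[OF cg, of "1/d"] L_scale[OF cg, of "1/d"] by auto
  have "L (g k) \<le> d * m {x. f x > real k * d}" for k
  proof -
    have "L (\<lambda>x. 1 / d * g k x) \<le> m {x. f x > real k * d}"
      using d by (intro upper opn bnd gd) (auto simp: g_def indicator_def field_simps)
    then have "L (g k) / d \<le> m {x. f x > real k * d}" unfolding gd(2) .
    then show ?thesis using d by (simp add: pos_divide_le_eq mult.commute)
  qed
  then show "L f \<le> (\<Sum>k<n. d * m {x. f x > real k * d})" unfolding Lf by (intro sum_mono)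
  have "d * m {x. f x > real (Suc k) * d} \<le> L (g k)" for k
  proof -
    have "m {x. f x > real (Suc k) * d} \<le> L (\<lambda>x. 1 / d * g k x)"
      using d by (intro lower opn bnd gd) (auto simp: g_def indicator_def field_simps)
    then have "m {x. f x > real (Suc k) * d} \<le> L (g k) / d" unfolding gd(2) .
    then show ?thesis using d by (simp add: pos_le_divide_eq mult.commute)
  qed
  then show "(\<Sum>k<n. d * m {x. f x > real (Suc k) * d}) \<le> L f" unfolding Lf by (intro sum_mono)
qed

lemma riesz_measure_bounded_open:
  assumes U: "open U" "bounded U" shows "emeasure riesz_measure U < \<infinity>"
proof -
  obtain R where R: "\<And>x. x \<in> U \<Longrightarrow> norm x \<le> R" using U(2) unfolding bounded_iff by auto
  have "content_open U \<le> ennreal (L (plateau R))"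
    by (intro content_le_L plateau) (auto simp: indicator_def plateau R)
  then show ?thesis using U by (simp add: riesz_measure_open order_le_less_trans)
qed

end

lemma csc_bounded:
  fixes f :: "'a::euclidean_space \<Rightarrow> real"
  assumes "csc f"
  obtains R B where "R > 0" "B > 0" "\<And>x. \<bar>f x\<bar> \<le> B" "\<And>x. f x \<noteq> 0 \<Longrightarrow> norm x \<le> R"
proof -
  obtain R where R: "\<And>x. f x \<noteq> 0 \<Longrightarrow> norm x \<le> R" using assms by (auto simp: csc_iff)
  have "compact (f ` cball 0 R)"
    using assms by (intro compact_continuous_image) (auto simp: csc_iff intro: continuous_on_subset)
  from compact_imp_bounded[OF this]
  obtain B where B: "\<And>x. x \<in> cball 0 R \<Longrightarrow> \<bar>f x\<bar> \<le> B"
    unfolding bounded_iff by fastforce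
  show ?thesis
  proof
    show "\<bar>f x\<bar> \<le> max B 1" for x
      using B[of x] R[of x] by (cases "f x = 0") (auto simp: max_def)
    show "norm x \<le> max R 1" if "f x \<noteq> 0" for x using R[OF that] by simp
  qed auto
qed

lemma radon_measureD:
  assumes "radon_measure M"
  shows "sets M = sets borel" "compact K \<Longrightarrow> emeasure M K < \<infinity>"
    "A \<in> sets borel \<Longrightarrow> emeasure M A = (SUP K\<in>{K. compact K \<and> K \<subseteq> A}. emeasure M K)"
  by (rule assms[unfolded radon_measure_def, THEN conjunct1]
      assms[unfolded radon_measure_def, THEN conjunct2, THEN conjunct1, rule_format]
      assms[unfolded radon_measure_def, THEN conjunct2, THEN conjunct2, rule_format]; assumption)+

lemma radon_measure_integrable:
  assumes M: "radon_measure M" and f: "csc f"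
  shows "integrable M f"
proof -
  obtain R B where RB: "R > 0" "B > 0" "\<And>x. \<bar>f x\<bar> \<le> B" "\<And>x. f x \<noteq> 0 \<Longrightarrow> norm x \<le> R"
    by (rule csc_bounded[OF f]) blast
  have sets: "sets M = sets borel" using radon_measureD(1)[OF M] by simp
  show ?thesis
  proof (rule integrableI_bounded_set[where A = "cball 0 R" and B = B])
    show "f \<in> borel_measurable M"
      using f sets by (auto simp: csc_iff cong: measurable_cong_sets intro: borel_measurable_continuous_onI)
    show "emeasure M (cball 0 R) < \<infinity>" by (rule radon_measureD(2)[OF M]) simp
    show "AE x in M. x \<in> cball 0 R \<longrightarrow> norm (f x) \<le> B" using RB by auto
    show "AE x in M. x \<notin> cball 0 R \<longrightarrow> f x = 0" using RB by fastforce
  qed (auto simp: sets)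
qed

text \<open>Finite Borel measures on a Euclidean space are inner regular; the general case follows by restriction to an increasing sequence of closed balls.\<close>
lemma radon_measureI:
  fixes M :: "'a::euclidean_space measure"
  assumes sets: "sets M = sets borel" and fin: "\<And>R. emeasure M (cball 0 R) < \<infinity>"
  shows "radon_measure M"
  unfolding radon_measure_def
proof (intro conjI allI impI ballI)
  show "sets M = sets borel" by fact
  have space: "space M = UNIV" using sets by (metis sets_eq_imp_space_eq space_borel)
  show "emeasure M K < \<infinity>" if K: "compact K" for K
  proof -
    obtain R where "\<And>x. x \<in> K \<Longrightarrow> norm x \<le> R"
      using compact_imp_bounded[OF K] unfolding bounded_iff by auto
    then have "K \<subseteq> cball 0 R" by auto
    then have "emeasure M K \<le> emeasure M (cball 0 R)" by (intro emeasure_mono) (auto simp: sets)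
    then show ?thesis using fin[of R] by (rule order_le_less_trans)
  qed
  fix A :: "'a set" assume A: "A \<in> sets borel"
  let ?S = "SUP K\<in>{K. compact K \<and> K \<subseteq> A}. emeasure M K"
  show "emeasure M A = ?S"
  proof (rule antisym)
    show "?S \<le> emeasure M A" using A by (intro SUP_least emeasure_mono) (auto simp: sets)
    have "emeasure M (A \<inter> cball 0 (real n)) \<le> ?S" for n
    proof -
      define N where "N = density M (indicator (cball 0 (real n)))"
      have sN: "sets N = sets borel" by (simp add: N_def sets)
      have N: "emeasure N B = emeasure M (B \<inter> cball 0 (real n))" if B: "B \<in> sets borel" for B
      proof -
        have "emeasure N B = (\<integral>\<^sup>+ x. indicator (B \<inter> cball 0 (real n)) x \<partial>M)"
          unfolding N_def indicator_inter_arith using B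
          by (subst emeasure_density) (simp_all add: sets mult.commute borel_measurable_indicator)
        then show ?thesis using B sets by (simp add: nn_integral_indicator)
      qed
      have "emeasure N (space N) = emeasure M (cball 0 (real n))"
        using N[of UNIV] by (simp add: N_def space)
      then have "emeasure N (space N) \<noteq> \<infinity>" using fin[of "real n"] by simp
      then have "emeasure N A = (SUP K\<in>{K. K \<subseteq> A \<and> compact K}. emeasure N K)"
        by (intro inner_regular sN A)
      also have "\<dots> \<le> ?S"
      proof (rule SUP_least, clarify)
        fix K assume K: "K \<subseteq> A" "compact K"
        have "emeasure N K = emeasure M (K \<inter> cball 0 (real n))" using K by (intro N borel_compact)
        also have "\<dots> \<le> ?S" using K by (intro SUP_upper) (auto intro: compact_Int)
        finally show "emeasure N K \<le> ?S" .
      qed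
      finally show ?thesis using N[OF A] by simp
    qed
    then have "(SUP n. emeasure M (A \<inter> cball 0 (real n))) \<le> ?S" by (rule SUP_least)
    moreover have "(SUP n. emeasure M (A \<inter> cball 0 (real n))) = emeasure M (\<Union>n. A \<inter> cball 0 (real n))"
      using A by (intro SUP_emeasure_incseq) (auto simp: sets incseq_def)
    moreover have "(\<Union>n. A \<inter> cball 0 (real n)) = A" using real_arch_simple by auto
    ultimately show "emeasure M A \<le> ?S" by simp
  qed
qed

theorem riesz_representation:
  fixes L :: "('a::euclidean_space \<Rightarrow> real) \<Rightarrow> real"
  assumes "positive_functional L"
  shows "\<exists>M. radon_measure M \<and> (\<forall>f. csc f \<longrightarrow> L f = (LINT x|M. f x))"
proof -
  interpret positive_functional L by fact
  define M where "M = riesz_measure"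
  have sets: "sets M = sets borel" unfolding M_def by (rule riesz_measure_sets)
  have finU: "emeasure M U < \<infinity>" if "open U" "bounded U" for U
    unfolding M_def using that by (rule riesz_measure_bounded_open)
  have radon: "radon_measure M"
  proof (rule radon_measureI[OF sets])
    fix R :: real
    have "emeasure M (cball 0 R) \<le> emeasure M (ball 0 (R + 1))" by (intro emeasure_mono) (auto simp: sets)
    also have "\<dots> < \<infinity>" by (rule finU) auto
    finally show "emeasure M (cball 0 R) < \<infinity>" .
  qed
  let ?I = "\<lambda>f. LINT x|M. f x"
  interpret I: positive_functional ?I
    by standard (auto simp: radon_measure_integrable[OF radon])
  have content: "content_open U = ennreal (measure M U)" if "open U" "bounded U" for U
    using finU[OF that] riesz_measure_open[OF that(1)] by (simp add: M_def measure_def)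
  have upper: "L f \<le> measure M U"
    if "open U" "bounded U" "csc f" "\<And>x. f x \<le> indicator U x" for U f
    using L_le_content[OF that(3,4,1)] content[OF that(1,2)] by (simp add: ennreal_le_iff)
  have lower: "measure M U \<le> L f"
    if "open U" "bounded U" "csc f" "\<And>x. indicator U x \<le> f x" for U f
  proof -
    have "0 \<le> L f" by (rule L_nonneg[OF that(3)]) (meson indicator_pos_le order_trans that(4))
    then show ?thesis using content_le_L[OF that(3,4)] content[OF that(1,2)] by (simp add: ennreal_le_iff)
  qed
  have ind: "integrable M (indicator U :: _ \<Rightarrow> real)" if "open U" "bounded U" for U
    using finU[OF that] that(1) by (intro integrable_real_indicator) (auto simp: sets)
  have indm: "(LINT x|M. indicator U x) = measure M U" for U :: "'a set"
    using sets_eq_imp_space_eq[OF sets] by simp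
  have Iupper: "?I f \<le> measure M U"
    if "open U" "bounded U" "csc f" "\<And>x. f x \<le> indicator U x" for U f
    using integral_mono[OF radon_measure_integrable[OF radon that(3)] ind[OF that(1,2)]] that(4) indm by simp
  have Ilower: "measure M U \<le> ?I f"
    if "open U" "bounded U" "csc f" "\<And>x. indicator U x \<le> f x" for U f
    using integral_mono[OF ind[OF that(1,2)] radon_measure_integrable[OF radon that(3)]] that(4) indm by simp
  have nonneg_case: "L f = ?I f" if f: "csc f" "\<And>x. 0 \<le> f x" for f
  proof -
    obtain R B where RB: "R > 0" "B > 0" "\<And>x. \<bar>f x\<bar> \<le> B" "\<And>x. f x \<noteq> 0 \<Longrightarrow> norm x \<le> R"
      by (rule csc_bounded[OF f(1)]) blast
    \<comment> \<open>Both values lie between the same two slice sums, which differ by \<open>a 0 - a n\<close>.\<close>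
    have "\<bar>L f - ?I f\<bar> \<le> d * measure M {x. f x > 0}" if d: "d > 0" for d
    proof -
      obtain n :: nat where n: "real n \<ge> B / d" using real_arch_simple by blast
      have fn: "f x \<le> real n * d" for x using RB(3)[of x] n d by (simp add: field_simps)
      define a where "a k = d * measure M {x. f x > real k * d}" for k
      have "L f \<le> sum a {..<n}" "(\<Sum>k<n. a (Suc k)) \<le> L f"
        unfolding a_def by (rule layer_cake_bounds[where m = "measure M"]; fact upper lower f d fn)+
      moreover have "?I f \<le> sum a {..<n}" "(\<Sum>k<n. a (Suc k)) \<le> ?I f"
        unfolding a_def by (rule I.layer_cake_bounds[where m = "measure M"]; fact Iupper Ilower f d fn)+
      moreover have "sum a {..<n} - (\<Sum>k<n. a (Suc k)) = a 0 - a n"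
        by (simp add: sum_lessThan_telescope' sum_subtractf[symmetric])
      moreover have "0 \<le> a n" using d by (simp add: a_def)
      ultimately show ?thesis by (simp add: a_def)
    qed
    then have *: "\<bar>L f - ?I f\<bar> \<le> d * measure M {x. f x > 0}" if "d > 0" for d using that by blast
    have "((\<lambda>d. d * measure M {x. f x > 0}) \<longlongrightarrow> 0 * measure M {x. f x > 0}) (at_right 0)"
      by (intro tendsto_intros)
    then have "\<bar>L f - ?I f\<bar> \<le> 0 * measure M {x. f x > 0}"
      by (rule tendsto_lowerbound[OF _ eventually_mono[OF eventually_at_right_less]]) (use * in auto)
    then show ?thesis by simp
  qed
  have "L f = ?I f" if f: "csc f" for f
  proof -
    have m: "csc (\<lambda>x. - f x)" using csc_scale[OF f, of "-1"] by simp
    have eq: "f = (\<lambda>x. max 0 (f x) - max 0 (- f x))" by (simp add: fun_eq_iff max_def)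
    have "L f = L (\<lambda>x. max 0 (f x)) - L (\<lambda>x. max 0 (- f x))"
      using arg_cong[OF eq, of L] L_diff[OF csc_pos[OF f] csc_pos[OF m]] by (rule trans)
    moreover have "?I f = ?I (\<lambda>x. max 0 (f x)) - ?I (\<lambda>x. max 0 (- f x))"
      using arg_cong[OF eq, of ?I] I.L_diff[OF csc_pos[OF f] csc_pos[OF m]] by (rule trans)
    ultimately show ?thesis using nonneg_case[OF csc_pos[OF f]] nonneg_case[OF csc_pos[OF m]] by simp
  qed
  then show ?thesis using radon by blast
qed

text \<open>Inner regularity reduces the claim to compact sets, and the indicator of a compact set \<open>K\<close> is the
  limit of the test functions \<open>max 0 (1 - n dist(x, K))\<close>, all dominated by one plateau function.\<close>
lemma radon_measure_eqI:
  fixes M N :: "'a::euclidean_space measure"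
  assumes M: "radon_measure M" and N: "radon_measure N"
    and eq: "\<And>f. csc f \<Longrightarrow> (LINT x|M. f x) = (LINT x|N. f x)"
  shows "M = N"
proof (rule measure_eqI)
  show sets: "sets M = sets N" using radon_measureD(1)[OF M] radon_measureD(1)[OF N] by simp
  have lim: "(\<lambda>n. LINT x|Q. max 0 (1 - real (Suc n) * infdist x K)) \<longlonglongrightarrow> measure Q K"
    and csc: "csc (\<lambda>x. max 0 (1 - real (Suc n) * infdist x K))"
    if Q: "radon_measure Q" and K: "compact K" "K \<noteq> {}" for Q :: "'a measure" and K n
  proof -
    have sQ: "sets Q = sets borel" by (rule radon_measureD(1)[OF Q])
    have closed: "closed K" using K by (simp add: compact_imp_closed)
    obtain R where R: "\<And>x. x \<in> K \<Longrightarrow> norm x \<le> R"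
      using compact_imp_bounded[OF K(1)] unfolding bounded_iff by auto
    define g where "g n x = max 0 (1 - real (Suc n) * infdist x K)" for n x
    have g_cont: "continuous_on UNIV (g n)" for n unfolding g_def by (intro continuous_intros)
    have g_le: "g n x \<le> plateau R x" for n x
    proof -
      obtain y where y: "y \<in> K" "infdist x K = dist x y" using infdist_attains_inf[OF closed K(2)] by blast
      have "norm x \<le> R + infdist x K"
        using R[OF y(1)] norm_triangle_ineq2[of x y] by (simp add: y dist_norm)
      moreover have "infdist x K \<le> real (Suc n) * infdist x K"
        by (simp add: distrib_right infdist_nonneg)
      ultimately show ?thesis using infdist_nonneg[of x K] by (simp add: g_def plateau_def)
    qed
    have "norm x \<le> R + 1" if "g n x \<noteq> 0" for n x
      using g_le[of n x] that by (auto simp: plateau_def g_def max_def split: if_splits)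
    then show "csc (\<lambda>x. max 0 (1 - real (Suc n) * infdist x K))"
      using g_cont[of n] unfolding csc_iff g_def by blast
    have lim_g: "(\<lambda>n. g n x) \<longlonglongrightarrow> indicator K x" for x
    proof (cases "x \<in> K")
      case False
      then have pos: "infdist x K > 0"
        using K closed by (metis in_closed_iff_infdist_zero infdist_nonneg less_eq_real_def)
      obtain n0 :: nat where n0: "real n0 \<ge> 1 / infdist x K" using real_arch_simple by blast
      have "\<forall>\<^sub>F n in sequentially. g n x = 0"
        using eventually_ge_at_top[of n0]
      proof eventually_elim
        case (elim n)
        then have "real (Suc n) \<ge> 1 / infdist x K" using n0 by linarith
        then have "1 \<le> real (Suc n) * infdist x K" using pos by (simp add: pos_divide_le_eq)
        then show ?case by (simp add: g_def)
      qed
      then show ?thesis using False by (simp add: tendsto_eventually)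
    qed (simp add: g_def)
    have "(\<lambda>n. LINT x|Q. g n x) \<longlonglongrightarrow> (LINT x|Q. indicator K x)"
    proof (rule integral_dominated_convergence)
      show "(indicator K :: _ \<Rightarrow> real) \<in> borel_measurable Q"
        using closed sQ by (intro borel_measurable_indicator) auto
      show "g n \<in> borel_measurable Q" for n
        unfolding measurable_cong_sets[OF sQ refl] by (rule borel_measurable_continuous_onI[OF g_cont])
      show "integrable Q (plateau R)" by (intro radon_measure_integrable[OF Q] plateau)
      show "AE x in Q. (\<lambda>n. g n x) \<longlonglongrightarrow> indicator K x" using lim_g by simp
      have "norm (g n x) \<le> plateau R x" for n x using g_le[of n x] by (simp add: g_def)
      then show "AE x in Q. norm (g n x) \<le> plateau R x" for n by simp
    qed
    moreover have "space Q = UNIV" using sets_eq_imp_space_eq[OF sQ] by simp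
    ultimately show "(\<lambda>n. LINT x|Q. max 0 (1 - real (Suc n) * infdist x K)) \<longlonglongrightarrow> measure Q K"
      unfolding g_def by simp
  qed
  have compact_eq: "emeasure M K = emeasure N K" if "compact K" for K
  proof (cases "K = {}")
    case False
    have "measure M K = measure N K"
      using LIMSEQ_unique[OF lim[OF M that False]] lim[OF N that False] eq[OF csc[OF M that False]] by simp
    moreover have "emeasure M K < \<infinity>" "emeasure N K < \<infinity>"
      using radon_measureD(2)[OF M that] radon_measureD(2)[OF N that] by simp_all
    ultimately show ?thesis by (simp add: emeasure_eq_ennreal_measure)
  qed simp
  fix A assume "A \<in> sets M"
  then have A: "A \<in> sets borel" using radon_measureD(1)[OF M] by simp
  have "emeasure M A = (SUP K\<in>{K. compact K \<and> K \<subseteq> A}. emeasure M K)"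
    "emeasure N A = (SUP K\<in>{K. compact K \<and> K \<subseteq> A}. emeasure N K)"
    by (rule radon_measureD(3)[OF M A], rule radon_measureD(3)[OF N A])
  then show "emeasure M A = emeasure N A" using compact_eq by (simp cong: SUP_cong_simp)
qed

section \<open>Local mass bounds for supersolutions\<close>

lemma heat_kernel_nonneg: "0 \<le> heat_kernel x t"
  by (simp add: heat_kernel_def)

lemma heat_kernel_ge:
  fixes z :: "'a::euclidean_space"
  assumes "0 < a" "a \<le> h" "h \<le> b" "norm z \<le> r"
  shows "(4 * pi * b) powr (- (real DIM('a) / 2)) * exp (- (r\<^sup>2 / (4 * a))) \<le> heat_kernel z h"
proof -
  have "(norm z)\<^sup>2 / (4 * h) \<le> r\<^sup>2 / (4 * a)"
    using assms by (intro frac_le power_mono) auto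
  moreover have "(4 * pi * b) powr (- (real DIM('a) / 2)) \<le> (4 * pi * h) powr (- (real DIM('a) / 2))"
    using assms by (intro powr_mono2') auto
  ultimately show ?thesis unfolding heat_kernel_def by (intro mult_mono) auto
qed

text \<open>With \<open>s = sqrt (h/K) \<le> r\<close>, the ball of radius \<open>r\<close> around \<open>z\<close> contains a ball of radius \<open>s/2\<close>
  within distance \<open>s\<close> of \<open>x\<close>, even if \<open>x\<close> is close to the boundary. On that ball the kernel is of
  order \<open>s\<^sup>-\<^sup>N\<close>, so its integral there is bounded below independently of \<open>h\<close>.\<close>
lemma heat_mass_in_ball:
  assumes K: "K > 0"
  shows "\<exists>c>0. \<forall>(z::'a::euclidean_space) x r h. dist z x < r \<and> 0 < h \<and> h \<le> K * r\<^sup>2 \<longrightarrow>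
    ennreal c \<le> (\<integral>\<^sup>+ y. ennreal (heat_kernel (x - y) h) * indicator (ball z r) y \<partial>lebesgue)"
proof -
  let ?N = "real DIM('a)"
  define c where "c = exp (- (1 / (4 * K))) * (unit_ball_vol ?N * (1 / (16 * pi * K)) powr (?N / 2))"
  have "c > 0" using K by (auto simp: c_def)
  moreover have "ennreal c \<le> (\<integral>\<^sup>+ y. ennreal (heat_kernel (x - y) h) * indicator (ball z r) y \<partial>lebesgue)"
    if *: "dist z x < r" "0 < h" "h \<le> K * r\<^sup>2" for z x :: 'a and r h
  proof -
    have r: "r > 0" using *(1) by (meson le_less_trans zero_le_dist)
    define s where "s = sqrt (h / K)"
    have s: "s > 0" "s\<^sup>2 = h / K" using * K by (auto simp: s_def)
    have "s\<^sup>2 \<le> r\<^sup>2" using * K unfolding s(2) by (simp add: pos_divide_le_eq mult.commute)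
    then have sr: "s \<le> r" by (rule power2_le_imp_le) (use r in simp)
    \<comment> \<open>Moving \<open>x\<close> towards the centre \<open>z\<close> by the fraction \<open>s/(2r)\<close> costs at most \<open>s/2\<close> in distance and gains as much room inside the ball.\<close>
    define w where "w = x + (s / (2 * r)) *\<^sub>R (z - x)"
    have "dist w x = s / (2 * r) * dist z x"
      using s r by (simp add: w_def dist_norm)
    also have "\<dots> \<le> s / (2 * r) * r" using * s r by (intro mult_left_mono) auto
    finally have wx: "dist w x \<le> s / 2" using r by simp
    have "w - z = (1 - s / (2 * r)) *\<^sub>R (x - z)" by (simp add: w_def algebra_simps)
    then have "dist w z = (1 - s / (2 * r)) * dist x z" using sr s r by (simp add: dist_norm)
    also have "\<dots> \<le> (1 - s / (2 * r)) * r" using * sr s r by (intro mult_left_mono) (auto simp: dist_commute)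
    finally have wz: "dist w z \<le> r - s / 2" using r by (simp add: algebra_simps)
    have sub: "y \<in> ball z r \<and> norm (x - y) \<le> s" if "y \<in> ball w (s / 2)" for y
      using that wx wz dist_triangle[of x y w] dist_triangle[of z y w] by (auto simp: dist_commute dist_norm[of x y, symmetric])
    define d where "d = (4 * pi * h) powr (- (?N / 2)) * exp (- (s\<^sup>2 / (4 * h)))"
    have "d = exp (- (1 / (4 * K))) * (4 * pi * h) powr (- (?N / 2))"
      using * K by (simp add: d_def s mult.commute)
    moreover have "(s / 2) ^ DIM('a) = (h / (4 * K)) powr (?N / 2)"
    proof -
      have "h / (4 * K) = (s / 2) powr 2" using s by (simp add: power_divide)
      then have "(h / (4 * K)) powr (?N / 2) = (s / 2) powr ?N" by (simp add: powr_powr)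
      then show ?thesis using s by (simp add: powr_realpow)
    qed
    moreover have "(4 * pi * h) powr (- (?N / 2)) * (h / (4 * K)) powr (?N / 2) = (1 / (16 * pi * K)) powr (?N / 2)"
      using * K by (simp add: powr_minus powr_divide powr_mult field_simps flip: powr_mult)
    ultimately have "c = d * (unit_ball_vol ?N * (s / 2) ^ DIM('a))"
      by (simp add: c_def)
    then have "ennreal c = ennreal d * emeasure lebesgue (ball w (s / 2))"
      using s by (simp add: emeasure_ball ennreal_mult d_def)
    also have "\<dots> = (\<integral>\<^sup>+ y. ennreal d * indicator (ball w (s / 2)) y \<partial>lebesgue)"
      by (simp add: nn_integral_cmult_indicator)
    also have "\<dots> \<le> (\<integral>\<^sup>+ y. ennreal (heat_kernel (x - y) h) * indicator (ball z r) y \<partial>lebesgue)"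
      using sub *(2) by (intro nn_integral_mono) (auto simp: indicator_def d_def intro!: ennreal_leI heat_kernel_ge)
    finally show ?thesis .
  qed
  ultimately show ?thesis by blast
qed

definition mild_supersolution ::
  "real \<Rightarrow> ('a::euclidean_space \<Rightarrow> real \<Rightarrow> ennreal) \<Rightarrow> ('a \<Rightarrow> real \<Rightarrow> ennreal) \<Rightarrow> real \<Rightarrow> real \<Rightarrow> bool" where
  "mild_supersolution D f w \<tau> b \<longleftrightarrow>
    (AE t in lebesgue. \<tau> < t \<and> t < b \<longrightarrow> (AE x in lebesgue.
      heat_flow (D * (t - \<tau>)) (\<lambda>y. w y \<tau>) x +
        (\<integral>\<^sup>+ s\<in>{\<tau><..<t}. heat_flow (D * (t - s)) (\<lambda>y. f y s) x \<partial>lebesgue) \<le> w x t))"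

lemma ennpowr_ge: "0 \<le> A \<Longrightarrow> 0 < p \<Longrightarrow> ennreal A \<le> a \<Longrightarrow> ennreal (A powr p) \<le> ennpowr a p"
  by (cases a) (auto simp: ennpowr_def intro!: ennreal_leI powr_mono2)

text \<open>A lower bound \<open>A\<close> for \<open>V\<close> on the ball after time \<open>t1\<close> feeds at least \<open>c A\<^sup>p\<close> per unit of time into
  \<open>U\<close> on the same ball, because the heat flow keeps a fixed fraction \<open>c\<close> of the source there.\<close>
lemma source_lower_bound:
  fixes U V :: "'a::euclidean_space \<Rightarrow> real \<Rightarrow> ennreal"
  assumes c: "c > 0" "\<And>(z::'a) x r h. dist z x < r \<Longrightarrow> 0 < h \<Longrightarrow> h \<le> K * r\<^sup>2 \<Longrightarrow>
      ennreal c \<le> (\<integral>\<^sup>+ y. ennreal (heat_kernel (x - y) h) * indicator (ball z r) y \<partial>lebesgue)"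
    and U: "mild_supersolution D (\<lambda>y s. ennpowr (V y s) p) U \<tau> b"
    and V: "AE t in lebesgue. t1 < t \<and> t < b \<longrightarrow> (AE x in lebesgue. x \<in> ball z r \<longrightarrow> ennreal A \<le> V x t)"
    and D: "0 < D" "D \<le> K" and A: "0 \<le> A" and p: "0 < p" and t: "\<tau> \<le> t1" "t1 \<le> t2" "b - \<tau> \<le> r\<^sup>2"
  shows "AE t in lebesgue. t2 < t \<and> t < b \<longrightarrow> (AE x in lebesgue. x \<in> ball z r \<longrightarrow> ennreal (c * (t2 - t1) * A powr p) \<le> U x t)"
  using U[unfolded mild_supersolution_def]
proof (eventually_elim, intro impI)
  fix t assume *: "\<tau> < t \<and> t < b \<longrightarrow> (AE x in lebesgue.
      heat_flow (D * (t - \<tau>)) (\<lambda>y. U y \<tau>) x +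
        (\<integral>\<^sup>+ s\<in>{\<tau><..<t}. heat_flow (D * (t - s)) (\<lambda>y. ennpowr (V y s) p) x \<partial>lebesgue) \<le> U x t)"
    and tt: "t2 < t \<and> t < b"
  have src: "ennreal (c * (t2 - t1) * A powr p) \<le>
      (\<integral>\<^sup>+ s\<in>{\<tau><..<t}. heat_flow (D * (t - s)) (\<lambda>y. ennpowr (V y s) p) x \<partial>lebesgue)"
    if x: "x \<in> ball z r" for x
  proof -
    have "AE s in lebesgue. ennreal (A powr p) * ennreal c * indicator {t1<..<t} s \<le>
        heat_flow (D * (t - s)) (\<lambda>y. ennpowr (V y s) p) x * indicator {\<tau><..<t} s"
      using V
    proof (eventually_elim)
      case (elim s)
      show ?case
      proof (cases "t1 < s \<and> s < t")
        case True
        have "D * (t - s) \<le> K * r\<^sup>2" using True D t tt by (intro mult_mono) auto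
        then have "ennreal (A powr p) * ennreal c \<le> ennreal (A powr p) *
            (\<integral>\<^sup>+ y. ennreal (heat_kernel (x - y) (D * (t - s))) * indicator (ball z r) y \<partial>lebesgue)"
          using True D x by (intro mult_left_mono c) auto
        also have "\<dots> = (\<integral>\<^sup>+ y. ennreal (A powr p) *
            (ennreal (heat_kernel (x - y) (D * (t - s))) * indicator (ball z r) y) \<partial>lebesgue)"
        proof (rule nn_integral_cmult[symmetric])
          have "continuous_on UNIV (\<lambda>y. heat_kernel (x - y) (D * (t - s)))"
            using True D unfolding heat_kernel_def by (intro continuous_intros) auto
          then have "(\<lambda>y. heat_kernel (x - y) (D * (t - s))) \<in> borel_measurable borel"
            by (rule borel_measurable_continuous_onI)
          then have "(\<lambda>y. ennreal (heat_kernel (x - y) (D * (t - s))) * indicator (ball z r) y) \<in> borel_measurable lborel"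
            by (intro borel_measurable_times_ennreal borel_measurable_indicator) auto
          then show "(\<lambda>y. ennreal (heat_kernel (x - y) (D * (t - s))) * indicator (ball z r) y) \<in> borel_measurable lebesgue"
            by (rule measurable_completion)
        qed
        also have "\<dots> \<le> heat_flow (D * (t - s)) (\<lambda>y. ennpowr (V y s) p) x"
          unfolding heat_flow_def
        proof (rule nn_integral_mono_AE)
          have "AE y in lebesgue. y \<in> ball z r \<longrightarrow> ennreal A \<le> V y s" using elim True tt by auto
          then show "AE y in lebesgue. ennreal (A powr p) *
              (ennreal (heat_kernel (x - y) (D * (t - s))) * indicator (ball z r) y) \<le>
              ennreal (heat_kernel (x - y) (D * (t - s))) * ennpowr (V y s) p"
          proof eventually_elim
            case (elim y)
            have "y \<in> ball z r \<Longrightarrow> ennreal (A powr p) \<le> ennpowr (V y s) p" using elim A p by (intro ennpowr_ge) auto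
            then show ?case
              by (subst mult.commute, subst mult.assoc) (auto simp: indicator_def intro!: mult_left_mono)
          qed
        qed
        finally show ?thesis using True t by simp
      qed simp
    qed
    then have "(\<integral>\<^sup>+ s. ennreal (A powr p) * ennreal c * indicator {t1<..<t} s \<partial>lebesgue) \<le>
      (\<integral>\<^sup>+ s\<in>{\<tau><..<t}. heat_flow (D * (t - s)) (\<lambda>y. ennpowr (V y s) p) x \<partial>lebesgue)"
      by (rule nn_integral_mono_AE)
    moreover have "(\<integral>\<^sup>+ s. ennreal (A powr p) * ennreal c * indicator {t1<..<t} s \<partial>lebesgue) = ennreal (A powr p * c * (t - t1))"
      using tt t c by (simp add: nn_integral_cmult_indicator ennreal_mult)
    moreover have "c * (t2 - t1) * A powr p \<le> A powr p * c * (t - t1)"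
    proof -
      have "c * A powr p * (t2 - t1) \<le> c * A powr p * (t - t1)" using tt c(1) by (intro mult_left_mono) auto
      then show ?thesis by (simp only: mult_ac)
    qed
    ultimately show ?thesis by (metis (no_types, lifting) ennreal_leI order_trans)
  qed
  have "AE x in lebesgue.
      heat_flow (D * (t - \<tau>)) (\<lambda>y. U y \<tau>) x +
        (\<integral>\<^sup>+ s\<in>{\<tau><..<t}. heat_flow (D * (t - s)) (\<lambda>y. ennpowr (V y s) p) x \<partial>lebesgue) \<le> U x t"
    using * tt t by auto
  then show "AE x in lebesgue. x \<in> ball z r \<longrightarrow> ennreal (c * (t2 - t1) * A powr p) \<le> U x t"
  proof eventually_elim
    case (elim x)
    then show ?case using src[of x] by (meson add_increasing order_trans zero_le)
  qed
qed

text \<open>Two points of the ball are at distance below \<open>2r\<close>, and at times of order \<open>r\<^sup>2\<close> the kernel is of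
  order \<open>r\<^sup>-\<^sup>N\<close> at such distances.\<close>
lemma initial_lower_bound:
  fixes U :: "'a::euclidean_space \<Rightarrow> real \<Rightarrow> ennreal"
  assumes U: "mild_supersolution D f U \<tau> (\<tau> + r\<^sup>2 / 8)" and D: "D > 0" and r: "r > 0"
    and meas: "(\<lambda>y. U y \<tau>) \<in> borel_measurable lebesgue"
    and M: "ennreal M \<le> (\<integral>\<^sup>+ y\<in>ball z r. U y \<tau> \<partial>lebesgue)" "0 \<le> M"
  shows "AE t in lebesgue. \<tau> + r\<^sup>2 / 16 < t \<and> t < \<tau> + r\<^sup>2 / 8 \<longrightarrow> (AE x in lebesgue. x \<in> ball z r \<longrightarrow>
    ennreal ((pi * D / 2) powr (- (real DIM('a) / 2)) * exp (- (16 / D)) * r powr (- real DIM('a)) * M) \<le> U x t)"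
  using U[unfolded mild_supersolution_def]
proof (eventually_elim, intro impI)
  let ?N = "real DIM('a)"
  fix t assume *: "\<tau> < t \<and> t < \<tau> + r\<^sup>2 / 8 \<longrightarrow> (AE x in lebesgue.
      heat_flow (D * (t - \<tau>)) (\<lambda>y. U y \<tau>) x +
        (\<integral>\<^sup>+ s\<in>{\<tau><..<t}. heat_flow (D * (t - s)) (\<lambda>y. f y s) x \<partial>lebesgue) \<le> U x t)"
    and tt: "\<tau> + r\<^sup>2 / 16 < t \<and> t < \<tau> + r\<^sup>2 / 8"
  define d where "d = (4 * pi * (D * r\<^sup>2 / 8)) powr (- (?N / 2)) * exp (- ((2 * r)\<^sup>2 / (4 * (D * r\<^sup>2 / 16))))"
  have "(r\<^sup>2) powr (- (?N / 2)) = r powr (- ?N)"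
  proof -
    have "r\<^sup>2 = r powr 2" using r by simp
    then show ?thesis by (simp only: powr_powr) simp
  qed
  then have e1: "(4 * pi * (D * r\<^sup>2 / 8)) powr (- (?N / 2)) = (pi * D / 2) powr (- (?N / 2)) * r powr (- ?N)"
    using powr_mult[of "pi * D / 2" "r\<^sup>2" "- (?N / 2)"] by (simp add: field_simps)
  have e2: "(2 * r)\<^sup>2 / (4 * (D * r\<^sup>2 / 16)) = 16 / D" using r by (simp add: power2_eq_square)
  have d: "d = (pi * D / 2) powr (- (?N / 2)) * exp (- (16 / D)) * r powr (- ?N)"
    unfolding d_def e1 e2 by (simp only: mult_ac)
  have init: "ennreal (d * M) \<le> heat_flow (D * (t - \<tau>)) (\<lambda>y. U y \<tau>) x" if x: "x \<in> ball z r" for x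
  proof -
    have "ennreal (d * M) = ennreal d * ennreal M" by (rule ennreal_mult) (auto simp: d M)
    also have "\<dots> \<le> ennreal d * (\<integral>\<^sup>+ y. U y \<tau> * indicator (ball z r) y \<partial>lebesgue)"
      by (intro mult_left_mono M) auto
    also have "\<dots> = (\<integral>\<^sup>+ y. ennreal d * (U y \<tau> * indicator (ball z r) y) \<partial>lebesgue)"
      by (intro nn_integral_cmult[symmetric] borel_measurable_times_ennreal meas borel_measurable_indicator) auto
    also have "\<dots> \<le> heat_flow (D * (t - \<tau>)) (\<lambda>y. U y \<tau>) x"
      unfolding heat_flow_def
    proof (rule nn_integral_mono)
      fix y
      have "d \<le> heat_kernel (x - y) (D * (t - \<tau>))" if "y \<in> ball z r"
        unfolding d_def
      proof (rule heat_kernel_ge)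
        show "norm (x - y) \<le> 2 * r" using x that dist_triangle[of x y z] by (simp add: dist_norm[symmetric] dist_commute)
        show "0 < D * r\<^sup>2 / 16" using D r by simp
        show "D * r\<^sup>2 / 16 \<le> D * (t - \<tau>)" "D * (t - \<tau>) \<le> D * r\<^sup>2 / 8"
          using tt D mult_left_mono[of "r\<^sup>2 / 16" "t - \<tau>" D] mult_left_mono[of "t - \<tau>" "r\<^sup>2 / 8" D] by simp_all
      qed
      then show "ennreal d * (U y \<tau> * indicator (ball z r) y) \<le> ennreal (heat_kernel (x - y) (D * (t - \<tau>))) * U y \<tau>"
        by (auto simp: indicator_def intro!: mult_right_mono ennreal_leI)
    qed
    finally show ?thesis .
  qed
  have "AE x in lebesgue.
      heat_flow (D * (t - \<tau>)) (\<lambda>y. U y \<tau>) x +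
        (\<integral>\<^sup>+ s\<in>{\<tau><..<t}. heat_flow (D * (t - s)) (\<lambda>y. f y s) x \<partial>lebesgue) \<le> U x t"
    using * tt r by (smt (verit) divide_pos_pos zero_less_power)
  then show "AE x in lebesgue. x \<in> ball z r \<longrightarrow>
      ennreal ((pi * D / 2) powr (- (?N / 2)) * exp (- (16 / D)) * r powr (- ?N) * M) \<le> U x t"
    unfolding d[symmetric]
  proof eventually_elim
    case (elim x)
    then show ?case using init[of x] by (meson add_increasing2 order_trans zero_le)
  qed
qed

text \<open>The bookkeeping of the iteration in logarithmic form: \<open>\<rho>\<close> is the logarithm of the radius, \<open>G\<close> that of
  the constant of a time step, \<open>\<kappa> - \<alpha> \<rho> + k l\<close> that of the lower bound after \<open>k\<close> rounds. The numbers
  \<open>\<alpha>\<close>, \<open>l\<close> and \<open>\<kappa>\<close> solve the equations that make one round through both components raise \<open>k\<close> by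
  exactly one: \<open>\<alpha>\<close> balances the powers of the radius, \<open>l\<close> the factors \<open>2\<^sup>-\<^sup>k\<close> that come from the
  shrinking time steps, and \<open>\<kappa>\<close> the constants.\<close>
lemma iteration_exponent:
  fixes p q k G \<rho> :: real
  assumes pq: "p * q > 1"
  defines "w \<equiv> p * q - 1"
  defines "\<alpha> \<equiv> 2 * (p + 1) / w" and "l \<equiv> (1 + p) * ln 2 / w"
  defines "\<kappa> \<equiv> (l - (1 + p) * G) / w"
  shows "(G + 2 * \<rho> - k * ln 2) + p * ((G + 2 * \<rho> - k * ln 2) + q * (\<kappa> - \<alpha> * \<rho> + k * l))
    = \<kappa> - \<alpha> * \<rho> + (k + 1) * l"
proof -
  have w: "w > 0" using pq by (simp add: w_def)
  have a: "w * \<alpha> = 2 * (p + 1)" "w * l = (1 + p) * ln 2" "w * \<kappa> = l - (1 + p) * G"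
    using w by (simp_all add: \<alpha>_def l_def \<kappa>_def)
  have pq: "p * q = w + 1" by (simp add: w_def)
  have "p * (q * (\<kappa> - \<alpha> * \<rho> + k * l)) = (w + 1) * (\<kappa> - \<alpha> * \<rho> + k * l)" by (simp flip: pq)
  also have "\<dots> = w * \<kappa> - (w * \<alpha>) * \<rho> + k * (w * l) + (\<kappa> - \<alpha> * \<rho> + k * l)"
    by (simp add: algebra_simps)
  finally show ?thesis unfolding a by (simp add: algebra_simps)
qed

text \<open>If the mass exceeded the bound, the first lower bound would be \<open>A 0\<close> and the iteration would give
  \<open>U \<ge> A k\<close> on the ball for all \<open>k\<close> at all times between \<open>\<tau> + 3r\<^sup>2/32\<close> and \<open>\<tau> + r\<^sup>2/8\<close>, where
  \<open>A k\<close> tends to infinity.\<close>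
proposition local_mass_bound:
  fixes D1 D2 p q :: real
  assumes D: "D1 > 0" "D2 > 0" and pq: "0 < p" "0 < q" "p * q > 1"
  shows "\<exists>\<gamma>>0. \<forall>(U :: 'a::euclidean_space \<Rightarrow> real \<Rightarrow> ennreal) V \<tau> r z. r > 0 \<longrightarrow>
    mild_supersolution D1 (\<lambda>y s. ennpowr (V y s) p) U \<tau> (\<tau> + r\<^sup>2 / 8) \<longrightarrow>
    mild_supersolution D2 (\<lambda>y s. ennpowr (U y s) q) V \<tau> (\<tau> + r\<^sup>2 / 8) \<longrightarrow>
    (AE t in lebesgue. \<tau> < t \<and> t < \<tau> + r\<^sup>2 / 8 \<longrightarrow> (AE x in lebesgue. U x t < \<infinity>)) \<longrightarrow>
    (\<lambda>y. U y \<tau>) \<in> borel_measurable lebesgue \<longrightarrow>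
    (\<integral>\<^sup>+ y\<in>ball z r. U y \<tau> \<partial>lebesgue) \<le>
      ennreal (\<gamma> * r powr (real DIM('a) - 2 * (p + 1) / (p * q - 1)))"
proof -
  let ?N = "real DIM('a)"
  define K where "K = max D1 D2"
  have K: "K > 0" "D1 \<le> K" "D2 \<le> K" using D by (auto simp: K_def)
  obtain c where c: "c > 0" "\<And>(z::'a) x r h. dist z x < r \<Longrightarrow> 0 < h \<Longrightarrow> h \<le> K * r\<^sup>2 \<Longrightarrow>
      ennreal c \<le> (\<integral>\<^sup>+ y. ennreal (heat_kernel (x - y) h) * indicator (ball z r) y \<partial>lebesgue)"
    using heat_mass_in_ball[OF K(1), where 'a = 'a] by blast
  define w where "w = p * q - 1"
  define \<alpha> where "\<alpha> = 2 * (p + 1) / w"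
  define l where "l = (1 + p) * ln 2 / w"
  define G where "G = ln (c / 128)"
  define \<kappa> where "\<kappa> = (l - (1 + p) * G) / w"
  define c1 where "c1 = (pi * D1 / 2) powr (- (?N / 2)) * exp (- (16 / D1))"
  have w: "w > 0" using pq by (simp add: w_def)
  have l: "l > 0" using w pq by (simp add: l_def)
  have c1: "c1 > 0" using D by (simp add: c1_def)
  define \<gamma> where "\<gamma> = exp \<kappa> / c1"
  have "\<gamma> > 0" using c1 by (simp add: \<gamma>_def)
  moreover have "(\<integral>\<^sup>+ y\<in>ball z r. U y \<tau> \<partial>lebesgue) \<le> ennreal (\<gamma> * r powr (?N - 2 * (p + 1) / (p * q - 1)))"
    if r: "r > 0"
    and U: "mild_supersolution D1 (\<lambda>y s. ennpowr (V y s) p) U \<tau> (\<tau> + r\<^sup>2 / 8)"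
    and V: "mild_supersolution D2 (\<lambda>y s. ennpowr (U y s) q) V \<tau> (\<tau> + r\<^sup>2 / 8)"
    and fin: "AE t in lebesgue. \<tau> < t \<and> t < \<tau> + r\<^sup>2 / 8 \<longrightarrow> (AE x in lebesgue. U x t < \<infinity>)"
    and meas: "(\<lambda>y. U y \<tau>) \<in> borel_measurable lebesgue"
    for U V :: "'a \<Rightarrow> real \<Rightarrow> ennreal" and \<tau> r z
  proof (rule ccontr)
    let ?b = "\<tau> + r\<^sup>2 / 8"
    define \<rho> where "\<rho> = ln r"
    define M where "M = \<gamma> * r powr (?N - \<alpha>)"
    assume "\<not> ?thesis"
    then have M: "ennreal M \<le> (\<integral>\<^sup>+ y\<in>ball z r. U y \<tau> \<partial>lebesgue)"
      unfolding M_def \<alpha>_def w_def by (simp add: not_le)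
    have M0: "0 \<le> M" using \<open>\<gamma> > 0\<close> by (simp add: M_def)
    define A where "A k = exp (\<kappa> - \<alpha> * \<rho> + real k * l)" for k :: nat
    have A0: "c1 * r powr (- ?N) * M = A 0"
    proof -
      have "r powr (- ?N) * r powr (?N - \<alpha>) = r powr (- \<alpha>)" by (simp add: powr_add[symmetric])
      then have "c1 * r powr (- ?N) * M = exp \<kappa> * r powr (- \<alpha>)"
        using c1 by (simp add: M_def \<gamma>_def mult.left_commute)
      also have "\<dots> = A 0" using r by (simp add: A_def \<rho>_def powr_def exp_diff exp_minus field_simps)
      finally show ?thesis .
    qed
    \<comment> \<open>Round \<open>k\<close> starts at time \<open>T k\<close>, passes through the other component at \<open>S k\<close>, and ends at \<open>T (k + 1)\<close>. The total length stays below \<open>r\<^sup>2/32\<close>, which leaves a time interval of positive length after all rounds.\<close>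
    define T where "T k = \<tau> + r\<^sup>2 / 16 + r\<^sup>2 / 32 * (1 - (1/2) ^ k)" for k :: nat
    define S where "S k = T k + r\<^sup>2 / 128 * (1/2) ^ k" for k :: nat
    have TS: "T (Suc k) = S k + r\<^sup>2 / 128 * (1/2) ^ k" for k
      by (simp add: T_def S_def field_simps)
    have Tt: "\<tau> \<le> T k" "T k \<le> \<tau> + 3 * r\<^sup>2 / 32" for k
    proof -
      have "0 \<le> r\<^sup>2 / 32 * (1 - (1/2) ^ k)" "r\<^sup>2 / 32 * (1 - (1/2) ^ k) \<le> r\<^sup>2 / 32"
        by (auto intro!: mult_nonneg_nonneg mult_left_le simp: power_le_one)
      then show "\<tau> \<le> T k" "T k \<le> \<tau> + 3 * r\<^sup>2 / 32" by (auto simp: T_def)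
    qed
    have gap: "c * (r\<^sup>2 / 128 * (1/2) ^ k) = exp (G + 2 * \<rho> - real k * ln 2)" for k
    proof -
      have "exp (G + 2 * \<rho> - real k * ln 2) = exp G * (exp \<rho>)\<^sup>2 / exp (ln 2) ^ k"
        by (simp add: exp_diff exp_add exp_double exp_of_nat_mult)
      also have "\<dots> = c / 128 * r\<^sup>2 / 2 ^ k" using c r by (simp add: G_def \<rho>_def)
      finally show ?thesis by (simp add: power_divide)
    qed
    have low: "AE t in lebesgue. T k < t \<and> t < ?b \<longrightarrow> (AE x in lebesgue. x \<in> ball z r \<longrightarrow> ennreal (A k) \<le> U x t)" for k
    proof (induction k)
      case 0
      show ?case using initial_lower_bound[OF U D(1) r meas M M0] A0
        by (simp add: T_def c1_def)
    next
      case (Suc k)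
      have b: "?b - \<tau> \<le> r\<^sup>2" by simp
      have gap0: "0 \<le> r\<^sup>2 / 128 * (1/2) ^ k" by simp
      have order: "T k \<le> S k" "S k \<le> T (Suc k)" "\<tau> \<le> S k"
        using gap0 Tt(1)[of k] unfolding TS S_def by linarith+
      have V': "AE t in lebesgue. S k < t \<and> t < ?b \<longrightarrow> (AE x in lebesgue. x \<in> ball z r \<longrightarrow> ennreal (c * (S k - T k) * A k powr q) \<le> V x t)"
        by (rule source_lower_bound[OF c V Suc D(2) K(3) _ pq(2) Tt(1) _ b]) (use order in \<open>simp_all add: A_def\<close>)
      have "AE t in lebesgue. T (Suc k) < t \<and> t < ?b \<longrightarrow> (AE x in lebesgue. x \<in> ball z r \<longrightarrow>
          ennreal (c * (T (Suc k) - S k) * (c * (S k - T k) * A k powr q) powr p) \<le> U x t)"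
        by (rule source_lower_bound[OF c U V' D(1) K(2) _ pq(1) _ _ b])
          (use c(1) order in simp_all)
      moreover have "c * (T (Suc k) - S k) * (c * (S k - T k) * A k powr q) powr p = A (Suc k)"
      proof -
        have "c * (T (Suc k) - S k) = exp (G + 2 * \<rho> - real k * ln 2)" "c * (S k - T k) = exp (G + 2 * \<rho> - real k * ln 2)"
          using gap[of k] by (simp_all add: TS S_def)
        then have "c * (T (Suc k) - S k) * (c * (S k - T k) * A k powr q) powr p =
            exp ((G + 2 * \<rho> - real k * ln 2) + p * ((G + 2 * \<rho> - real k * ln 2) + q * (\<kappa> - \<alpha> * \<rho> + real k * l)))"
          by (simp add: A_def powr_def exp_add[symmetric])
        also have "\<dots> = A (Suc k)"
          using iteration_exponent[OF pq(3), of G \<rho> "real k"] unfolding A_def \<alpha>_def l_def \<kappa>_def w_def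
          by (simp add: add.commute)
        finally show ?thesis .
      qed
      ultimately show ?case by simp
    qed
    have "AE t in lebesgue. t \<notin> {\<tau> + 3 * r\<^sup>2 / 32<..<?b}"
    proof -
      have "AE t in lebesgue. \<forall>k. T k < t \<and> t < ?b \<longrightarrow> (AE x in lebesgue. x \<in> ball z r \<longrightarrow> ennreal (A k) \<le> U x t)"
        using low by (simp add: AE_all_countable)
      then show ?thesis using fin
      proof eventually_elim
        case (elim t)
        show ?case
        proof
          assume t: "t \<in> {\<tau> + 3 * r\<^sup>2 / 32<..<?b}"
          have "T k < t" for k using Tt(2)[of k] t by simp
          then have 1: "AE x in lebesgue. \<forall>k. x \<in> ball z r \<longrightarrow> ennreal (A k) \<le> U x t"
            using elim(1) t unfolding AE_all_countable by simp
          have "\<tau> < t" using t r by (smt (verit) greaterThanLessThan_iff divide_nonneg_nonneg zero_le_power2)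
          then have "AE x in lebesgue. U x t < \<infinity>" using elim(2) t by simp
          with 1 have "AE x in lebesgue. x \<notin> ball z r"
          proof eventually_elim
            case (elim x)
            show ?case
            proof
              assume "x \<in> ball z r"
              then have Ak: "ennreal (A k) \<le> U x t" for k using elim by simp
              define B where "B = enn2real (U x t)"
              have B: "A k \<le> B" for k using Ak[of k] elim(2) unfolding B_def
                by (cases "U x t") (auto simp: A_def)
              obtain k :: nat where k: "real k * l > ln (max B 1) - (\<kappa> - \<alpha> * \<rho>)"
                using reals_Archimedean3[OF l] by blast
              have "B \<le> exp (ln (max B 1))" by simp
              also have "\<dots> < A k" using k by (simp only: A_def exp_less_cancel_iff)
              finally show False using B[of k] by simp
            qed
          qed
          then have "ball z r \<in> null_sets lebesgue" by (subst AE_iff_null_sets) auto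
          then have "emeasure lborel (ball z r) = 0" by (auto dest: null_setsD1)
          then show False using r
            by (simp add: emeasure_ball) (metis less_irrefl of_nat_0_le_iff unit_ball_vol_pos)
        qed
      qed
    qed
    then have "{\<tau> + 3 * r\<^sup>2 / 32<..<?b} \<in> null_sets lebesgue" by (subst AE_iff_null_sets) auto
    then have "emeasure lebesgue {\<tau> + 3 * r\<^sup>2 / 32<..<?b} = 0" by (rule null_setsD1)
    then show False using r by simp
  qed
  ultimately show ?thesis by blast
qed

section \<open>Almost everywhere statements on products\<close>

lemma AE_lborel_swap:
  assumes "AE z in (lborel :: ('a::euclidean_space \<times> 'b::euclidean_space) measure). P z"
  shows "AE z in (lborel :: ('b \<times> 'a) measure). P (snd z, fst z)"
proof -
  have "AE z in distr (lborel \<Otimes>\<^sub>M lborel) (lborel \<Otimes>\<^sub>M lborel) (\<lambda>(x, y). (y, x)). P z"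
    using assms unfolding lborel_prod[symmetric] by (subst (asm) lborel_pair.distr_pair_swap)
  from AE_distrD[OF measurable_pair_swap' this]
  show ?thesis unfolding lborel_prod[symmetric] by (simp add: case_prod_beta)
qed

lemma AE_lborel_curry:
  assumes "AE z in (lborel :: ('a::euclidean_space \<times> 'b::euclidean_space) measure). P z"
  shows "AE x in lborel. AE y in lborel. P (x, y)"
  using assms unfolding lborel_prod[symmetric] by (rule lborel_pair.AE_pair)

section \<open>The Gauss kernel acting on test functions\<close>

lemma borel_measurable_heat_kernel [measurable]:
  assumes [measurable]: "f \<in> borel_measurable M" "g \<in> borel_measurable M"
  shows "(\<lambda>p. heat_kernel (f p) (g p)) \<in> borel_measurable M"
  unfolding heat_kernel_def by measurable

text \<open>The kernel is a product of one-dimensional normal densities of variance \<open>2h\<close>.\<close>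
lemma nn_integral_heat_kernel:
  fixes y :: "'a::euclidean_space"
  assumes h: "h > 0"
  shows "(\<integral>\<^sup>+ x. ennreal (heat_kernel (x - y) h) \<partial>lborel) = 1"
proof -
  define \<sigma> where "\<sigma> = sqrt (2 * h)"
  have \<sigma>: "\<sigma> > 0" "\<sigma>\<^sup>2 = 2 * h" using h by (auto simp: \<sigma>_def)
  have prod: "heat_kernel (x - y) h = (\<Prod>b\<in>Basis. normal_density (y \<bullet> b) \<sigma> (x \<bullet> b))" for x
  proof -
    have factor: "normal_density (y \<bullet> b) \<sigma> (x \<bullet> b) = 1 / sqrt (4 * pi * h) * exp (- ((x \<bullet> b - y \<bullet> b)\<^sup>2 / (4 * h)))" for b
    proof -
      have "2 * pi * \<sigma>\<^sup>2 = 4 * pi * h" "2 * \<sigma>\<^sup>2 = 4 * h" unfolding \<sigma>(2) by simp_all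
      then show ?thesis unfolding normal_density_def by (simp only: minus_divide_left)
    qed
    have "(\<Prod>b\<in>Basis. normal_density (y \<bullet> b) \<sigma> (x \<bullet> b)) =
        (\<Prod>b\<in>(Basis::'a set). 1 / sqrt (4 * pi * h)) * (\<Prod>b\<in>Basis. exp (- ((x \<bullet> b - y \<bullet> b)\<^sup>2 / (4 * h))))"
      unfolding factor by (rule prod.distrib)
    also have "(\<Prod>b\<in>Basis. exp (- ((x \<bullet> b - y \<bullet> b)\<^sup>2 / (4 * h)))) = exp (\<Sum>b\<in>Basis. - ((x \<bullet> b - y \<bullet> b)\<^sup>2 / (4 * h)))"
      by (rule exp_sum[symmetric]) simp
    also have "(\<Sum>b\<in>Basis. - ((x \<bullet> b - y \<bullet> b)\<^sup>2 / (4 * h))) = - ((norm (x - y))\<^sup>2 / (4 * h))"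
    proof -
      have "(norm (x - y))\<^sup>2 = (\<Sum>b\<in>Basis. (x \<bullet> b - y \<bullet> b)\<^sup>2)"
        unfolding power2_norm_eq_inner euclidean_inner[of "x - y" "x - y"]
        by (simp only: inner_diff_left power2_eq_square)
      then show ?thesis by (simp only: sum_negf sum_divide_distrib)
    qed
    also have "(\<Prod>b\<in>(Basis::'a set). 1 / sqrt (4 * pi * h)) = (4 * pi * h) powr (- (real DIM('a) / 2))"
    proof -
      have "1 / sqrt (4 * pi * h) = (4 * pi * h) powr (- (1 / 2))"
        using h by (simp add: powr_minus powr_half_sqrt inverse_eq_divide)
      then have "(\<Prod>b\<in>(Basis::'a set). 1 / sqrt (4 * pi * h)) = ((4 * pi * h) powr (- (1 / 2))) powr real DIM('a)"
        using h by (simp add: powr_realpow)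
      then show ?thesis by (simp add: powr_powr)
    qed
    finally show ?thesis by (simp add: heat_kernel_def)
  qed
  have one: "(\<integral>\<^sup>+ s. ennreal (normal_density (y \<bullet> b) \<sigma> s) \<partial>lborel) = 1" for b
    using nn_integral_eq_integral[OF integrable_normal_density[OF \<sigma>(1)]] integral_normal_density[OF \<sigma>(1)] by simp
  have "(\<integral>\<^sup>+ x. ennreal (heat_kernel (x - y) h) \<partial>lborel) =
      (\<integral>\<^sup>+ x. (\<Prod>b\<in>Basis. ennreal (normal_density (y \<bullet> b) \<sigma> (x \<bullet> b))) \<partial>lborel)"
    unfolding prod by (simp add: prod_ennreal)
  also have "\<dots> = (\<Prod>b\<in>(Basis::'a set). (\<integral>\<^sup>+ s. ennreal (normal_density (y \<bullet> b) \<sigma> s) \<partial>lborel))"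
    by (rule nn_integral_lborel_prod) auto
  finally show ?thesis using one by simp
qed

text \<open>Half of the Gaussian decay is spent on a small factor, and the other half is a kernel at the doubled
  time. Integrals of the kernel far from its centre are thus small against integrals of a kernel
  of total mass 1.\<close>
lemma heat_kernel_far:
  fixes z :: "'a::euclidean_space"
  assumes h: "h > 0" and \<rho>: "0 \<le> \<rho>" "\<rho> \<le> norm z"
  shows "heat_kernel z h \<le> 2 powr (real DIM('a) / 2) * exp (- (\<rho>\<^sup>2 / (8 * h))) * heat_kernel z (2 * h)"
proof -
  have "(norm z)\<^sup>2 / (4 * h) = (norm z)\<^sup>2 / (8 * h) + (norm z)\<^sup>2 / (4 * (2 * h))" using h by (simp add: field_simps)
  then have "exp (- ((norm z)\<^sup>2 / (4 * h))) = exp (- ((norm z)\<^sup>2 / (8 * h))) * exp (- ((norm z)\<^sup>2 / (4 * (2 * h))))"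
    by (simp add: exp_add[symmetric])
  also have "\<dots> \<le> exp (- (\<rho>\<^sup>2 / (8 * h))) * exp (- ((norm z)\<^sup>2 / (4 * (2 * h))))"
    using h \<rho> by (intro mult_right_mono) (auto intro!: divide_right_mono power_mono)
  finally have "(4 * pi * h) powr (- (real DIM('a) / 2)) * exp (- ((norm z)\<^sup>2 / (4 * h))) \<le>
     (4 * pi * h) powr (- (real DIM('a) / 2)) * (exp (- (\<rho>\<^sup>2 / (8 * h))) * exp (- ((norm z)\<^sup>2 / (4 * (2 * h)))))"
    by (rule mult_left_mono) simp
  moreover have "(4 * pi * (2 * h)) powr (- (real DIM('a) / 2)) = 2 powr (- (real DIM('a) / 2)) * (4 * pi * h) powr (- (real DIM('a) / 2))"
    using powr_mult[of 2 "4 * pi * h" "- (real DIM('a) / 2)"] by (simp add: mult_ac)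
  moreover have "2 powr (real DIM('a) / 2) * 2 powr (- (real DIM('a) / 2)) = (1::real)"
    by (simp add: powr_add[symmetric])
  moreover have "c * u * ((i * P) * E) = P * (u * E)" if "c * i = 1" for c i u P E :: real
  proof -
    have "c * u * ((i * P) * E) = (c * i) * (P * (u * E))" by (simp only: mult_ac)
    then show ?thesis using that by simp
  qed
  ultimately show ?thesis unfolding heat_kernel_def by presburger
qed

lemma exp_neg_div_le: assumes "a > 0" "h > 0" shows "exp (- (a / h)) \<le> h / (a::real)"
proof -
  have "a / h \<le> exp (a / h)" using exp_ge_add_one_self[of "a / h"] by linarith
  then have "inverse (exp (a / h)) \<le> inverse (a / h)" using assms by (intro le_imp_inverse_le) auto
  then show ?thesis by (simp add: exp_minus)
qed

lemma nn_integral_heat_kernel_add: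
  fixes y :: "'a::euclidean_space"
  assumes h: "h > 0"
  shows "(\<integral>\<^sup>+ x. a * ennreal (heat_kernel (x - y) h) + b * ennreal (heat_kernel (x - y) (2 * h)) \<partial>lborel) = a + b"
proof -
  have "(\<integral>\<^sup>+ x. a * ennreal (heat_kernel (x - y) h) + b * ennreal (heat_kernel (x - y) (2 * h)) \<partial>lborel) =
    (\<integral>\<^sup>+ x. a * ennreal (heat_kernel (x - y) h) \<partial>lborel) + (\<integral>\<^sup>+ x. b * ennreal (heat_kernel (x - y) (2 * h)) \<partial>lborel)"
    by (rule nn_integral_add) measurable
  also have "(\<integral>\<^sup>+ x. a * ennreal (heat_kernel (x - y) h) \<partial>lborel) = a * (\<integral>\<^sup>+ x. ennreal (heat_kernel (x - y) h) \<partial>lborel)"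
    by (rule nn_integral_cmult) measurable
  also have "(\<integral>\<^sup>+ x. b * ennreal (heat_kernel (x - y) (2 * h)) \<partial>lborel) = b * (\<integral>\<^sup>+ x. ennreal (heat_kernel (x - y) (2 * h)) \<partial>lborel)"
    by (rule nn_integral_cmult) measurable
  finally show ?thesis using h by (simp add: nn_integral_heat_kernel)
qed

abbreviation kernel_average :: "('a::euclidean_space \<Rightarrow> real) \<Rightarrow> real \<Rightarrow> 'a \<Rightarrow> ennreal" where
  "kernel_average \<phi> h y \<equiv> \<integral>\<^sup>+ x. ennreal (heat_kernel (x - y) h * \<phi> x) \<partial>lborel"

lemma nn_integral_heat_kernel_bound:
  fixes y :: "'a::euclidean_space" and \<phi> :: "'a \<Rightarrow> real"
  assumes h: "h > 0" and ab: "a \<ge> 0" "b \<ge> 0" and [measurable]: "\<phi> \<in> borel_measurable borel"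
  and le: "\<And>x. heat_kernel (x - y) h * \<phi> x \<le> a * heat_kernel (x - y) h + b * heat_kernel (x - y) (2 * h)"
  shows "kernel_average \<phi> h y \<le> ennreal (a + b)"
proof -
  have "kernel_average \<phi> h y \<le>
      (\<integral>\<^sup>+ x. ennreal a * ennreal (heat_kernel (x - y) h) + ennreal b * ennreal (heat_kernel (x - y) (2 * h)) \<partial>lborel)"
  proof (rule nn_integral_mono)
    fix x
    have "ennreal (heat_kernel (x - y) h * \<phi> x) \<le> ennreal (a * heat_kernel (x - y) h + b * heat_kernel (x - y) (2 * h))"
      by (rule ennreal_leI) (rule le)
    then show "ennreal (heat_kernel (x - y) h * \<phi> x) \<le>
        ennreal a * ennreal (heat_kernel (x - y) h) + ennreal b * ennreal (heat_kernel (x - y) (2 * h))"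
      using ab by (simp add: heat_kernel_nonneg ennreal_plus ennreal_mult)
  qed
  also have "\<dots> = ennreal a + ennreal b"
    by (rule nn_integral_heat_kernel_add[OF h])
  finally show ?thesis using ab by simp
qed

text \<open>Near the support of \<open>\<phi>\<close> the weight is bounded below, and uniform continuity of \<open>\<phi>\<close> together with the
  small mass of the kernel away from its centre gives a uniform error. Far from the support \<open>\<phi>\<close>
  vanishes and its heat flow decays like a Gaussian of variance of order \<open>h\<close>, hence faster than the
  weight once \<open>h\<close> is small against \<open>\<kappa>\<close>.\<close>
lemma heat_flow_test_function:
  fixes \<phi> :: "'a::euclidean_space \<Rightarrow> real" and x0 :: 'a
  assumes \<phi>: "csc \<phi>" "\<And>x. 0 \<le> \<phi> x" and \<kappa>: "\<kappa> > 0" and e: "e > 0"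
  shows "\<exists>\<delta>>0. \<forall>h y. 0 < h \<and> h < \<delta> \<longrightarrow>
    kernel_average \<phi> h y \<le> ennreal (\<phi> y + e * exp (- ((norm (y - x0))\<^sup>2 / \<kappa>))) \<and>
    ennreal (\<phi> y) \<le> kernel_average \<phi> h y + ennreal (e * exp (- ((norm (y - x0))\<^sup>2 / \<kappa>)))"
proof -
  obtain R0 B where B: "B > 0" "\<And>x. \<bar>\<phi> x\<bar> \<le> B" "\<And>x. \<phi> x \<noteq> 0 \<Longrightarrow> norm x \<le> R0"
    by (rule csc_bounded[OF \<phi>(1)]) blast
  have cont: "continuous_on UNIV \<phi>" using \<phi>(1) by (simp add: csc_iff)
  then have [measurable]: "\<phi> \<in> borel_measurable borel" by (rule borel_measurable_continuous_onI)
  define R where "R = max 1 (R0 + norm x0)"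
  have R: "R \<ge> 1" "\<phi> x \<noteq> 0 \<Longrightarrow> norm (x - x0) \<le> R" for x
    using B(3)[of x] norm_triangle_ineq4[of x x0] by (auto simp: R_def)
  define g where "g y = exp (- ((norm (y - x0))\<^sup>2 / \<kappa>))" for y
  have g: "g y > 0" "g y \<le> 1" for y using \<kappa> by (auto simp: g_def)
  define \<eta> where "\<eta> = e * exp (- ((2 * R)\<^sup>2 / \<kappa>)) / 2"
  have \<eta>: "\<eta> > 0" using e by (simp add: \<eta>_def)
  have near: "2 * \<eta> \<le> e * g y" if "norm (y - x0) \<le> 2 * R" for y
  proof -
    have "(norm (y - x0))\<^sup>2 \<le> (2 * R)\<^sup>2" using that by (intro power_mono) auto
    then have "(norm (y - x0))\<^sup>2 / \<kappa> \<le> (2 * R)\<^sup>2 / \<kappa>" using \<kappa> by (intro divide_right_mono) auto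
    then have "exp (- ((2 * R)\<^sup>2 / \<kappa>)) \<le> g y" unfolding g_def by simp
    then have "e * exp (- ((2 * R)\<^sup>2 / \<kappa>)) \<le> e * g y" using e by (intro mult_left_mono) auto
    then show ?thesis by (simp add: \<eta>_def)
  qed
  have uc: "uniformly_continuous_on UNIV \<phi>"
  proof -
    have "uniformly_continuous_on (cball 0 (R0 + 1)) \<phi>"
      using cont by (intro compact_uniformly_continuous) (auto intro: continuous_on_subset)
    then show ?thesis
      unfolding uniformly_continuous_on_def
    proof (intro allI impI)
      fix d :: real assume *: "\<forall>e>0. \<exists>d>0. \<forall>x\<in>cball 0 (R0 + 1). \<forall>x'\<in>cball 0 (R0 + 1). dist x' x < d \<longrightarrow> dist (\<phi> x') (\<phi> x) < e" "d > 0"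
      then obtain s where s: "s > 0" "\<And>x x'. x \<in> cball 0 (R0 + 1) \<Longrightarrow> x' \<in> cball 0 (R0 + 1) \<Longrightarrow> dist x' x < s \<Longrightarrow> dist (\<phi> x') (\<phi> x) < d"
        by meson
      have "dist (\<phi> x') (\<phi> x) < d" if "dist x' x < min s 1" for x x'
      proof (cases "\<phi> x = 0 \<and> \<phi> x' = 0")
        case False
        then have "norm x \<le> R0 \<or> norm x' \<le> R0" using B(3) by blast
        then have "norm x \<le> R0 + 1 \<and> norm x' \<le> R0 + 1"
          using that norm_triangle_ineq2[of x x'] norm_triangle_ineq2[of x' x] by (auto simp: dist_norm norm_minus_commute)
        then show ?thesis using s(2)[of x x'] that by auto
      qed (use *(2) in auto)
      then show "\<exists>s>0. \<forall>x\<in>UNIV. \<forall>x'\<in>UNIV. dist x' x < s \<longrightarrow> dist (\<phi> x') (\<phi> x) < d"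
        using s(1) by (intro exI[of _ "min s 1"]) auto
    qed
  qed
  obtain d where d: "d > 0" "\<And>x x'. dist x' x < d \<Longrightarrow> dist (\<phi> x') (\<phi> x) < \<eta>"
    using uc \<eta> unfolding uniformly_continuous_on_def by blast
  define c where "c = (2::real) powr (real DIM('a) / 2)"
  have c: "c > 0" by (simp add: c_def)
  \<comment> \<open>The three entries make the Gaussian tail thinner than the weight, the error near the support at most \<open>\<eta>\<close>, and the error far from it at most \<open>e g\<close>.\<close>
  define \<delta> where "\<delta> = min (\<kappa> / 64) (min (\<eta> * (d\<^sup>2 / 8) / (B * c)) (e * ((2 * R)\<^sup>2 / 64) / (B * c)))"
  have "\<delta> > 0" using \<kappa> \<eta> d e R(1) B(1) c by (simp add: \<delta>_def)
  moreover have "kernel_average \<phi> h y \<le> ennreal (\<phi> y + e * g y) \<and>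
    ennreal (\<phi> y) \<le> kernel_average \<phi> h y + ennreal (e * g y)"
    if h: "0 < h" "h < \<delta>" for h y
  proof (cases "norm (y - x0) \<le> 2 * R")
    case True
    define b where "b = B * (c * exp (- (d\<^sup>2 / (8 * h))))"
    have b0: "b \<ge> 0" using B(1) c by (simp add: b_def)
    have "b \<le> \<eta>"
    proof -
      have "exp (- (d\<^sup>2 / (8 * h))) \<le> h / (d\<^sup>2 / 8)" using exp_neg_div_le[of "d\<^sup>2 / 8" h] d h by (simp add: mult.commute)
      then have "b \<le> B * (c * (h / (d\<^sup>2 / 8)))" unfolding b_def using B(1) c by (intro mult_left_mono) auto
      also have "\<dots> \<le> \<eta>"
      proof -
        have "h \<le> \<eta> * (d\<^sup>2 / 8) / (B * c)" using h by (simp add: \<delta>_def)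
        then have "h * (B * c) \<le> \<eta> * (d\<^sup>2 / 8)" using B(1) c by (simp add: pos_le_divide_eq)
        then have "h * (B * c) / (d\<^sup>2 / 8) \<le> \<eta>" using d(1) by (subst pos_divide_le_eq) auto
        then show ?thesis by (simp add: mult_ac)
      qed
      finally show ?thesis .
    qed
    have key: "\<phi> x1 * heat_kernel (x - y) h \<le> (\<phi> x2 + \<eta>) * heat_kernel (x - y) h + b * heat_kernel (x - y) (2 * h)"
      if x: "(x1 = x \<and> x2 = y) \<or> (x1 = y \<and> x2 = x)" for x x1 x2
    proof (cases "dist x y < d")
      case near: True
      then have "\<phi> x1 \<le> \<phi> x2 + \<eta>" using d(2)[of x1 x2] x by (auto simp: dist_real_def dist_commute)
      then have "\<phi> x1 * heat_kernel (x - y) h \<le> (\<phi> x2 + \<eta>) * heat_kernel (x - y) h"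
        by (rule mult_right_mono) (rule heat_kernel_nonneg)
      then show ?thesis using mult_nonneg_nonneg[OF b0 heat_kernel_nonneg[of "x - y" "2 * h"]] by linarith
    next
      case False
      have "\<phi> x1 * heat_kernel (x - y) h \<le> B * heat_kernel (x - y) h"
        using B(2)[of x1] by (intro mult_right_mono heat_kernel_nonneg) auto
      also have "\<dots> \<le> B * (c * exp (- (d\<^sup>2 / (8 * h))) * heat_kernel (x - y) (2 * h))"
        unfolding c_def using B(1) h False d(1) by (intro mult_left_mono heat_kernel_far) (auto simp: dist_norm)
      also have "\<dots> = b * heat_kernel (x - y) (2 * h)" by (simp add: b_def)
      also have "\<dots> \<le> (\<phi> x2 + \<eta>) * heat_kernel (x - y) h + b * heat_kernel (x - y) (2 * h)"
        using \<eta> \<phi>(2)[of x2] by (simp add: heat_kernel_nonneg)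
      finally show ?thesis .
    qed
    have "kernel_average \<phi> h y \<le> ennreal ((\<phi> y + \<eta>) + b)"
      by (rule nn_integral_heat_kernel_bound[OF h(1)]) (use \<phi>(2)[of y] \<eta> b0 key in \<open>auto simp: mult.commute\<close>)
    also have "\<dots> \<le> ennreal (\<phi> y + e * g y)" using near[OF True] \<open>b \<le> \<eta>\<close> by (intro ennreal_leI) simp
    finally have 1: "kernel_average \<phi> h y \<le> ennreal (\<phi> y + e * g y)" .
    have "ennreal (\<phi> y) = (\<integral>\<^sup>+ x. ennreal (\<phi> y) * ennreal (heat_kernel (x - y) h) \<partial>lborel)"
      by (subst nn_integral_cmult) (auto simp: nn_integral_heat_kernel h)
    also have "\<dots> \<le> (\<integral>\<^sup>+ x. ennreal (heat_kernel (x - y) h * \<phi> x) +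
        (ennreal \<eta> * ennreal (heat_kernel (x - y) h) + ennreal b * ennreal (heat_kernel (x - y) (2 * h))) \<partial>lborel)"
    proof (rule nn_integral_mono)
      fix x
      have "\<phi> y * heat_kernel (x - y) h \<le> heat_kernel (x - y) h * \<phi> x + (\<eta> * heat_kernel (x - y) h + b * heat_kernel (x - y) (2 * h))"
        using key[of y x x] by (simp add: algebra_simps)
      from ennreal_leI[OF this] show "ennreal (\<phi> y) * ennreal (heat_kernel (x - y) h) \<le> ennreal (heat_kernel (x - y) h * \<phi> x) +
        (ennreal \<eta> * ennreal (heat_kernel (x - y) h) + ennreal b * ennreal (heat_kernel (x - y) (2 * h)))"
        using \<phi>(2) \<eta> b0 by (simp add: heat_kernel_nonneg ennreal_plus ennreal_mult)
    qed
    also have "\<dots> = kernel_average \<phi> h y + (ennreal \<eta> + ennreal b)"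
      unfolding nn_integral_heat_kernel_add[OF h(1), of "ennreal \<eta>" y "ennreal b", symmetric]
      by (rule nn_integral_add) measurable
    also have "ennreal \<eta> + ennreal b \<le> ennreal (e * g y)"
      using near[OF True] \<open>b \<le> \<eta>\<close> \<eta> b0 by (simp flip: ennreal_plus)
    finally show ?thesis using 1 by (simp add: add_left_mono)
  next
    case False
    then have \<phi>y: "\<phi> y = 0" using R(2)[of y] R(1) by force
    define n where "n = norm (y - x0)"
    have n: "n > 2 * R" using False by (simp add: n_def)
    define b where "b = B * (c * exp (- ((n / 2)\<^sup>2 / (8 * h))))"
    have b0: "b \<ge> 0" using B(1) c by (simp add: b_def)
    have "kernel_average \<phi> h y \<le> ennreal (0 + b)"
    proof (rule nn_integral_heat_kernel_bound[OF h(1)])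
      fix x
      show "heat_kernel (x - y) h * \<phi> x \<le> 0 * heat_kernel (x - y) h + b * heat_kernel (x - y) (2 * h)"
      proof (cases "\<phi> x = 0")
        case True then show ?thesis using b0 heat_kernel_nonneg[of "x - y" "2 * h"] by simp
      next
        case False
        then have "norm (x - x0) \<le> R" by (rule R(2))
        then have far: "n / 2 \<le> norm (x - y)"
          using n norm_triangle_ineq[of "y - x" "x - x0"] by (simp add: n_def norm_minus_commute)
        have "heat_kernel (x - y) h * \<phi> x \<le> heat_kernel (x - y) h * B"
          using B(2)[of x] by (intro mult_left_mono heat_kernel_nonneg) auto
        also have "\<dots> \<le> (c * exp (- ((n / 2)\<^sup>2 / (8 * h))) * heat_kernel (x - y) (2 * h)) * B"
          unfolding c_def using B(1) h far n R(1) by (intro mult_right_mono heat_kernel_far) auto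
        finally show ?thesis by (simp add: b_def mult_ac)
      qed
    qed (use b0 in auto)
    also have "\<dots> \<le> ennreal (e * g y)"
    proof (rule ennreal_leI)
      have "h \<le> \<kappa> / 64" using h by (simp add: \<delta>_def)
      then have "n\<^sup>2 / \<kappa> \<le> n\<^sup>2 / (64 * h)" using h \<kappa> by (intro divide_left_mono) auto
      moreover have "(2 * R)\<^sup>2 / (64 * h) \<le> n\<^sup>2 / (64 * h)" using n R(1) h by (intro divide_right_mono power_mono) auto
      moreover have "(n / 2)\<^sup>2 / (8 * h) = n\<^sup>2 / (64 * h) + n\<^sup>2 / (64 * h)" using h by (simp add: field_simps power2_eq_square)
      ultimately have "exp (- ((n / 2)\<^sup>2 / (8 * h))) \<le> exp (- ((2 * R)\<^sup>2 / (64 * h)) + - (n\<^sup>2 / \<kappa>))" by simp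
      also have "\<dots> = exp (- ((2 * R)\<^sup>2 / (64 * h))) * g y" unfolding exp_add n_def g_def by (rule refl)
      finally have "b \<le> B * (c * (exp (- ((2 * R)\<^sup>2 / (64 * h))) * g y))"
        unfolding b_def using B(1) c by (intro mult_left_mono) auto
      also have "\<dots> \<le> B * (c * ((h / ((2 * R)\<^sup>2 / 64)) * g y))"
        using B(1) c g(1)[of y] exp_neg_div_le[of "(2 * R)\<^sup>2 / 64" h] h R(1)
        by (intro mult_left_mono mult_right_mono) (auto simp: mult.commute)
      also have "\<dots> = (h * (B * c) / ((2 * R)\<^sup>2 / 64)) * g y" by (simp add: mult_ac)
      also have "\<dots> \<le> e * g y"
      proof (rule mult_right_mono)
        have "h \<le> e * ((2 * R)\<^sup>2 / 64) / (B * c)" using h by (simp add: \<delta>_def)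
        then have "h * (B * c) \<le> e * ((2 * R)\<^sup>2 / 64)" using B(1) c by (simp add: pos_le_divide_eq)
        then show "h * (B * c) / ((2 * R)\<^sup>2 / 64) \<le> e" using R(1) by (subst pos_divide_le_eq) auto
      qed (use g(1)[of y] in simp)
      finally show "0 + b \<le> e * g y" by simp
    qed
    finally show ?thesis by (simp add: \<phi>y)
  qed
  ultimately show ?thesis unfolding g_def by blast
qed

section \<open>A linear heat equation near time zero\<close>

lemma AE_lborel_point:
  assumes "AE t in lborel. P t" "a < (b::real)"
  shows "\<exists>t. a < t \<and> t < b \<and> P t"
proof (rule ccontr)
  assume no: "\<not> ?thesis"
  have "AE t in lborel. t \<notin> {a<..<b}" using assms(1) by eventually_elim (use no in auto)
  then have "{a<..<b} \<in> null_sets lborel" by (subst AE_iff_null_sets) auto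
  then have "emeasure lborel {a<..<b} = 0" by (rule null_setsD1)
  then show False using assms(2) by simp
qed

lemma heat_flow_lborel: "heat_flow t f x = (\<integral>\<^sup>+ y. ennreal (heat_kernel (x - y) t) * f y \<partial>lborel)"
  unfolding heat_flow_def by (rule nn_integral_completion)

text \<open>The integral equation of one component at one choice of point and times, with the nonlinearity replaced by a given source \<open>f\<close>.\<close>
definition mild_identity ::
  "real \<Rightarrow> ('a::euclidean_space \<Rightarrow> real \<Rightarrow> ennreal) \<Rightarrow> ('a \<Rightarrow> real \<Rightarrow> ennreal) \<Rightarrow> 'a \<Rightarrow> real \<Rightarrow> real \<Rightarrow> bool" where
  "mild_identity D w f x \<tau> t \<longleftrightarrow> w x t < \<infinity> \<and>
    w x t = heat_flow (D * (t - \<tau>)) (\<lambda>y. w y \<tau>) x +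
      (\<integral>\<^sup>+ s\<in>{\<tau><..<t}. heat_flow (D * (t - s)) (\<lambda>y. f y s) x \<partial>lborel)"

text \<open>The integral equation is needed with the exceptional null sets taken in two orders. Fixing
  \<open>(x, t)\<close> and letting \<open>\<tau>\<close> vary gives bounds uniform in \<open>\<tau>\<close>; fixing \<open>(t, \<tau>)\<close> and letting \<open>x\<close> vary
  allows integration against test functions.\<close>
locale linear_mild_solution =
  fixes D T :: real and w f :: "'a::euclidean_space \<Rightarrow> real \<Rightarrow> ennreal"
  assumes D: "D > 0" and T: "T > 0"
    and w_borel: "case_prod w \<in> borel_measurable borel" and f_borel: "case_prod f \<in> borel_measurable borel"
    and eqn_AE_x_t_tau: "AE x in lborel. AE t in lborel. AE \<tau> in lborel.
      0 < \<tau> \<and> \<tau> < t \<and> t < T \<longrightarrow> mild_identity D w f x \<tau> t"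
    and eqn_AE_t_tau_x: "AE t in lborel. AE \<tau> in lborel.
      0 < \<tau> \<and> \<tau> < t \<and> t < T \<longrightarrow> (AE x in lborel. mild_identity D w f x \<tau> t)"
begin

abbreviation "eqn \<equiv> mild_identity D w f"

lemma w_meas [measurable (raw)]:
  assumes [measurable]: "g \<in> M \<rightarrow>\<^sub>M borel" "h \<in> M \<rightarrow>\<^sub>M borel"
  shows "(\<lambda>p. w (g p) (h p)) \<in> borel_measurable M"
  using measurable_compose[OF borel_measurable_Pair[OF assms] w_borel] by simp

lemma f_meas [measurable (raw)]:
  assumes [measurable]: "g \<in> M \<rightarrow>\<^sub>M borel" "h \<in> M \<rightarrow>\<^sub>M borel"
  shows "(\<lambda>p. f (g p) (h p)) \<in> borel_measurable M"
  using measurable_compose[OF borel_measurable_Pair[OF assms] f_borel] by simp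

text \<open>At a point \<open>(x0, t0)\<close> with \<open>t0 > T/2\<close> where \<open>w\<close> is finite, both terms on the right-hand side of the
  equation are at most \<open>w x0 t0\<close> for almost every \<open>\<tau>\<close>. For times below \<open>T/4\<close> the elapsed time up to
  \<open>t0\<close> lies between \<open>T/4\<close> and \<open>T\<close>, so the kernel dominates a fixed multiple of the weight.\<close>
lemma gaussian_weight_bound:
  obtains x0 :: 'a and C :: real where "C \<ge> 0"
    "AE \<tau> in lborel. 0 < \<tau> \<and> \<tau> < T / 4 \<longrightarrow>
      (\<integral>\<^sup>+ y. w y \<tau> * ennreal (exp (- ((norm (y - x0))\<^sup>2 / (D * T)))) \<partial>lborel) \<le> ennreal C"
    "(\<integral>\<^sup>+ s\<in>{0<..<T / 4}. (\<integral>\<^sup>+ y. f y s * ennreal (exp (- ((norm (y - x0))\<^sup>2 / (D * T)))) \<partial>lborel) \<partial>lborel) \<le> ennreal C"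
proof -
  have "\<exists>x. AE t in lborel. AE \<tau> in lborel. 0 < \<tau> \<and> \<tau> < t \<and> t < T \<longrightarrow> eqn x \<tau> t"
  proof (rule ccontr)
    assume no: "\<not> ?thesis"
    have "AE x in (lborel :: 'a measure). x \<notin> UNIV" using eqn_AE_x_t_tau by eventually_elim (use no in blast)
    then have "(UNIV :: 'a set) \<in> null_sets lborel" by (subst AE_iff_null_sets) auto
    then have "emeasure lborel (UNIV :: 'a set) = 0" by (rule null_setsD1)
    then show False by simp
  qed
  then obtain x0 where "AE t in lborel. AE \<tau> in lborel. 0 < \<tau> \<and> \<tau> < t \<and> t < T \<longrightarrow> eqn x0 \<tau> t" by blast
  from AE_lborel_point[OF this, of "T / 2" T] T obtain t0 where t0: "T / 2 < t0" "t0 < T"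
    and AE0: "AE \<tau> in lborel. 0 < \<tau> \<and> \<tau> < t0 \<and> t0 < T \<longrightarrow> eqn x0 \<tau> t0" by auto
  define g where "g y = exp (- ((norm (y - x0))\<^sup>2 / (D * T)))" for y
  define c where "c = (4 * pi * (D * T)) powr (- (real DIM('a) / 2))"
  have c: "c > 0" using D T by (simp add: c_def)
  have fin: "w x0 t0 < \<infinity>"
    using AE_lborel_point[OF AE0, of 0 t0] t0 T by (auto simp: mild_identity_def)
  have kernel: "c * g y \<le> heat_kernel (x0 - y) (D * (t0 - \<tau>))" if "0 < \<tau>" "\<tau> < T / 4" for y \<tau>
  proof -
    have "D * T / 4 \<le> D * (t0 - \<tau>)" "D * (t0 - \<tau>) \<le> D * T"
      using that t0 D mult_left_mono[of "T / 4" "t0 - \<tau>" D] mult_left_mono[of "t0 - \<tau>" T D] by simp_all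
    from heat_kernel_ge[OF _ this order_refl, of "x0 - y"] show ?thesis
      using D T by (simp add: c_def g_def norm_minus_commute)
  qed
  have flow: "ennreal c * (\<integral>\<^sup>+ y. W y * ennreal (g y) \<partial>lborel) \<le> heat_flow (D * (t0 - \<tau>)) W x0"
    if "0 < \<tau>" "\<tau> < T / 4" and [measurable]: "W \<in> borel_measurable borel" for \<tau> W
  proof -
    have "ennreal c * (\<integral>\<^sup>+ y. W y * ennreal (g y) \<partial>lborel) = (\<integral>\<^sup>+ y. ennreal c * (W y * ennreal (g y)) \<partial>lborel)"
      unfolding g_def by (intro nn_integral_cmult[symmetric]) measurable
    also have "\<dots> \<le> heat_flow (D * (t0 - \<tau>)) W x0"
      unfolding heat_flow_lborel
    proof (rule nn_integral_mono)
      fix y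
      have "ennreal c * (W y * ennreal (g y)) = ennreal (c * g y) * W y"
        using c by (simp add: ennreal_mult g_def mult_ac)
      also have "\<dots> \<le> ennreal (heat_kernel (x0 - y) (D * (t0 - \<tau>))) * W y"
        by (intro mult_right_mono ennreal_leI kernel that) auto
      finally show "ennreal c * (W y * ennreal (g y)) \<le> ennreal (heat_kernel (x0 - y) (D * (t0 - \<tau>))) * W y" .
    qed
    finally show ?thesis .
  qed
  have cancel: "X \<le> ennreal (enn2real (w x0 t0) / c)" if "ennreal c * X \<le> w x0 t0" for X
  proof -
    have "X = ennreal (1 / c) * (ennreal c * X)"
      using c by (simp add: mult.assoc[symmetric] ennreal_mult[symmetric])
    also have "\<dots> \<le> ennreal (1 / c) * w x0 t0" using that by (rule mult_left_mono) simp
    also have "\<dots> = ennreal (1 / c) * ennreal (enn2real (w x0 t0))" using fin by simp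
    also have "\<dots> = ennreal (enn2real (w x0 t0) / c)" using c by (simp add: ennreal_mult[symmetric])
    finally show ?thesis .
  qed
  define \<psi> where "\<psi> s = (\<integral>\<^sup>+ y. f y s * ennreal (g y) \<partial>lborel)" for s
  have [measurable]: "\<psi> \<in> borel_measurable borel" unfolding \<psi>_def g_def by measurable
  show ?thesis
  proof
    show "enn2real (w x0 t0) / c \<ge> 0" using c by simp
    show "AE \<tau> in lborel. 0 < \<tau> \<and> \<tau> < T / 4 \<longrightarrow>
      (\<integral>\<^sup>+ y. w y \<tau> * ennreal (exp (- ((norm (y - x0))\<^sup>2 / (D * T)))) \<partial>lborel) \<le> ennreal (enn2real (w x0 t0) / c)"
      using AE0
    proof eventually_elim
      case (elim \<tau>)
      show ?case
      proof
        assume *: "0 < \<tau> \<and> \<tau> < T / 4"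
        then have "eqn x0 \<tau> t0" using elim t0 by auto
        then have "heat_flow (D * (t0 - \<tau>)) (\<lambda>y. w y \<tau>) x0 \<le> w x0 t0" by (simp add: mild_identity_def)
        moreover have "ennreal c * (\<integral>\<^sup>+ y. w y \<tau> * ennreal (g y) \<partial>lborel) \<le> heat_flow (D * (t0 - \<tau>)) (\<lambda>y. w y \<tau>) x0"
          using * by (intro flow) auto
        ultimately have "(\<integral>\<^sup>+ y. w y \<tau> * ennreal (g y) \<partial>lborel) \<le> ennreal (enn2real (w x0 t0) / c)"
          by (intro cancel) (rule order_trans)
        then show "(\<integral>\<^sup>+ y. w y \<tau> * ennreal (exp (- ((norm (y - x0))\<^sup>2 / (D * T)))) \<partial>lborel) \<le> ennreal (enn2real (w x0 t0) / c)"
          by (simp add: g_def)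
      qed
    qed
    have part: "(\<integral>\<^sup>+ s. \<psi> s * indicator {1 / real (Suc n)<..<T / 4} s \<partial>lborel) \<le> ennreal (enn2real (w x0 t0) / c)" for n
    proof -
      obtain \<tau> where \<tau>: "0 < \<tau>" "\<tau> < min (1 / real (Suc n)) t0" "eqn x0 \<tau> t0"
        using AE_lborel_point[OF AE0, of 0 "min (1 / real (Suc n)) t0"] t0 T by auto
      have "ennreal c * (\<integral>\<^sup>+ s. \<psi> s * indicator {1 / real (Suc n)<..<T / 4} s \<partial>lborel) =
          (\<integral>\<^sup>+ s. ennreal c * (\<psi> s * indicator {1 / real (Suc n)<..<T / 4} s) \<partial>lborel)"
        by (intro nn_integral_cmult[symmetric]) measurable
      also have "\<dots> \<le> (\<integral>\<^sup>+ s\<in>{\<tau><..<t0}. heat_flow (D * (t0 - s)) (\<lambda>y. f y s) x0 \<partial>lborel)"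
      proof (rule nn_integral_mono)
        fix s
        show "ennreal c * (\<psi> s * indicator {1 / real (Suc n)<..<T / 4} s) \<le>
          heat_flow (D * (t0 - s)) (\<lambda>y. f y s) x0 * indicator {\<tau><..<t0} s"
        proof (cases "1 / real (Suc n) < s \<and> s < T / 4")
          case True
          then have "\<tau> < s" "s < t0" using \<tau> t0 T by auto
          moreover have "ennreal c * \<psi> s \<le> heat_flow (D * (t0 - s)) (\<lambda>y. f y s) x0"
            unfolding \<psi>_def using True \<open>\<tau> < s\<close> \<tau> by (intro flow) auto
          ultimately show ?thesis using True by simp
        qed simp
      qed
      also have "\<dots> \<le> w x0 t0" using \<tau>(3) by (simp add: mild_identity_def)
      finally show ?thesis by (rule cancel)
    qed
    \<comment> \<open>The equation starts at a positive time \<open>\<tau>\<close>, so the source is first bounded on \<open>(1/(n+1), T/4)\<close> and the bounds are then combined by monotone convergence.\<close>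
    have "(\<integral>\<^sup>+ s. \<psi> s * indicator {0<..<T / 4} s \<partial>lborel) = (\<integral>\<^sup>+ s. (SUP n. \<psi> s * indicator {1 / real (Suc n)<..<T / 4} s) \<partial>lborel)"
    proof (rule nn_integral_cong)
      fix s :: real
      show "\<psi> s * indicator {0<..<T / 4} s = (SUP n. \<psi> s * indicator {1 / real (Suc n)<..<T / 4} s)"
      proof (cases "0 < s \<and> s < T / 4")
        case True
        then obtain n where n: "1 / real (Suc n) < s" using reals_Archimedean[of s] by (auto simp: inverse_eq_divide)
        show ?thesis
        proof (rule antisym)
          show "\<psi> s * indicator {0<..<T / 4} s \<le> (SUP n. \<psi> s * indicator {1 / real (Suc n)<..<T / 4} s)"
            using True n by (intro SUP_upper2[of n]) auto
          show "(SUP n. \<psi> s * indicator {1 / real (Suc n)<..<T / 4} s) \<le> \<psi> s * indicator {0<..<T / 4} s"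
            using True by (intro SUP_least) (auto simp: indicator_def)
        qed
      next
        case False
        have "s \<notin> {1 / real (Suc n)<..<T / 4}" for n
        proof
          assume "s \<in> {1 / real (Suc n)<..<T / 4}"
          then have "1 / real (Suc n) < s" "s < T / 4" by auto
          moreover have "0 < 1 / real (Suc n)" by simp
          ultimately show False using False by linarith
        qed
        then have z: "(indicator {1 / real (Suc n)<..<T / 4} s :: ennreal) = 0" for n by (rule indicator_simps(2))
        show ?thesis unfolding z using False by simp
      qed
    qed
    also have "\<dots> = (SUP n. \<integral>\<^sup>+ s. \<psi> s * indicator {1 / real (Suc n)<..<T / 4} s \<partial>lborel)"
    proof (rule nn_integral_monotone_convergence_SUP)
      show "incseq (\<lambda>n s. \<psi> s * indicator {1 / real (Suc n)<..<T / 4} s)"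
      proof (intro incseq_SucI le_funI mult_left_mono)
        fix n s
        have "1 / real (Suc (Suc n)) \<le> 1 / real (Suc n)" by (intro divide_left_mono) auto
        then show "indicator {1 / real (Suc n)<..<T / 4} s \<le> (indicator {1 / real (Suc (Suc n))<..<T / 4} s :: ennreal)"
          by (auto simp: indicator_def simp del: of_nat_Suc)
      qed auto
    qed measurable
    also have "\<dots> \<le> ennreal (enn2real (w x0 t0) / c)" by (intro SUP_least part)
    finally show "(\<integral>\<^sup>+ s\<in>{0<..<T / 4}. (\<integral>\<^sup>+ y. f y s * ennreal (exp (- ((norm (y - x0))\<^sup>2 / (D * T)))) \<partial>lborel) \<partial>lborel) \<le> ennreal (enn2real (w x0 t0) / c)"
      by (simp add: \<psi>_def g_def)
  qed
qed

end

text \<open>The heat flow is symmetric; this is Tonelli's theorem.\<close>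
lemma heat_flow_dual:
  fixes W :: "'a::euclidean_space \<Rightarrow> ennreal" and \<phi> :: "'a \<Rightarrow> real"
  assumes [measurable]: "W \<in> borel_measurable borel" "\<phi> \<in> borel_measurable borel"
  shows "(\<integral>\<^sup>+ x. heat_flow h W x * ennreal (\<phi> x) \<partial>lborel) =
    (\<integral>\<^sup>+ y. W y * kernel_average \<phi> h y \<partial>lborel)"
proof -
  have "(\<integral>\<^sup>+ x. heat_flow h W x * ennreal (\<phi> x) \<partial>lborel) =
      (\<integral>\<^sup>+ x. (\<integral>\<^sup>+ y. ennreal (heat_kernel (x - y) h) * W y * ennreal (\<phi> x) \<partial>lborel) \<partial>lborel)"
    unfolding heat_flow_lborel by (intro nn_integral_cong nn_integral_multc[symmetric]) measurable
  also have "\<dots> = (\<integral>\<^sup>+ y. (\<integral>\<^sup>+ x. ennreal (heat_kernel (x - y) h) * W y * ennreal (\<phi> x) \<partial>lborel) \<partial>lborel)"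
    by (rule lborel_pair.Fubini'[symmetric]) measurable
  also have "\<dots> = (\<integral>\<^sup>+ y. W y * kernel_average \<phi> h y \<partial>lborel)"
  proof (rule nn_integral_cong)
    fix y :: 'a
    have "(\<integral>\<^sup>+ x. ennreal (heat_kernel (x - y) h) * W y * ennreal (\<phi> x) \<partial>lborel) =
        (\<integral>\<^sup>+ x. W y * ennreal (heat_kernel (x - y) h * \<phi> x) \<partial>lborel)"
      by (intro nn_integral_cong) (simp add: ennreal_mult'' ennreal_mult' heat_kernel_nonneg mult_ac)
    also have "\<dots> = W y * kernel_average \<phi> h y"
      by (intro nn_integral_cmult) measurable
    finally show "(\<integral>\<^sup>+ x. ennreal (heat_kernel (x - y) h) * W y * ennreal (\<phi> x) \<partial>lborel) =
        W y * kernel_average \<phi> h y" .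
  qed
  finally show ?thesis .
qed

abbreviation test_integral ::
  "('a::euclidean_space \<Rightarrow> real \<Rightarrow> ennreal) \<Rightarrow> real \<Rightarrow> ('a \<Rightarrow> real) \<Rightarrow> ennreal" where
  "test_integral w t \<phi> \<equiv> \<integral>\<^sup>+ x. w x t * ennreal (\<phi> x) \<partial>lborel"

context linear_mild_solution
begin

lemma weak_form:
  fixes \<phi> :: "'a \<Rightarrow> real"
  assumes [measurable]: "\<phi> \<in> borel_measurable borel" and eqn: "AE x in lborel. eqn x \<tau> t"
  shows "test_integral w t \<phi> =
    (\<integral>\<^sup>+ y. w y \<tau> * kernel_average \<phi> (D * (t - \<tau>)) y \<partial>lborel) +
    (\<integral>\<^sup>+ s\<in>{\<tau><..<t}. (\<integral>\<^sup>+ y. f y s * kernel_average \<phi> (D * (t - s)) y \<partial>lborel) \<partial>lborel)"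
proof -
  have [measurable]: "(\<lambda>x. heat_flow (D * (t - \<tau>)) (\<lambda>y. w y \<tau>) x) \<in> borel_measurable borel"
    unfolding heat_flow_lborel by measurable
  let ?src = "\<lambda>x s. heat_flow (D * (t - s)) (\<lambda>y. f y s) x"
  have src: "(\<lambda>z. ?src (fst z) (snd z)) \<in> borel_measurable (borel \<Otimes>\<^sub>M borel)"
    unfolding heat_flow_lborel
  proof (rule lborel.borel_measurable_nn_integral)
    have "(\<lambda>p. ennreal (heat_kernel (fst (fst p) - snd p) (D * (t - snd (fst p)))) * f (snd p) (snd (fst p)))
        \<in> borel_measurable ((borel \<Otimes>\<^sub>M borel) \<Otimes>\<^sub>M lborel)"
      by measurable
    then show "(\<lambda>(z, y). ennreal (heat_kernel (fst z - y) (D * (t - snd z))) * f y (snd z))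
        \<in> borel_measurable ((borel \<Otimes>\<^sub>M borel) \<Otimes>\<^sub>M lborel)"
      by (simp add: case_prod_beta)
  qed
  have src1: "(\<lambda>s. ?src x s) \<in> borel_measurable borel" for x
    using measurable_compose[OF measurable_Pair1' src, of x] by simp
  have src_ind: "(\<lambda>s. ?src x s * indicator {\<tau><..<t} s) \<in> borel_measurable lborel" for x
    using src1[of x] by measurable
  have src_prod: "(\<lambda>z. ?src (fst z) (snd z) * indicator {\<tau><..<t} (snd z)) \<in> borel_measurable (borel \<Otimes>\<^sub>M borel)"
    using src by measurable
  have int_src: "(\<lambda>x. \<integral>\<^sup>+ s. ?src x s * indicator {\<tau><..<t} s \<partial>lborel) \<in> borel_measurable borel"
    using src_prod by (intro lborel.borel_measurable_nn_integral) (simp add: case_prod_beta cong: measurable_cong_sets)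
  have "test_integral w t \<phi> =
      (\<integral>\<^sup>+ x. heat_flow (D * (t - \<tau>)) (\<lambda>y. w y \<tau>) x * ennreal (\<phi> x) +
        (\<integral>\<^sup>+ s. ?src x s * indicator {\<tau><..<t} s \<partial>lborel) * ennreal (\<phi> x) \<partial>lborel)"
  proof (rule nn_integral_cong_AE)
    show "AE x in lborel. w x t * ennreal (\<phi> x) = heat_flow (D * (t - \<tau>)) (\<lambda>y. w y \<tau>) x * ennreal (\<phi> x) +
        (\<integral>\<^sup>+ s. ?src x s * indicator {\<tau><..<t} s \<partial>lborel) * ennreal (\<phi> x)"
      using eqn by eventually_elim (simp add: mild_identity_def distrib_right)
  qed
  also have "\<dots> = (\<integral>\<^sup>+ x. heat_flow (D * (t - \<tau>)) (\<lambda>y. w y \<tau>) x * ennreal (\<phi> x) \<partial>lborel) +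
      (\<integral>\<^sup>+ x. (\<integral>\<^sup>+ s. ?src x s * indicator {\<tau><..<t} s \<partial>lborel) * ennreal (\<phi> x) \<partial>lborel)"
    by (rule nn_integral_add) (use int_src in measurable)
  also have "(\<integral>\<^sup>+ x. heat_flow (D * (t - \<tau>)) (\<lambda>y. w y \<tau>) x * ennreal (\<phi> x) \<partial>lborel) =
      (\<integral>\<^sup>+ y. w y \<tau> * kernel_average \<phi> (D * (t - \<tau>)) y \<partial>lborel)"
    by (rule heat_flow_dual) measurable
  also have "(\<integral>\<^sup>+ x. (\<integral>\<^sup>+ s. ?src x s * indicator {\<tau><..<t} s \<partial>lborel) * ennreal (\<phi> x) \<partial>lborel) =
      (\<integral>\<^sup>+ x. (\<integral>\<^sup>+ s. ?src x s * indicator {\<tau><..<t} s * ennreal (\<phi> x) \<partial>lborel) \<partial>lborel)"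
    by (intro nn_integral_cong nn_integral_multc[symmetric] src_ind)
  also have "\<dots> = (\<integral>\<^sup>+ s. (\<integral>\<^sup>+ x. ?src x s * indicator {\<tau><..<t} s * ennreal (\<phi> x) \<partial>lborel) \<partial>lborel)"
  proof (rule lborel_pair.Fubini'[symmetric])
    have "(\<lambda>z. ?src (fst z) (snd z) * indicator {\<tau><..<t} (snd z) * ennreal (\<phi> (fst z))) \<in> borel_measurable (borel \<Otimes>\<^sub>M borel)"
      using src_prod by measurable
    then show "(\<lambda>(x, s). ?src x s * indicator {\<tau><..<t} s * ennreal (\<phi> x)) \<in> borel_measurable (lborel \<Otimes>\<^sub>M lborel)"
      by (simp add: case_prod_beta cong: measurable_cong_sets)
  qed
  also have "\<dots> = (\<integral>\<^sup>+ s\<in>{\<tau><..<t}. (\<integral>\<^sup>+ y. f y s * kernel_average \<phi> (D * (t - s)) y \<partial>lborel) \<partial>lborel)"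
  proof (rule nn_integral_cong)
    fix s :: real
    have "(\<integral>\<^sup>+ x. ?src x s * indicator {\<tau><..<t} s * ennreal (\<phi> x) \<partial>lborel) =
        (\<integral>\<^sup>+ x. ?src x s * ennreal (\<phi> x) \<partial>lborel) * indicator {\<tau><..<t} s"
      by (cases "s \<in> {\<tau><..<t}") auto
    also have "(\<integral>\<^sup>+ x. ?src x s * ennreal (\<phi> x) \<partial>lborel) =
        (\<integral>\<^sup>+ y. f y s * kernel_average \<phi> (D * (t - s)) y \<partial>lborel)"
      by (rule heat_flow_dual) measurable
    finally show "(\<integral>\<^sup>+ x. ?src x s * indicator {\<tau><..<t} s * ennreal (\<phi> x) \<partial>lborel) =
      (\<integral>\<^sup>+ y. f y s * kernel_average \<phi> (D * (t - s)) y \<partial>lborel) * indicator {\<tau><..<t} s" .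
  qed
  finally show ?thesis .
qed

end

lemma nn_integral_small_interval:
  fixes \<psi> :: "real \<Rightarrow> ennreal"
  assumes [measurable]: "\<psi> \<in> borel_measurable borel" and fin: "(\<integral>\<^sup>+ s\<in>{0<..<a}. \<psi> s \<partial>lborel) < \<infinity>"
    and a: "a > 0" and e: "e > 0"
  obtains \<delta> where "0 < \<delta>" "\<delta> \<le> a" "(\<integral>\<^sup>+ s\<in>{0<..<\<delta>}. \<psi> s \<partial>lborel) \<le> ennreal e"
proof -
  define M where "M = density lborel \<psi>"
  define A where "A n = {0<..<a / real (Suc n)}" for n
  have emb: "emeasure M (A n) = (\<integral>\<^sup>+ s\<in>A n. \<psi> s \<partial>lborel)" for n
    unfolding M_def A_def by (subst emeasure_density) auto
  have A_mono: "A n \<subseteq> A m" if "m \<le> n" for m n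
  proof -
    have "a / real (Suc n) \<le> a / real (Suc m)" using that a by (intro divide_left_mono) auto
    then show ?thesis unfolding A_def by auto
  qed
  have "(\<lambda>n. emeasure M (A n)) \<longlonglongrightarrow> emeasure M (\<Inter>n. A n)"
  proof (rule Lim_emeasure_decseq)
    show "range A \<subseteq> sets M" by (auto simp: A_def M_def)
    show "decseq A" using A_mono by (auto simp: decseq_def)
    have "emeasure M (A n) \<le> emeasure M (A 0)" for n
      using A_mono[of 0 n] by (intro emeasure_mono) (auto simp: A_def M_def)
    moreover have "emeasure M (A 0) < \<infinity>" using fin unfolding emb by (simp add: A_def)
    ultimately show "emeasure M (A n) \<noteq> \<infinity>" for n by (metis infinity_ennreal_def order_le_less_trans less_irrefl)
  qed
  moreover have "(\<Inter>n. A n) = {}"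
  proof (rule equals0I)
    fix s assume s: "s \<in> (\<Inter>n. A n)"
    then have "s \<in> A 0" by blast
    then have "0 < s / a" using a by (simp add: A_def)
    then obtain n where "inverse (real (Suc n)) < s / a" using reals_Archimedean by blast
    then have "a / real (Suc n) < s" using a by (simp add: field_simps)
    moreover have "s \<in> A n" using s by blast
    ultimately show False by (simp add: A_def)
  qed
  ultimately have "(\<lambda>n. emeasure M (A n)) \<longlonglongrightarrow> 0" by simp
  then have "\<forall>\<^sub>F n in sequentially. emeasure M (A n) < ennreal e"
    by (rule order_tendstoD(2)) (use e in simp)
  then obtain n where n: "emeasure M (A n) < ennreal e" by (auto simp: eventually_sequentially)
  show ?thesis
  proof
    show "0 < a / real (Suc n)" using a by simp
    show "a / real (Suc n) \<le> a" using a by (simp add: field_simps)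
    show "(\<integral>\<^sup>+ s\<in>{0<..<a / real (Suc n)}. \<psi> s \<partial>lborel) \<le> ennreal e" using less_imp_le[OF n, unfolded emb] unfolding A_def .
  qed
qed

context linear_mild_solution
begin

text \<open>Two times \<open>t\<close> and \<open>t'\<close> are compared through an earlier time \<open>\<tau>\<close> from which the equation holds up to
  both of them. Passing from \<open>\<tau>\<close> to \<open>t\<close> changes the integral of \<open>w\<close> against \<open>\<phi>\<close> by the error
  \<open>\<epsilon> g\<close> in the heat flow of \<open>\<phi>\<close>, integrated against \<open>w(\<tau>)\<close>, and by the contribution of the source,
  which is small because its weighted integral over \<open>(0, t)\<close> tends to 0 with \<open>t\<close>.\<close>
lemma test_integrals_Cauchy:
  obtains N where "N \<in> null_sets lebesgue"
    "\<And>t. 0 < t \<Longrightarrow> t < T / 4 \<Longrightarrow> t \<notin> N \<Longrightarrow> AE x in lborel. w x t < \<infinity>"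
    "\<And>\<phi> t. csc \<phi> \<Longrightarrow> (\<And>x. 0 \<le> \<phi> x) \<Longrightarrow> 0 < t \<Longrightarrow> t < T / 4 \<Longrightarrow> t \<notin> N \<Longrightarrow>
      test_integral w t \<phi> < \<infinity>"
    "\<And>\<phi> e. csc \<phi> \<Longrightarrow> (\<And>x. 0 \<le> \<phi> x) \<Longrightarrow> 0 < e \<Longrightarrow>
      \<exists>\<delta>>0. \<forall>t t'. 0 < t \<and> t < \<delta> \<and> 0 < t' \<and> t' < \<delta> \<and> t \<notin> N \<and> t' \<notin> N \<longrightarrow>
        test_integral w t \<phi> \<le> test_integral w t' \<phi> + ennreal e"
proof -
  obtain x0 :: 'a and C :: real where C: "C \<ge> 0"
    and wC: "AE \<tau> in lborel. 0 < \<tau> \<and> \<tau> < T / 4 \<longrightarrow>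
      (\<integral>\<^sup>+ y. w y \<tau> * ennreal (exp (- ((norm (y - x0))\<^sup>2 / (D * T)))) \<partial>lborel) \<le> ennreal C"
    and fC: "(\<integral>\<^sup>+ s\<in>{0<..<T / 4}. (\<integral>\<^sup>+ y. f y s * ennreal (exp (- ((norm (y - x0))\<^sup>2 / (D * T)))) \<partial>lborel) \<partial>lborel) \<le> ennreal C"
    by (rule gaussian_weight_bound)
  define g where "g y = exp (- ((norm (y - x0))\<^sup>2 / (D * T)))" for y
  have g0: "g y > 0" for y by (simp add: g_def)
  have [measurable]: "g \<in> borel_measurable borel" unfolding g_def by measurable
  define \<psi> where "\<psi> s = (\<integral>\<^sup>+ y. f y s * ennreal (g y) \<partial>lborel)" for s
  have \<psi>_meas[measurable]: "\<psi> \<in> borel_measurable borel" unfolding \<psi>_def by measurable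
  have \<psi>C: "(\<integral>\<^sup>+ s\<in>{0<..<T / 4}. \<psi> s \<partial>lborel) \<le> ennreal C" using fC by (simp add: \<psi>_def g_def)
  define wbd where "wbd \<tau> \<longleftrightarrow> (\<integral>\<^sup>+ y. w y \<tau> * ennreal (g y) \<partial>lborel) \<le> ennreal C" for \<tau>
  define good where "good t \<longleftrightarrow> (0 < t \<and> t < T / 4 \<longrightarrow>
      wbd t \<and> (AE \<tau> in lborel. 0 < \<tau> \<and> \<tau> < t \<longrightarrow> wbd \<tau> \<and> (AE x in lborel. eqn x \<tau> t)))" for t
  have wbd_AE: "AE \<tau> in lborel. 0 < \<tau> \<and> \<tau> < T / 4 \<longrightarrow> wbd \<tau>" using wC by (simp add: wbd_def g_def)
  have "AE t in lborel. good t"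
    using eqn_AE_t_tau_x wbd_AE
  proof eventually_elim
    case (elim t)
    show ?case unfolding good_def
    proof (intro impI conjI)
      assume t: "0 < t \<and> t < T / 4"
      then show "wbd t" using elim by blast
      show "AE \<tau> in lborel. 0 < \<tau> \<and> \<tau> < t \<longrightarrow> wbd \<tau> \<and> (AE x in lborel. eqn x \<tau> t)"
        using elim(1) wbd_AE by eventually_elim (use t T in auto)
    qed
  qed
  then have "AE t in lebesgue. good t" by (rule AE_completion)
  then obtain N where N: "N \<in> null_sets lebesgue" "\<And>t. t \<notin> N \<Longrightarrow> good t"
    unfolding eventually_ae_filter by auto
  have dominated: "\<exists>B>0. \<forall>x. \<phi> x \<le> B * g x" if \<phi>: "csc \<phi>" for \<phi> :: "'a \<Rightarrow> real"
  proof -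
    obtain R B where B: "R > 0" "B > 0" "\<And>x. \<bar>\<phi> x\<bar> \<le> B" "\<And>x. \<phi> x \<noteq> 0 \<Longrightarrow> norm x \<le> R"
      by (rule csc_bounded[OF \<phi>]) blast
    define m where "m = exp (- ((R + norm x0)\<^sup>2 / (D * T)))"
    have "\<phi> x \<le> B / m * g x" for x
    proof (cases "\<phi> x = 0")
      case True then show ?thesis using B(2) g0[of x] by (simp add: m_def)
    next
      case False
      then have "norm (x - x0) \<le> R + norm x0" using B(4)[of x] norm_triangle_ineq4[of x x0] by simp
      then have "(norm (x - x0))\<^sup>2 / (D * T) \<le> (R + norm x0)\<^sup>2 / (D * T)"
        using D T by (intro divide_right_mono power_mono) auto
      then have "m \<le> g x" by (simp add: m_def g_def)
      then have "B * m \<le> B * g x" using B(2) by simp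
      moreover have "\<phi> x \<le> B" using B(3)[of x] by simp
      moreover have "m > 0" by (simp add: m_def)
      ultimately show ?thesis by (simp add: pos_le_divide_eq) (smt (verit) mult_right_mono)
    qed
    moreover have "B / m > 0" using B(2) by (simp add: m_def)
    ultimately show ?thesis by blast
  qed
  have meas: "\<phi> \<in> borel_measurable borel" if "csc \<phi>" for \<phi> :: "'a \<Rightarrow> real"
    using that by (intro borel_measurable_continuous_onI) (simp add: csc_iff)
  have weight_mult: "(\<integral>\<^sup>+ y. W y * ennreal (c * g y) \<partial>lborel) = ennreal c * (\<integral>\<^sup>+ y. W y * ennreal (g y) \<partial>lborel)"
    if "c \<ge> 0" and [measurable]: "W \<in> borel_measurable borel" for W c
  proof -
    have "(\<integral>\<^sup>+ y. W y * ennreal (c * g y) \<partial>lborel) = (\<integral>\<^sup>+ y. ennreal c * (W y * ennreal (g y)) \<partial>lborel)"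
      using that(1) g0 by (intro nn_integral_cong) (simp add: ennreal_mult less_imp_le mult_ac)
    then show ?thesis by (subst (asm) nn_integral_cmult) auto
  qed
  show ?thesis
  proof (rule that[OF N(1)])
    fix t assume t: "0 < t" "t < T / 4" "t \<notin> N"
    then have "AE \<tau> in lborel. 0 < \<tau> \<and> \<tau> < t \<longrightarrow> wbd \<tau> \<and> (AE x in lborel. eqn x \<tau> t)"
      using N(2)[OF t(3)] by (simp add: good_def)
    from AE_lborel_point[OF this t(1)] obtain \<tau> where "AE x in lborel. eqn x \<tau> t" by auto
    then show "AE x in lborel. w x t < \<infinity>" by eventually_elim (unfold mild_identity_def, erule conjunct1)
  next
    fix \<phi> :: "'a \<Rightarrow> real" and t
    assume \<phi>: "csc \<phi>" "\<And>x. 0 \<le> \<phi> x" and t: "0 < t" "t < T / 4" "t \<notin> N"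
    obtain B where B: "B > 0" "\<And>x. \<phi> x \<le> B * g x" using dominated[OF \<phi>(1)] by blast
    have "wbd t" using N(2)[OF t(3)] t by (simp add: good_def)
    have "test_integral w t \<phi> \<le> (\<integral>\<^sup>+ x. w x t * ennreal (B * g x) \<partial>lborel)"
      using B(2) by (intro nn_integral_mono mult_left_mono ennreal_leI) auto
    also have "\<dots> = ennreal B * (\<integral>\<^sup>+ x. w x t * ennreal (g x) \<partial>lborel)"
      using B(1) by (intro weight_mult) auto
    also have "\<dots> \<le> ennreal B * ennreal C"
      using \<open>wbd t\<close> unfolding wbd_def by (intro mult_left_mono) auto
    also have "\<dots> < \<infinity>" by (simp add: ennreal_mult_less_top)
    finally show "test_integral w t \<phi> < \<infinity>" .
  next
    fix \<phi> :: "'a \<Rightarrow> real" and e :: real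
    assume \<phi>: "csc \<phi>" "\<And>x. 0 \<le> \<phi> x" and e: "0 < e"
    have [measurable]: "\<phi> \<in> borel_measurable borel" by (rule meas[OF \<phi>(1)])
    obtain B where B: "B > 0" "\<And>x. \<phi> x \<le> B * g x" using dominated[OF \<phi>(1)] by blast
    \<comment> \<open>The error of the heat flow enters twice and contributes at most \<open>e/4\<close> each time; the source contributes at most \<open>e/2\<close>.\<close>
    define \<epsilon> where "\<epsilon> = min 1 (e / (4 * (C + 1)))"
    have \<epsilon>: "\<epsilon> > 0" "\<epsilon> \<le> 1" "\<epsilon> * C \<le> e / 4"
    proof -
      show "\<epsilon> > 0" "\<epsilon> \<le> 1" using e C by (auto simp: \<epsilon>_def)
      have "\<epsilon> * C \<le> e / (4 * (C + 1)) * C" using C by (intro mult_right_mono) (auto simp: \<epsilon>_def)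
      also have "\<dots> \<le> e / 4" using e C by (simp add: field_simps)
      finally show "\<epsilon> * C \<le> e / 4" .
    qed
    have DT: "D * T > 0" using D T by simp
    define S where "S h y = kernel_average \<phi> h y" for h y
    obtain \<delta>1 where \<delta>1: "\<delta>1 > 0" "\<And>h y. 0 < h \<Longrightarrow> h < \<delta>1 \<Longrightarrow>
        S h y \<le> ennreal (\<phi> y + \<epsilon> * g y) \<and> ennreal (\<phi> y) \<le> S h y + ennreal (\<epsilon> * g y)"
      using heat_flow_test_function[OF \<phi> DT \<epsilon>(1), of x0] unfolding S_def g_def by blast
    have S_meas[measurable]: "S h \<in> borel_measurable borel" for h unfolding S_def by measurable
    have S_weight: "S h y \<le> ennreal ((B + 1) * g y)" if "0 < h" "h < \<delta>1" for h y
    proof -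
      have "\<phi> y + \<epsilon> * g y \<le> (B + 1) * g y"
        using B(2)[of y] \<epsilon>(2) g0[of y] by (simp add: distrib_right mult_left_le_one_le add_mono)
      then show ?thesis using \<delta>1(2)[OF that, of y] by (meson ennreal_leI order_trans)
    qed
    have fin: "(\<integral>\<^sup>+ s\<in>{0<..<T / 4}. \<psi> s \<partial>lborel) < \<infinity>" using \<psi>C by (rule order_le_less_trans) simp
    have pos: "0 < e / (2 * (B + 1))" "0 < T / 4" using e B(1) T by auto
    obtain \<delta>2 where \<delta>2: "0 < \<delta>2" "\<delta>2 \<le> T / 4" "(\<integral>\<^sup>+ s\<in>{0<..<\<delta>2}. \<psi> s \<partial>lborel) \<le> ennreal (e / (2 * (B + 1)))"
      by (rule nn_integral_small_interval[OF \<psi>_meas fin pos(2,1)])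
    define \<delta> where "\<delta> = min (\<delta>1 / D) \<delta>2"
    have "\<delta> > 0" using \<delta>1 \<delta>2 D by (simp add: \<delta>_def)
    moreover have "test_integral w t \<phi> \<le> test_integral w t' \<phi> + ennreal e"
      if t: "0 < t" "t < \<delta>" "0 < t'" "t' < \<delta>" "t \<notin> N" "t' \<notin> N" for t t'
    proof -
      have tt: "t < T / 4" "t' < T / 4" using t \<delta>2 by (auto simp: \<delta>_def)
      have "AE \<tau> in lborel. 0 < \<tau> \<and> \<tau> < t \<longrightarrow> wbd \<tau> \<and> (AE x in lborel. eqn x \<tau> t)"
        "AE \<tau> in lborel. 0 < \<tau> \<and> \<tau> < t' \<longrightarrow> wbd \<tau> \<and> (AE x in lborel. eqn x \<tau> t')"
        using N(2) t tt unfolding good_def by blast+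
      then have "AE \<tau> in lborel. 0 < \<tau> \<and> \<tau> < min t t' \<longrightarrow> wbd \<tau> \<and> (AE x in lborel. eqn x \<tau> t) \<and> (AE x in lborel. eqn x \<tau> t')"
        by eventually_elim auto
      from AE_lborel_point[OF this, of 0 "min t t'"] t
      obtain \<tau> where \<tau>: "0 < \<tau>" "\<tau> < t" "\<tau> < t'" "wbd \<tau>" "AE x in lborel. eqn x \<tau> t" "AE x in lborel. eqn x \<tau> t'"
        by auto
      have small: "0 < D * (s' - s)" "D * (s' - s) < \<delta>1" if "0 \<le> s" "s < s'" "s' < \<delta>" for s s'
      proof -
        show "0 < D * (s' - s)" using D that by simp
        have "s' - s < \<delta>1 / D" using that by (simp add: \<delta>_def)
        then show "D * (s' - s) < \<delta>1" using D by (simp add: pos_less_divide_eq mult.commute)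
      qed
      define E where "E t = test_integral w t \<phi>" for t
      have g\<tau>: "ennreal \<epsilon> * (\<integral>\<^sup>+ y. w y \<tau> * ennreal (g y) \<partial>lborel) \<le> ennreal (e / 4)"
      proof -
        have "ennreal \<epsilon> * (\<integral>\<^sup>+ y. w y \<tau> * ennreal (g y) \<partial>lborel) \<le> ennreal \<epsilon> * ennreal C"
          using \<tau>(4) unfolding wbd_def by (intro mult_left_mono) auto
        also have "\<dots> \<le> ennreal (e / 4)" using \<epsilon> C by (simp add: ennreal_mult[symmetric] ennreal_leI)
        finally show ?thesis .
      qed
      have g\<tau>': "(\<integral>\<^sup>+ y. w y \<tau> * ennreal (\<epsilon> * g y) \<partial>lborel) \<le> ennreal (e / 4)"
        using g\<tau> \<epsilon>(1) by (subst weight_mult) auto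
      have upper: "E t \<le> E \<tau> + ennreal (e / 4) + ennreal (e / 2)"
      proof -
        have "E t = (\<integral>\<^sup>+ y. w y \<tau> * S (D * (t - \<tau>)) y \<partial>lborel) +
            (\<integral>\<^sup>+ s\<in>{\<tau><..<t}. (\<integral>\<^sup>+ y. f y s * S (D * (t - s)) y \<partial>lborel) \<partial>lborel)"
          unfolding E_def S_def by (rule weak_form[OF _ \<tau>(5)]) measurable
        also have "(\<integral>\<^sup>+ y. w y \<tau> * S (D * (t - \<tau>)) y \<partial>lborel) \<le> (\<integral>\<^sup>+ y. w y \<tau> * ennreal (\<phi> y) + w y \<tau> * ennreal (\<epsilon> * g y) \<partial>lborel)"
        proof (rule nn_integral_mono)
          fix y
          have "S (D * (t - \<tau>)) y \<le> ennreal (\<phi> y + \<epsilon> * g y)" using \<delta>1(2) small[of \<tau> t] \<tau> t by simp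
          also have "\<dots> = ennreal (\<phi> y) + ennreal (\<epsilon> * g y)" using \<phi>(2) \<epsilon>(1) g0[of y] by (intro ennreal_plus) auto
          finally show "w y \<tau> * S (D * (t - \<tau>)) y \<le> w y \<tau> * ennreal (\<phi> y) + w y \<tau> * ennreal (\<epsilon> * g y)"
            by (metis distrib_left mult_left_mono zero_le)
        qed
        also have "\<dots> = E \<tau> + (\<integral>\<^sup>+ y. w y \<tau> * ennreal (\<epsilon> * g y) \<partial>lborel)"
          unfolding E_def by (rule nn_integral_add) measurable
        also have "\<dots> \<le> E \<tau> + ennreal (e / 4)" using g\<tau>' by (rule add_left_mono)
        also have "(\<integral>\<^sup>+ s\<in>{\<tau><..<t}. (\<integral>\<^sup>+ y. f y s * S (D * (t - s)) y \<partial>lborel) \<partial>lborel) \<le>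
            (\<integral>\<^sup>+ s. ennreal (B + 1) * (\<psi> s * indicator {0<..<\<delta>2} s) \<partial>lborel)"
        proof (rule nn_integral_mono)
          fix s
          show "(\<integral>\<^sup>+ y. f y s * S (D * (t - s)) y \<partial>lborel) * indicator {\<tau><..<t} s \<le> ennreal (B + 1) * (\<psi> s * indicator {0<..<\<delta>2} s)"
          proof (cases "s \<in> {\<tau><..<t}")
            case True
            then have s: "0 < s" "s < \<delta>2" using \<tau> t by (auto simp: \<delta>_def)
            have "(\<integral>\<^sup>+ y. f y s * S (D * (t - s)) y \<partial>lborel) \<le> (\<integral>\<^sup>+ y. f y s * ennreal ((B + 1) * g y) \<partial>lborel)"
              using True small[of s t] s t by (intro nn_integral_mono mult_left_mono S_weight) auto
            also have "\<dots> = ennreal (B + 1) * \<psi> s"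
              unfolding \<psi>_def using B(1) by (intro weight_mult) auto
            finally show ?thesis using True s by simp
          qed simp
        qed
        also have "\<dots> = ennreal (B + 1) * (\<integral>\<^sup>+ s\<in>{0<..<\<delta>2}. \<psi> s \<partial>lborel)"
          by (rule nn_integral_cmult) measurable
        also have "\<dots> \<le> ennreal (B + 1) * ennreal (e / (2 * (B + 1)))"
          by (intro mult_left_mono \<delta>2) simp
        also have "\<dots> = ennreal ((B + 1) * (e / (2 * (B + 1))))"
          using B(1) e by (intro ennreal_mult[symmetric]) auto
        also have "(B + 1) * (e / (2 * (B + 1))) = e / 2" using B(1) by (simp add: field_simps)
        finally show ?thesis by (simp add: add_mono)
      qed
      have lower: "E \<tau> \<le> E t' + ennreal (e / 4)"
      proof -
        have "E \<tau> \<le> (\<integral>\<^sup>+ y. w y \<tau> * S (D * (t' - \<tau>)) y + w y \<tau> * ennreal (\<epsilon> * g y) \<partial>lborel)"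
          unfolding E_def
        proof (rule nn_integral_mono)
          fix y
          have "ennreal (\<phi> y) \<le> S (D * (t' - \<tau>)) y + ennreal (\<epsilon> * g y)" using \<delta>1(2) small[of \<tau> t'] \<tau> t by simp
          then show "w y \<tau> * ennreal (\<phi> y) \<le> w y \<tau> * S (D * (t' - \<tau>)) y + w y \<tau> * ennreal (\<epsilon> * g y)"
            by (metis distrib_left mult_left_mono zero_le)
        qed
        also have "\<dots> = (\<integral>\<^sup>+ y. w y \<tau> * S (D * (t' - \<tau>)) y \<partial>lborel) + (\<integral>\<^sup>+ y. w y \<tau> * ennreal (\<epsilon> * g y) \<partial>lborel)"
          by (rule nn_integral_add) measurable
        also have "\<dots> \<le> E t' + ennreal (e / 4)"
        proof (rule add_mono[OF _ g\<tau>'])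
          have "E t' = (\<integral>\<^sup>+ y. w y \<tau> * S (D * (t' - \<tau>)) y \<partial>lborel) +
              (\<integral>\<^sup>+ s\<in>{\<tau><..<t'}. (\<integral>\<^sup>+ y. f y s * S (D * (t' - s)) y \<partial>lborel) \<partial>lborel)"
            unfolding E_def S_def by (rule weak_form[OF _ \<tau>(6)]) measurable
          then show "(\<integral>\<^sup>+ y. w y \<tau> * S (D * (t' - \<tau>)) y \<partial>lborel) \<le> E t'" by simp
        qed
        finally show ?thesis .
      qed
      have "E t \<le> (E t' + ennreal (e / 4)) + ennreal (e / 4) + ennreal (e / 2)"
        using upper lower by (meson add_right_mono order_trans)
      also have "\<dots> = E t' + ennreal e"
        using e by (simp add: add.assoc flip: ennreal_plus)
      finally show ?thesis unfolding E_def .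
    qed
    ultimately show "\<exists>\<delta>>0. \<forall>t t'. 0 < t \<and> t < \<delta> \<and> 0 < t' \<and> t' < \<delta> \<and> t \<notin> N \<and> t' \<notin> N \<longrightarrow>
        test_integral w t \<phi> \<le> test_integral w t' \<phi> + ennreal e"
      by blast
  qed
qed

end

section \<open>Initial traces\<close>

lemma at_0_within_null_nontrivial:
  assumes N: "N \<in> null_sets (lebesgue :: real measure)"
  shows "at 0 within {0<..} - N \<noteq> bot"
proof -
  have "AE t in lebesgue. t \<notin> N" using N by (rule AE_not_in)
  then have ae: "AE t in lborel. t \<notin> N" by (simp add: AE_completion_iff)
  have "0 islimpt ({0<..} - N)"
    unfolding islimpt_approachable
  proof (intro allI impI)
    fix e :: real assume "e > 0"
    from AE_lborel_point[OF ae this] obtain t where "0 < t" "t < e" "t \<notin> N" by blast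
    then show "\<exists>x'\<in>{0<..} - N. x' \<noteq> 0 \<and> dist x' 0 < e" by (intro bexI[of _ t]) auto
  qed
  then show ?thesis by (simp add: trivial_limit_within)
qed

lemma eventually_at_0_within:
  fixes N :: "real set"
  assumes "\<delta> > 0" "\<And>t. 0 < t \<Longrightarrow> t < \<delta> \<Longrightarrow> t \<notin> N \<Longrightarrow> P t"
  shows "\<forall>\<^sub>F t in at 0 within {0<..} - N. P t"
  unfolding eventually_at using assms by (intro exI[of _ \<delta>]) auto

lemma Cauchy_filter_limit:
  fixes E :: "'b \<Rightarrow> real"
  assumes "F \<noteq> bot" "\<And>e. e > 0 \<Longrightarrow> \<exists>P. eventually P F \<and> (\<forall>x y. P x \<and> P y \<longrightarrow> \<bar>E x - E y\<bar> < e)"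
  shows "\<exists>l. (E \<longlongrightarrow> l) F"
proof -
  have "cauchy_filter (filtermap E F)"
    unfolding cauchy_filter_metric_filtermap using assms(2) by (simp add: dist_real_def)
  moreover have "filtermap E F \<noteq> bot" using assms(1) by (simp add: filtermap_bot_iff)
  moreover have "complete (UNIV :: real set)" by (rule complete_UNIV)
  ultimately show ?thesis unfolding complete_uniform filterlim_def by (metis UNIV_I principal_UNIV top_greatest)
qed

text \<open>The function \<open>w\<close> is a Borel representative of \<open>u\<close>. The Cauchy property yields a limit for
  nonnegative test functions, the splitting into positive and negative parts extends it to all test
  functions, and the limit is a positive functional, to which the Riesz theorem applies.\<close>
lemma trace_of_Cauchy_test_integrals:
  fixes u w :: "'a::euclidean_space \<Rightarrow> real \<Rightarrow> ennreal"
  assumes N: "N \<in> null_sets lebesgue" and T: "T > 0"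
    and w_meas: "\<And>t. (\<lambda>x. w x t) \<in> borel_measurable borel"
    and uw: "\<And>t. 0 < t \<Longrightarrow> t < T \<Longrightarrow> t \<notin> N \<Longrightarrow> AE x in lborel. u x t = w x t"
    and fin: "\<And>t. 0 < t \<Longrightarrow> t < T \<Longrightarrow> t \<notin> N \<Longrightarrow> AE x in lborel. w x t < \<infinity>"
    and test_fin: "\<And>\<phi> t. csc \<phi> \<Longrightarrow> (\<And>x. 0 \<le> \<phi> x) \<Longrightarrow> 0 < t \<Longrightarrow> t < T \<Longrightarrow> t \<notin> N \<Longrightarrow>
      test_integral w t \<phi> < \<infinity>"
    and Cauchy: "\<And>\<phi> e. csc \<phi> \<Longrightarrow> (\<And>x. 0 \<le> \<phi> x) \<Longrightarrow> 0 < e \<Longrightarrow>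
      \<exists>\<delta>>0. \<forall>t t'. 0 < t \<and> t < \<delta> \<and> 0 < t' \<and> t' < \<delta> \<and> t \<notin> N \<and> t' \<notin> N \<longrightarrow>
        test_integral w t \<phi> \<le> test_integral w t' \<phi> + ennreal e"
  shows "\<exists>\<mu>. radon_measure \<mu> \<and> is_initial_trace u \<mu>"
proof -
  let ?F = "at 0 within {0<..} - N"
  have F: "?F \<noteq> bot" by (rule at_0_within_null_nontrivial[OF N])
  define E where "E \<phi> t = (LINT y|lebesgue. enn2real (u y t) * \<phi> y)" for \<phi> :: "'a \<Rightarrow> real" and t
  define I where "I \<phi> t \<longleftrightarrow> integrable lebesgue (\<lambda>y. enn2real (u y t) * \<phi> y)" for \<phi> :: "'a \<Rightarrow> real" and t
  have nonneg: "I \<phi> t \<and> 0 \<le> E \<phi> t \<and> test_integral w t \<phi> = ennreal (E \<phi> t)"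
    if \<phi>: "csc \<phi>" "\<And>x. 0 \<le> \<phi> x" and t: "0 < t" "t < T" "t \<notin> N" for \<phi> t
  proof -
    have [measurable]: "\<phi> \<in> borel_measurable borel"
      using \<phi>(1) by (intro borel_measurable_continuous_onI) (simp add: csc_iff)
    have [measurable]: "(\<lambda>x. w x t) \<in> borel_measurable borel" by (rule w_meas)
    define k where "k y = enn2real (w y t) * \<phi> y" for y
    have k_meas[measurable]: "k \<in> borel_measurable borel" unfolding k_def by measurable
    have k0: "0 \<le> k y" for y using \<phi>(2) by (simp add: k_def)
    have kk: "(\<integral>\<^sup>+ x. ennreal (k x) \<partial>lborel) = test_integral w t \<phi>"
    proof (rule nn_integral_cong_AE)
      show "AE x in lborel. ennreal (k x) = w x t * ennreal (\<phi> x)"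
        using fin[OF t] by eventually_elim (use \<phi>(2) in \<open>simp add: k_def ennreal_mult\<close>)
    qed
    then have fink: "(\<integral>\<^sup>+ x. ennreal (k x) \<partial>lborel) < \<infinity>" using test_fin[OF \<phi> t] by simp
    have intk: "integrable lborel k" using fink k0 by (intro integrableI_nonneg) auto
    then have intk': "integrable lebesgue k" by (simp add: integrable_completion)
    have "AE y in lborel. k y = enn2real (u y t) * \<phi> y"
      using uw[OF t] by eventually_elim (simp add: k_def)
    then have ae: "AE y in lebesgue. k y = enn2real (u y t) * \<phi> y" by (rule AE_completion)
    have k_meas': "k \<in> borel_measurable lebesgue" using k_meas by (simp add: measurable_completion)
    then have u_meas: "(\<lambda>y. enn2real (u y t) * \<phi> y) \<in> borel_measurable lebesgue"
      by (rule borel_measurable_AE[OF _ ae])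
    have I: "I \<phi> t" unfolding I_def
      using intk' integrable_cong_AE[OF k_meas' u_meas ae] by simp
    have "E \<phi> t = (LINT y|lebesgue. k y)" unfolding E_def
      using integral_cong_AE[OF k_meas' u_meas ae] by simp
    also have "\<dots> = (LINT y|lborel. k y)" using k_meas by (simp add: integral_completion)
    finally have Ek: "E \<phi> t = (LINT y|lborel. k y)" .
    then have "(\<integral>\<^sup>+ x. ennreal (k x) \<partial>lborel) = ennreal (E \<phi> t)"
      using nn_integral_eq_integral[OF intk] k0 by simp
    moreover have "0 \<le> E \<phi> t" unfolding Ek using k0 by (intro integral_nonneg_AE) auto
    ultimately show ?thesis using I kk by simp
  qed
  have limit_nonneg: "\<exists>l. (E \<phi> \<longlongrightarrow> l) ?F"
    if \<phi>: "csc \<phi>" "\<And>x. 0 \<le> \<phi> x" for \<phi>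
  proof (rule Cauchy_filter_limit[OF F])
    fix e :: real assume "e > 0"
    then obtain \<delta> where \<delta>: "\<delta> > 0" "\<And>t t'. 0 < t \<Longrightarrow> t < \<delta> \<Longrightarrow> 0 < t' \<Longrightarrow> t' < \<delta> \<Longrightarrow> t \<notin> N \<Longrightarrow> t' \<notin> N \<Longrightarrow>
        test_integral w t \<phi> \<le> test_integral w t' \<phi> + ennreal (e / 2)"
      using Cauchy[OF \<phi>, of "e / 2"] by auto
    define P where "P t \<longleftrightarrow> 0 < t \<and> t < min \<delta> T \<and> t \<notin> N" for t
    have half: "E \<phi> t \<le> E \<phi> t' + e / 2" if "P t" "P t'" for t t'
    proof -
      have "ennreal (E \<phi> t) \<le> ennreal (E \<phi> t') + ennreal (e / 2)"
        using \<delta>(2)[of t t'] nonneg[OF \<phi>, of t] nonneg[OF \<phi>, of t'] that by (simp add: P_def)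
      also have "\<dots> = ennreal (E \<phi> t' + e / 2)"
        using nonneg[OF \<phi>, of t'] that \<open>e > 0\<close> by (intro ennreal_plus[symmetric]) (auto simp: P_def)
      finally show ?thesis
        using nonneg[OF \<phi>, of t'] that \<open>e > 0\<close> by (subst (asm) ennreal_le_iff) (auto simp: P_def)
    qed
    have "\<bar>E \<phi> t - E \<phi> t'\<bar> < e" if "P t" "P t'" for t t'
      using half[OF that] half[OF that(2,1)] \<open>e > 0\<close> by linarith
    moreover have "eventually P ?F"
      by (rule eventually_at_0_within[of "min \<delta> T"]) (use \<delta>(1) T in \<open>auto simp: P_def\<close>)
    ultimately show "\<exists>P. eventually P ?F \<and> (\<forall>x y. P x \<and> P y \<longrightarrow> \<bar>E \<phi> x - E \<phi> y\<bar> < e)" by blast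
  qed
  have split: "\<forall>\<^sub>F t in ?F. I \<phi> t" "\<exists>l. (E \<phi> \<longlongrightarrow> l) ?F" if \<phi>: "csc \<phi>" for \<phi>
  proof -
    have m: "csc (\<lambda>x. - \<phi> x)" using csc_scale[OF \<phi>, of "-1"] by simp
    define P where "P x = max 0 (\<phi> x)" for x
    define Q where "Q x = max 0 (- \<phi> x)" for x
    have PQ: "csc P" "csc Q"
      unfolding P_def[abs_def] Q_def[abs_def] by (rule csc_pos[OF \<phi>], rule csc_pos[OF m])
    have PQ0: "0 \<le> P x" "0 \<le> Q x" for x by (auto simp: P_def Q_def)
    have eq: "enn2real (u y t) * \<phi> y = enn2real (u y t) * P y - enn2real (u y t) * Q y" for y t
      by (simp add: P_def Q_def max_def)
    have both: "I \<phi> t \<and> E \<phi> t = E P t - E Q t" if "0 < t" "t < T" "t \<notin> N" for t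
    proof -
      have "I P t" "I Q t" using nonneg[OF PQ(1) PQ0(1) that] nonneg[OF PQ(2) PQ0(2) that] by blast+
      then show ?thesis unfolding I_def E_def eq by simp
    qed
    then show "\<forall>\<^sub>F t in ?F. I \<phi> t" by (intro eventually_at_0_within[OF T]) auto
    have ev: "\<forall>\<^sub>F t in ?F. E P t - E Q t = E \<phi> t" using both by (intro eventually_at_0_within[OF T]) auto
    obtain a b where "(E P \<longlongrightarrow> a) ?F" "(E Q \<longlongrightarrow> b) ?F"
      using limit_nonneg[OF PQ(1) PQ0(1)] limit_nonneg[OF PQ(2) PQ0(2)] by blast
    then have "((\<lambda>t. E P t - E Q t) \<longlongrightarrow> a - b) ?F" by (rule tendsto_diff)
    then have "(E \<phi> \<longlongrightarrow> a - b) ?F" by (rule Lim_transform_eventually[OF _ ev])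
    then show "\<exists>l. (E \<phi> \<longlongrightarrow> l) ?F" by blast
  qed
  define L where "L \<phi> = Lim ?F (E \<phi>)" for \<phi>
  have L: "(E \<phi> \<longlongrightarrow> L \<phi>) ?F" if "csc \<phi>" for \<phi>
    using split(2)[OF that] tendsto_Lim[OF F] unfolding L_def by metis
  have "positive_functional L"
  proof
    fix \<phi> \<theta> :: "'a \<Rightarrow> real"
    assume c: "csc \<phi>" "csc \<theta>"
    have ev: "\<forall>\<^sub>F t in ?F. E \<phi> t + E \<theta> t = E (\<lambda>x. \<phi> x + \<theta> x) t"
      using split(1)[OF c(1)] split(1)[OF c(2)]
      by eventually_elim (simp add: I_def E_def distrib_left)
    have "(E (\<lambda>x. \<phi> x + \<theta> x) \<longlongrightarrow> L \<phi> + L \<theta>) ?F"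
      by (rule Lim_transform_eventually[OF tendsto_add[OF L[OF c(1)] L[OF c(2)]] ev])
    then show "L (\<lambda>x. \<phi> x + \<theta> x) = L \<phi> + L \<theta>"
      using L[OF csc_add[OF c]] F tendsto_unique by blast
  next
    fix \<phi> :: "'a \<Rightarrow> real" and k :: real
    assume c: "csc \<phi>"
    have "E (\<lambda>x. k * \<phi> x) = (\<lambda>t. k * E \<phi> t)"
      unfolding E_def by (simp add: mult.left_commute[of _ k])
    then have "(E (\<lambda>x. k * \<phi> x) \<longlongrightarrow> k * L \<phi>) ?F"
      using tendsto_mult_left[OF L[OF c], of k] by simp
    then show "L (\<lambda>x. k * \<phi> x) = k * L \<phi>"
      using L[OF csc_scale[OF c]] F tendsto_unique by blast
  next
    fix \<phi> :: "'a \<Rightarrow> real"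
    assume c: "csc \<phi>" "\<And>x. 0 \<le> \<phi> x"
    have "\<forall>\<^sub>F t in ?F. 0 \<le> E \<phi> t"
      using nonneg[OF c] by (intro eventually_at_0_within[OF T]) auto
    then show "0 \<le> L \<phi>" using tendsto_lowerbound[OF L[OF c(1)] _ F] by blast
  qed
  from riesz_representation[OF this] obtain \<mu> where \<mu>: "radon_measure \<mu>"
    "\<And>\<phi>. csc \<phi> \<Longrightarrow> L \<phi> = (LINT x|\<mu>. \<phi> x)" by blast
  have "is_initial_trace u \<mu>"
    unfolding is_initial_trace_def
  proof (intro allI impI bexI[OF _ N] conjI)
    fix \<phi> :: "'a \<Rightarrow> real" assume c: "csc \<phi>"
    show "\<forall>\<^sub>F t in ?F. integrable lebesgue (\<lambda>y. enn2real (u y t) * \<phi> y)"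
      using split(1)[OF c] by (simp add: I_def)
    show "((\<lambda>t. LINT y|lebesgue. enn2real (u y t) * \<phi> y) \<longlongrightarrow> (LINT y|\<mu>. \<phi> y)) ?F"
      using L[OF c] \<mu>(2)[OF c] by (simp add: E_def[abs_def])
  qed
  then show ?thesis using \<mu>(1) by blast
qed

lemma initial_trace_unique:
  fixes u :: "'a::euclidean_space \<Rightarrow> real \<Rightarrow> ennreal"
  assumes "radon_measure \<mu>" "radon_measure \<nu>" "is_initial_trace u \<mu>" "is_initial_trace u \<nu>"
  shows "\<mu> = \<nu>"
proof (rule radon_measure_eqI[OF assms(1,2)])
  fix \<phi> :: "'a \<Rightarrow> real" assume c: "csc \<phi>"
  let ?E = "\<lambda>t. LINT y|lebesgue. enn2real (u y t) * \<phi> y"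
  obtain Z1 where Z1: "Z1 \<in> null_sets lebesgue" "(?E \<longlongrightarrow> (LINT y|\<mu>. \<phi> y)) (at 0 within {0<..} - Z1)"
    using assms(3) c unfolding is_initial_trace_def by blast
  obtain Z2 where Z2: "Z2 \<in> null_sets lebesgue" "(?E \<longlongrightarrow> (LINT y|\<nu>. \<phi> y)) (at 0 within {0<..} - Z2)"
    using assms(4) c unfolding is_initial_trace_def by blast
  let ?F = "at 0 within {0<..} - (Z1 \<union> Z2)"
  have "?F \<noteq> bot" using Z1(1) Z2(1) by (intro at_0_within_null_nontrivial) auto
  moreover have "(?E \<longlongrightarrow> (LINT y|\<mu>. \<phi> y)) ?F" by (rule tendsto_within_subset[OF Z1(2)]) auto
  moreover have "(?E \<longlongrightarrow> (LINT y|\<nu>. \<phi> y)) ?F" by (rule tendsto_within_subset[OF Z2(2)]) auto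
  ultimately show "(LINT y|\<mu>. \<phi> y) = (LINT y|\<nu>. \<phi> y)" by (rule tendsto_unique)
qed

text \<open>A continuous cutoff that is 1 on the ball of radius \<open>\<sigma>\<close> and vanishes outside the ball of radius
  \<open>2\<sigma>\<close> carries the bound through the limit.\<close>
lemma trace_ball_bound:
  fixes u :: "'a::euclidean_space \<Rightarrow> real \<Rightarrow> ennreal"
  assumes \<mu>: "radon_measure \<mu>" "is_initial_trace u \<mu>" and \<sigma>: "\<sigma> > 0" and T: "T > 0" and B: "B \<ge> 0"
    and mass: "AE t in lebesgue. 0 < t \<and> t < T \<longrightarrow> (\<integral>\<^sup>+ y\<in>ball x (2 * \<sigma>). u y t \<partial>lebesgue) \<le> ennreal B"
  shows "emeasure \<mu> (ball x \<sigma>) \<le> ennreal B"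
proof -
  define \<phi> :: "'a \<Rightarrow> real" where "\<phi> y = max 0 (min 1 (2 - norm (y - x) / \<sigma>))" for y
  have supp: "y \<in> ball x (2 * \<sigma>)" if "\<phi> y \<noteq> 0" for y
  proof -
    have "norm (y - x) / \<sigma> < 2" using that by (auto simp: \<phi>_def max_def min_def split: if_splits)
    then show ?thesis using \<sigma> by (simp add: pos_divide_less_eq dist_norm norm_minus_commute)
  qed
  have range: "0 \<le> \<phi> y" "\<phi> y \<le> 1" for y by (auto simp: \<phi>_def)
  have one: "\<phi> y = 1" if "y \<in> ball x \<sigma>" for y
  proof -
    have "norm (y - x) / \<sigma> < 1" using that \<sigma> by (simp add: pos_divide_less_eq dist_norm norm_minus_commute)
    then show ?thesis by (simp add: \<phi>_def)
  qed
  have c: "csc \<phi>"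
    unfolding csc_iff
  proof
    show "continuous_on UNIV \<phi>" unfolding \<phi>_def using \<sigma> by (intro continuous_intros) auto
    have "norm y \<le> norm x + 2 * \<sigma>" if "\<phi> y \<noteq> 0" for y
      using supp[OF that] norm_triangle_ineq2[of y x] by (simp add: dist_norm norm_minus_commute)
    then show "\<exists>R. \<forall>y. \<phi> y \<noteq> 0 \<longrightarrow> norm y \<le> R" by blast
  qed
  obtain Z where Z: "Z \<in> null_sets lebesgue"
    "\<forall>\<^sub>F t in at 0 within {0<..} - Z. integrable lebesgue (\<lambda>y. enn2real (u y t) * \<phi> y)"
    "((\<lambda>t. LINT y|lebesgue. enn2real (u y t) * \<phi> y) \<longlongrightarrow> (LINT y|\<mu>. \<phi> y)) (at 0 within {0<..} - Z)"
    using \<mu>(2) c unfolding is_initial_trace_def by blast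
  obtain N where N: "N \<in> null_sets lebesgue"
    "\<And>t. t \<notin> N \<Longrightarrow> 0 < t \<Longrightarrow> t < T \<Longrightarrow> (\<integral>\<^sup>+ y\<in>ball x (2 * \<sigma>). u y t \<partial>lebesgue) \<le> ennreal B"
    using mass unfolding eventually_ae_filter by auto
  let ?F = "at 0 within {0<..} - (Z \<union> N)"
  have F: "?F \<noteq> bot" using Z(1) N(1) by (intro at_0_within_null_nontrivial) auto
  have le: "?F \<le> at 0 within {0<..} - Z" by (rule at_le) auto
  have "\<forall>\<^sub>F t in ?F. (LINT y|lebesgue. enn2real (u y t) * \<phi> y) \<le> B"
  proof -
    have "\<forall>\<^sub>F t in ?F. 0 < t \<and> t < T \<and> t \<notin> N" by (rule eventually_at_0_within[OF T]) auto
    then show ?thesis using filter_leD[OF le Z(2)]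
    proof eventually_elim
      case (elim t)
      have "ennreal (LINT y|lebesgue. enn2real (u y t) * \<phi> y) = (\<integral>\<^sup>+ y. ennreal (enn2real (u y t) * \<phi> y) \<partial>lebesgue)"
        using nn_integral_eq_integral[OF elim(2)] range by simp
      also have "\<dots> \<le> (\<integral>\<^sup>+ y\<in>ball x (2 * \<sigma>). u y t \<partial>lebesgue)"
      proof (rule nn_integral_mono)
        fix y
        show "ennreal (enn2real (u y t) * \<phi> y) \<le> u y t * indicator (ball x (2 * \<sigma>)) y"
        proof (cases "\<phi> y = 0")
          case False
          have "ennreal (enn2real (u y t) * \<phi> y) \<le> ennreal (enn2real (u y t))"
            using range[of y] by (intro ennreal_leI) (simp add: mult_left_le)
          also have "\<dots> \<le> u y t" by (cases "u y t") auto
          finally show ?thesis using supp[OF False] by simp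
        qed simp
      qed
      also have "\<dots> \<le> ennreal B" using N(2) elim(1) by blast
      finally show ?case using B by (simp add: ennreal_le_iff)
    qed
  qed
  then have "(LINT y|\<mu>. \<phi> y) \<le> B"
    by (rule tendsto_upperbound[OF tendsto_mono[OF le Z(3)] _ F])
  have \<phi>_int: "integrable \<mu> \<phi>" by (rule radon_measure_integrable[OF \<mu>(1) c])
  have "emeasure \<mu> (ball x \<sigma>) = (\<integral>\<^sup>+ y. indicator (ball x \<sigma>) y \<partial>\<mu>)"
    using radon_measureD(1)[OF \<mu>(1)] by (intro nn_integral_indicator[symmetric]) auto
  also have "\<dots> \<le> (\<integral>\<^sup>+ y. ennreal (\<phi> y) \<partial>\<mu>)"
    using one by (intro nn_integral_mono) (auto simp: indicator_def)
  also have "\<dots> = ennreal (LINT y|\<mu>. \<phi> y)" using nn_integral_eq_integral[OF \<phi>_int] range by simp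
  also have "\<dots> \<le> ennreal B" using \<open>(LINT y|\<mu>. \<phi> y) \<le> B\<close> by (rule ennreal_leI)
  finally show ?thesis .
qed

section \<open>Solutions of the system\<close>

lemma mild_identity_cong:
  assumes "u x t = w x t" "AE y in lborel. u y \<tau> = w y \<tau>"
    and "AE s in lborel. \<tau> < s \<and> s < t \<longrightarrow> (AE y in lborel. f y s = g y s)"
  shows "mild_identity D u f x \<tau> t \<longleftrightarrow> mild_identity D w g x \<tau> t"
proof -
  have flow: "heat_flow h W x = heat_flow h W' x" if "AE y in lborel. W y = W' y" for h W W'
    unfolding heat_flow_lborel by (rule nn_integral_cong_AE) (use that in \<open>eventually_elim, simp\<close>)
  have "(\<integral>\<^sup>+ s\<in>{\<tau><..<t}. heat_flow (D * (t - s)) (\<lambda>y. f y s) x \<partial>lborel) =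
      (\<integral>\<^sup>+ s\<in>{\<tau><..<t}. heat_flow (D * (t - s)) (\<lambda>y. g y s) x \<partial>lborel)"
  proof (rule nn_integral_cong_AE)
    show "AE s in lborel. heat_flow (D * (t - s)) (\<lambda>y. f y s) x * indicator {\<tau><..<t} s =
        heat_flow (D * (t - s)) (\<lambda>y. g y s) x * indicator {\<tau><..<t} s"
      using assms(3)
    proof eventually_elim
      case (elim s)
      show ?case
      proof (cases "s \<in> {\<tau><..<t}")
        case True
        then have "AE y in lborel. f y s = g y s" using elim by simp
        then show ?thesis by (simp add: flow[of "\<lambda>y. f y s" "\<lambda>y. g y s"])
      qed simp
    qed
  qed
  then show ?thesis
    unfolding mild_identity_def using assms(1) flow[OF assms(2)] by simp
qed

text \<open>A Lebesgue measurable function of \<open>(x, t)\<close> need not have measurable sections, and Tonelli's theorem is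
  used for Borel functions. Changing the solution on a null set repairs both; the two orders
  of the exceptional sets are those in which the equation is used.\<close>
lemma borel_representative:
  fixes u :: "'a::euclidean_space \<Rightarrow> real \<Rightarrow> ennreal"
  assumes "(\<lambda>(x, t). u x t) \<in> borel_measurable (lebesgue_on (UNIV \<times> {0<..<T}))"
  obtains w where "case_prod w \<in> borel_measurable borel"
    "AE t in lborel. 0 < t \<and> t < T \<longrightarrow> (AE x in lborel. u x t = w x t)"
    "AE x in lborel. AE t in lborel. 0 < t \<and> t < T \<longrightarrow> u x t = w x t"
proof -
  let ?S = "UNIV \<times> {0<..<T} :: ('a \<times> real) set"
  have "?S \<in> sets lebesgue" by (intro sets_completionI_sets) (auto intro!: borel_open open_Times)
  then have "(\<lambda>z. if z \<in> ?S then (case z of (x, t) \<Rightarrow> u x t) else 0) \<in> borel_measurable lebesgue"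
    using assms by (subst (asm) measurable_restrict_space_iff) auto
  from completion_ex_borel_measurable[OF this] obtain k where k: "k \<in> borel_measurable lborel"
    "AE z in lborel. (if z \<in> ?S then (case z of (x, t) \<Rightarrow> u x t) else 0) = k z" by auto
  define w where "w x t = k (x, t)" for x t
  have ae: "AE z in lborel. 0 < snd z \<and> snd z < T \<longrightarrow> u (fst z) (snd z) = w (fst z) (snd z)"
    using k(2) by eventually_elim (auto simp: w_def split: if_splits)
  show ?thesis
  proof
    show "case_prod w \<in> borel_measurable borel"
    proof -
      have "case_prod w = k" by (auto simp: w_def)
      then show ?thesis using k(1) by simp
    qed
    show "AE x in lborel. AE t in lborel. 0 < t \<and> t < T \<longrightarrow> u x t = w x t"
      using AE_lborel_curry[OF ae] by simp
    show "AE t in lborel. 0 < t \<and> t < T \<longrightarrow> (AE x in lborel. u x t = w x t)"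
      using AE_lborel_curry[OF AE_lborel_swap[OF ae]] by eventually_elim auto
  qed
qed

lemma lebesgue_measurable_of_AE_eq:
  fixes f g :: "'a::euclidean_space \<Rightarrow> 'b"
  assumes g: "g \<in> measurable borel N" and ae: "AE x in lborel. f x = g x" and sp: "\<And>x. f x \<in> space N"
  shows "f \<in> measurable lebesgue N"
proof (rule measurableI)
  fix A assume A: "A \<in> sets N"
  have gA: "g -` A \<in> sets lebesgue"
    using measurable_sets[OF g A] by (auto intro: sets_completionI_sets)
  have eq: "AE x in lebesgue. x \<in> g -` A \<longleftrightarrow> x \<in> f -` A"
    using AE_completion[OF ae] by eventually_elim simp
  have "f -` A \<in> sets lebesgue" by (rule completion.in_sets_AE[OF eq gA]) simp
  then show "f -` A \<inter> space lebesgue \<in> sets lebesgue" by simp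
qed (rule sp)

lemma borel_measurable_ennpowr:
  assumes f: "f \<in> borel_measurable M"
  shows "(\<lambda>x. ennpowr (f x) p) \<in> borel_measurable M"
  unfolding ennpowr_def
proof (rule measurable_If)
  have "(\<lambda>x. enn2real (f x)) \<in> borel_measurable M" using f by measurable
  then show "(\<lambda>x. ennreal (enn2real (f x) powr p)) \<in> borel_measurable M" by measurable
  show "{x \<in> space M. f x = \<infinity>} \<in> sets M"
    using measurable_sets[OF f, of "{\<infinity>}"] by (simp add: vimage_def Int_def conj_commute)
qed simp

text \<open>Exchanging the components lets every statement about \<open>u\<close> serve for \<open>v\<close> as well.\<close>
lemma is_solution_commute:
  assumes sol: "is_solution D1 D2 p q T u v" shows "is_solution D2 D1 q p T v u"
proof -
  note s = sol[unfolded is_solution_def]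
  show ?thesis
    unfolding is_solution_def
  proof (intro conjI)
    show "(\<lambda>(x, t). v x t) \<in> borel_measurable (lebesgue_on (UNIV \<times> {0<..<T}))"
      "(\<lambda>(x, t). u x t) \<in> borel_measurable (lebesgue_on (UNIV \<times> {0<..<T}))" using s by blast+
    show "AE (x, \<tau>, t) in lebesgue. 0 < \<tau> \<and> \<tau> < t \<and> t < T \<longrightarrow>
      v x t < \<infinity> \<and> u x t < \<infinity> \<and>
      v x t = heat_flow (D2 * (t - \<tau>)) (\<lambda>y. v y \<tau>) x +
        (\<integral>\<^sup>+ s\<in>{\<tau><..<t}. heat_flow (D2 * (t - s)) (\<lambda>y. ennpowr (u y s) q) x \<partial>lebesgue) \<and>
      u x t = heat_flow (D1 * (t - \<tau>)) (\<lambda>y. u y \<tau>) x +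
        (\<integral>\<^sup>+ s\<in>{\<tau><..<t}. heat_flow (D1 * (t - s)) (\<lambda>y. ennpowr (v y s) p) x \<partial>lebesgue)"
      using s[THEN conjunct2, THEN conjunct2] by (rule AE_mp) (rule AE_I2, clarsimp split: prod.splits)
  qed
qed

lemma solution_mild_identity:
  assumes "is_solution D1 D2 p q T u v"
  shows "AE x in lborel. AE t in lborel. AE \<tau> in lborel. 0 < \<tau> \<and> \<tau> < t \<and> t < T \<longrightarrow>
      mild_identity D1 u (\<lambda>y s. ennpowr (v y s) p) x \<tau> t"
    and "AE t in lborel. AE \<tau> in lborel. 0 < \<tau> \<and> \<tau> < t \<and> t < T \<longrightarrow>
      (AE x in lborel. mild_identity D1 u (\<lambda>y s. ennpowr (v y s) p) x \<tau> t)"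
    and "AE \<tau> in lborel. AE t in lborel. 0 < \<tau> \<and> \<tau> < t \<and> t < T \<longrightarrow>
      (AE x in lborel. mild_identity D1 u (\<lambda>y s. ennpowr (v y s) p) x \<tau> t)"
proof -
  let ?P = "mild_identity D1 u (\<lambda>y s. ennpowr (v y s) p)"
  have "AE z in lebesgue. 0 < fst (snd z) \<and> fst (snd z) < snd (snd z) \<and> snd (snd z) < T \<longrightarrow>
      ?P (fst z) (fst (snd z)) (snd (snd z))"
    using assms[unfolded is_solution_def, THEN conjunct2, THEN conjunct2]
    unfolding mild_identity_def nn_integral_completion
    by (rule AE_mp) (rule AE_I2, clarsimp split: prod.splits)
  then have ae: "AE z in lborel. 0 < fst (snd z) \<and> fst (snd z) < snd (snd z) \<and> snd (snd z) < T \<longrightarrow>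
      ?P (fst z) (fst (snd z)) (snd (snd z))"
    by (simp add: AE_completion_iff)
  show "AE x in lborel. AE t in lborel. AE \<tau> in lborel. 0 < \<tau> \<and> \<tau> < t \<and> t < T \<longrightarrow> ?P x \<tau> t"
    using AE_lborel_curry[OF ae]
  proof eventually_elim
    case (elim x)
    from AE_lborel_curry[OF AE_lborel_swap[OF this]] show ?case by simp
  qed
  have "AE s in lborel. 0 < fst s \<and> fst s < snd s \<and> snd s < T \<longrightarrow> (AE x in lborel. ?P x (fst s) (snd s))"
    using AE_lborel_curry[OF AE_lborel_swap[OF ae]] by eventually_elim auto
  from AE_lborel_curry[OF AE_lborel_swap[OF this]] AE_lborel_curry[OF this]
  show "AE t in lborel. AE \<tau> in lborel. 0 < \<tau> \<and> \<tau> < t \<and> t < T \<longrightarrow> (AE x in lborel. ?P x \<tau> t)"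
    "AE \<tau> in lborel. AE t in lborel. 0 < \<tau> \<and> \<tau> < t \<and> t < T \<longrightarrow> (AE x in lborel. ?P x \<tau> t)"
    by simp_all
qed

lemma solution_has_trace:
  fixes u :: "'a::euclidean_space \<Rightarrow> real \<Rightarrow> ennreal"
  assumes sol: "is_solution D1 D2 p q T u v" and D: "D1 > 0" and T: "T > 0"
  shows "\<exists>\<mu>. radon_measure \<mu> \<and> is_initial_trace u \<mu>"
proof -
  have um: "(\<lambda>(x, t). u x t) \<in> borel_measurable (lebesgue_on (UNIV \<times> {0<..<T}))"
    and vm: "(\<lambda>(x, t). v x t) \<in> borel_measurable (lebesgue_on (UNIV \<times> {0<..<T}))"
    using sol unfolding is_solution_def by blast+
  obtain w where w: "case_prod w \<in> borel_measurable borel"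
    "AE t in lborel. 0 < t \<and> t < T \<longrightarrow> (AE x in lborel. u x t = w x t)"
    "AE x in lborel. AE t in lborel. 0 < t \<and> t < T \<longrightarrow> u x t = w x t"
    by (rule borel_representative[OF um])
  obtain k where k: "case_prod k \<in> borel_measurable borel"
    "AE t in lborel. 0 < t \<and> t < T \<longrightarrow> (AE x in lborel. v x t = k x t)"
    by (rule borel_representative[OF vm])
  let ?f = "\<lambda>y s. ennpowr (v y s) p" and ?g = "\<lambda>y s. ennpowr (k y s) p"
  have fg: "AE s in lborel. \<tau> < s \<and> s < t \<longrightarrow> (AE y in lborel. ?f y s = ?g y s)" if "0 < \<tau>" "t < T" for \<tau> t
    using k(2)
  proof eventually_elim
    case (elim s)
    show ?case
    proof
      assume "\<tau> < s \<and> s < t"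
      then have "AE y in lborel. v y s = k y s" using elim that by auto
      then show "AE y in lborel. ?f y s = ?g y s" by eventually_elim simp
    qed
  qed
  interpret linear_mild_solution D1 T w ?g
  proof
    show "D1 > 0" "T > 0" "case_prod w \<in> borel_measurable borel" by fact+
    show "case_prod ?g \<in> borel_measurable borel"
      using borel_measurable_ennpowr[OF k(1), of p] by (simp add: case_prod_beta')
    show "AE x in lborel. AE t in lborel. AE \<tau> in lborel.
        0 < \<tau> \<and> \<tau> < t \<and> t < T \<longrightarrow> mild_identity D1 w ?g x \<tau> t"
      using solution_mild_identity(1)[OF sol] w(3)
    proof eventually_elim
      case (elim x)
      then show ?case
      proof eventually_elim
        case (elim t)
        from elim(1) w(2) show ?case
        proof eventually_elim
          case (elim \<tau>)
          then show ?case
            using mild_identity_cong[of u x t w \<tau> ?f ?g D1] fg[of \<tau> t] \<open>0 < t \<and> t < T \<longrightarrow> u x t = w x t\<close> by auto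
        qed
      qed
    qed
    show "AE t in lborel. AE \<tau> in lborel. 0 < \<tau> \<and> \<tau> < t \<and> t < T \<longrightarrow>
        (AE x in lborel. mild_identity D1 w ?g x \<tau> t)"
      using solution_mild_identity(2)[OF sol] w(2)
    proof eventually_elim
      case (elim t)
      note ut = elim(2)
      from elim(1) w(2) show ?case
      proof eventually_elim
        case (elim \<tau>)
        show ?case
        proof
          assume t: "0 < \<tau> \<and> \<tau> < t \<and> t < T"
          then have "AE x in lborel. u x t = w x t" "AE x in lborel. mild_identity D1 u ?f x \<tau> t"
            using ut elim by auto
          moreover have u\<tau>: "AE y in lborel. u y \<tau> = w y \<tau>" using elim t by auto
          ultimately show "AE x in lborel. mild_identity D1 w ?g x \<tau> t"
            by eventually_elim (use mild_identity_cong[of u _ t w \<tau> ?f ?g D1, OF _ u\<tau> fg] t in blast)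
        qed
      qed
    qed
  qed
  obtain N where N: "N \<in> null_sets lebesgue"
    "\<And>t. 0 < t \<Longrightarrow> t < T / 4 \<Longrightarrow> t \<notin> N \<Longrightarrow> AE x in lborel. w x t < \<infinity>"
    "\<And>\<phi> t. csc \<phi> \<Longrightarrow> (\<And>x. 0 \<le> \<phi> x) \<Longrightarrow> 0 < t \<Longrightarrow> t < T / 4 \<Longrightarrow> t \<notin> N \<Longrightarrow>
      test_integral w t \<phi> < \<infinity>"
    "\<And>\<phi> e. csc \<phi> \<Longrightarrow> (\<And>x. 0 \<le> \<phi> x) \<Longrightarrow> 0 < e \<Longrightarrow>
      \<exists>\<delta>>0. \<forall>t t'. 0 < t \<and> t < \<delta> \<and> 0 < t' \<and> t' < \<delta> \<and> t \<notin> N \<and> t' \<notin> N \<longrightarrow>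
        test_integral w t \<phi> \<le> test_integral w t' \<phi> + ennreal e"
    by (rule test_integrals_Cauchy) blast
  obtain N' where N': "N' \<in> null_sets lebesgue" "\<And>t. t \<notin> N' \<Longrightarrow> 0 < t \<Longrightarrow> t < T \<Longrightarrow> AE x in lborel. u x t = w x t"
    by (rule AE_E3[OF AE_completion[OF w(2)]]) auto
  show ?thesis
  proof (rule trace_of_Cauchy_test_integrals[where N = "N \<union> N'" and T = "T / 4" and w = w])
    show "N \<union> N' \<in> null_sets lebesgue" "T / 4 > 0" using N(1) N'(1) T by auto
    show "(\<lambda>x. w x t) \<in> borel_measurable borel" for t by measurable
    show "AE x in lborel. u x t = w x t" if "0 < t" "t < T / 4" "t \<notin> N \<union> N'" for t
      using N'(2)[of t] that T by auto
    show "AE x in lborel. w x t < \<infinity>" if "0 < t" "t < T / 4" "t \<notin> N \<union> N'" for t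
      using N(2)[of t] that by auto
    show "test_integral w t \<phi> < \<infinity>"
      if "csc \<phi>" "\<And>x. 0 \<le> \<phi> x" "0 < t" "t < T / 4" "t \<notin> N \<union> N'" for \<phi> t
      using N(3)[OF that(1,2,3,4)] that(5) by auto
    show "\<exists>\<delta>>0. \<forall>t t'. 0 < t \<and> t < \<delta> \<and> 0 < t' \<and> t' < \<delta> \<and> t \<notin> N \<union> N' \<and> t' \<notin> N \<union> N' \<longrightarrow>
        test_integral w t \<phi> \<le> test_integral w t' \<phi> + ennreal e"
      if "csc \<phi>" "\<And>x. 0 \<le> \<phi> x" "0 < e" for \<phi> e
      using N(4)[OF that] by (meson UnI1)
  qed
qed

lemma mild_supersolutionI:
  assumes "AE t in lborel. 0 < \<tau> \<and> \<tau> < t \<and> t < T \<longrightarrow> (AE x in lborel. mild_identity D w f x \<tau> t)"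
    and "0 < \<tau>" "b \<le> T"
  shows "mild_supersolution D f w \<tau> b"
  unfolding mild_supersolution_def nn_integral_completion AE_completion_iff
  using assms(1)
proof eventually_elim
  case (elim t)
  show ?case
  proof
    assume "\<tau> < t \<and> t < b"
    then have "AE x in lborel. mild_identity D w f x \<tau> t" using elim assms(2,3) by auto
    then show "AE x in lborel. heat_flow (D * (t - \<tau>)) (\<lambda>y. w y \<tau>) x +
        (\<integral>\<^sup>+ s\<in>{\<tau><..<t}. heat_flow (D * (t - s)) (\<lambda>y. f y s) x \<partial>lborel) \<le> w x t"
      by eventually_elim (simp add: mild_identity_def)
  qed
qed

lemma solution_mass_bound:
  fixes D1 D2 p q :: real
  assumes D: "D1 > 0" "D2 > 0" and pq: "0 < p" "0 < q" "p * q > 1"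
  shows "\<exists>\<gamma>>0. \<forall>(u :: 'a::euclidean_space \<Rightarrow> real \<Rightarrow> ennreal) v T. is_solution D1 D2 p q T u v \<longrightarrow>
    (AE \<tau> in lebesgue. 0 < \<tau> \<and> \<tau> < T \<longrightarrow> (\<forall>r z. 0 < r \<and> \<tau> + r\<^sup>2 / 8 \<le> T \<longrightarrow>
      (\<integral>\<^sup>+ y\<in>ball z r. u y \<tau> \<partial>lebesgue) \<le>
        ennreal (\<gamma> * r powr (real DIM('a) - 2 * (p + 1) / (p * q - 1)))))"
proof -
  obtain \<gamma> where \<gamma>: "\<gamma> > 0" "\<And>(U :: 'a \<Rightarrow> real \<Rightarrow> ennreal) V \<tau> r z. r > 0 \<Longrightarrow>
    mild_supersolution D1 (\<lambda>y s. ennpowr (V y s) p) U \<tau> (\<tau> + r\<^sup>2 / 8) \<Longrightarrow>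
    mild_supersolution D2 (\<lambda>y s. ennpowr (U y s) q) V \<tau> (\<tau> + r\<^sup>2 / 8) \<Longrightarrow>
    (AE t in lebesgue. \<tau> < t \<and> t < \<tau> + r\<^sup>2 / 8 \<longrightarrow> (AE x in lebesgue. U x t < \<infinity>)) \<Longrightarrow>
    (\<lambda>y. U y \<tau>) \<in> borel_measurable lebesgue \<Longrightarrow>
    (\<integral>\<^sup>+ y\<in>ball z r. U y \<tau> \<partial>lebesgue) \<le>
      ennreal (\<gamma> * r powr (real DIM('a) - 2 * (p + 1) / (p * q - 1)))"
    using local_mass_bound[OF D pq, where 'a = 'a] by blast
  have main: "AE \<tau> in lebesgue. 0 < \<tau> \<and> \<tau> < T \<longrightarrow> (\<forall>r z. 0 < r \<and> \<tau> + r\<^sup>2 / 8 \<le> T \<longrightarrow>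
      (\<integral>\<^sup>+ y\<in>ball z r. u y \<tau> \<partial>lebesgue) \<le>
        ennreal (\<gamma> * r powr (real DIM('a) - 2 * (p + 1) / (p * q - 1))))"
    if sol: "is_solution D1 D2 p q T u v" for u v :: "'a \<Rightarrow> real \<Rightarrow> ennreal" and T
  proof -
    have um: "(\<lambda>(x, t). u x t) \<in> borel_measurable (lebesgue_on (UNIV \<times> {0<..<T}))"
      using sol unfolding is_solution_def by blast
    obtain w where w: "case_prod w \<in> borel_measurable borel"
      "AE t in lborel. 0 < t \<and> t < T \<longrightarrow> (AE x in lborel. u x t = w x t)"
      by (rule borel_representative[OF um])
    have w_sec: "(\<lambda>y. w y \<tau>) \<in> borel_measurable borel" for \<tau>
      using measurable_compose[OF _ w(1), of "\<lambda>y. (y, \<tau>)" borel] by simp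
    show ?thesis
      unfolding AE_completion_iff
      using solution_mild_identity(3)[OF sol] solution_mild_identity(3)[OF is_solution_commute[OF sol]] w(2)
    proof eventually_elim
      case (elim \<tau>)
      show ?case
      proof (intro impI allI)
        fix r :: real and z :: 'a
        assume \<tau>: "0 < \<tau> \<and> \<tau> < T" and r: "0 < r \<and> \<tau> + r\<^sup>2 / 8 \<le> T"
        show "(\<integral>\<^sup>+ y\<in>ball z r. u y \<tau> \<partial>lebesgue) \<le>
          ennreal (\<gamma> * r powr (real DIM('a) - 2 * (p + 1) / (p * q - 1)))"
        proof (rule \<gamma>(2))
          show "r > 0" using r by simp
          show "mild_supersolution D1 (\<lambda>y s. ennpowr (v y s) p) u \<tau> (\<tau> + r\<^sup>2 / 8)"
            by (rule mild_supersolutionI[OF elim(1)]) (use \<tau> r in auto)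
          show "mild_supersolution D2 (\<lambda>y s. ennpowr (u y s) q) v \<tau> (\<tau> + r\<^sup>2 / 8)"
            by (rule mild_supersolutionI[OF elim(2)]) (use \<tau> r in auto)
          show "AE t in lebesgue. \<tau> < t \<and> t < \<tau> + r\<^sup>2 / 8 \<longrightarrow> (AE x in lebesgue. u x t < \<infinity>)"
            unfolding AE_completion_iff using elim(1)
          proof eventually_elim
            case (elim t)
            show ?case
            proof
              assume "\<tau> < t \<and> t < \<tau> + r\<^sup>2 / 8"
              then have "AE x in lborel. mild_identity D1 u (\<lambda>y s. ennpowr (v y s) p) x \<tau> t"
                using elim \<tau> r by auto
              then show "AE x in lborel. u x t < \<infinity>" by eventually_elim (unfold mild_identity_def, erule conjunct1)
            qed
          qed
          have "AE y in lborel. u y \<tau> = w y \<tau>" using elim(3) \<tau> by simp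
          then show "(\<lambda>y. u y \<tau>) \<in> borel_measurable lebesgue"
            by (rule lebesgue_measurable_of_AE_eq[OF w_sec]) simp
        qed
      qed
    qed
  qed
  show ?thesis by (intro exI[of _ \<gamma>] conjI allI impI \<gamma>(1)) (rule main)
qed

text \<open>The a priori bound with \<open>r = 2\<sigma>\<close> looks ahead by \<open>r\<^sup>2/8 = \<sigma>\<^sup>2/2\<close> in time. For \<open>\<sigma> \<le> sqrt T\<close> this is at
  most \<open>T/2\<close>, so it is available at almost all times below \<open>T/2\<close>.\<close>
lemma solution_trace_bound:
  fixes D1 D2 p q :: real
  assumes D: "D1 > 0" "D2 > 0" and pq: "0 < p" "0 < q" "p * q > 1"
  shows "\<exists>\<gamma>>0. \<forall>(u :: 'a::euclidean_space \<Rightarrow> real \<Rightarrow> ennreal) v T \<mu> \<sigma>.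
    is_solution D1 D2 p q T u v \<longrightarrow> 0 < T \<longrightarrow> radon_measure \<mu> \<longrightarrow> is_initial_trace u \<mu> \<longrightarrow>
    0 < \<sigma> \<longrightarrow> \<sigma> \<le> T powr (1 / 2) \<longrightarrow>
    (SUP x. emeasure \<mu> (ball x \<sigma>)) \<le> ennreal (\<gamma> * \<sigma> powr (real DIM('a) - 2 * (p + 1) / (p * q - 1)))"
proof -
  define \<theta> where "\<theta> = real DIM('a) - 2 * (p + 1) / (p * q - 1)"
  from solution_mass_bound[OF D pq, where 'a = 'a, folded \<theta>_def]
  obtain \<gamma> where \<gamma>: "\<gamma> > 0" "\<forall>(u :: 'a \<Rightarrow> real \<Rightarrow> ennreal) v T. is_solution D1 D2 p q T u v \<longrightarrow>
    (AE \<tau> in lebesgue. 0 < \<tau> \<and> \<tau> < T \<longrightarrow> (\<forall>r z. 0 < r \<and> \<tau> + r\<^sup>2 / 8 \<le> T \<longrightarrow>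
      (\<integral>\<^sup>+ y\<in>ball z r. u y \<tau> \<partial>lebesgue) \<le> ennreal (\<gamma> * r powr \<theta>)))"
    by (elim exE conjE)
  have main: "(SUP x. emeasure \<mu> (ball x \<sigma>)) \<le> ennreal (\<gamma> * 2 powr \<theta> * \<sigma> powr \<theta>)"
    if sol: "is_solution D1 D2 p q T u v" and T: "0 < T" and \<mu>: "radon_measure \<mu>" "is_initial_trace u \<mu>"
      and \<sigma>: "0 < \<sigma>" "\<sigma> \<le> T powr (1 / 2)" for u v :: "'a \<Rightarrow> real \<Rightarrow> ennreal" and T \<mu> \<sigma>
  proof (rule SUP_least)
    fix x :: 'a
    have "\<sigma>\<^sup>2 \<le> (sqrt T)\<^sup>2" using \<sigma> T by (intro power_mono) (auto simp: powr_half_sqrt)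
    then have \<sigma>T: "(2 * \<sigma>)\<^sup>2 / 8 \<le> T / 2" using T by simp
    have "emeasure \<mu> (ball x \<sigma>) \<le> ennreal (\<gamma> * (2 * \<sigma>) powr \<theta>)"
    proof (rule trace_ball_bound[OF \<mu> \<sigma>(1), where T = "T / 2"])
      show "0 < T / 2" "0 \<le> \<gamma> * (2 * \<sigma>) powr \<theta>" using T \<gamma>(1) by auto
      show "AE t in lebesgue. 0 < t \<and> t < T / 2 \<longrightarrow> (\<integral>\<^sup>+ y\<in>ball x (2 * \<sigma>). u y t \<partial>lebesgue) \<le> ennreal (\<gamma> * (2 * \<sigma>) powr \<theta>)"
        using \<gamma>(2)[rule_format, OF sol]
      proof eventually_elim
        case (elim t)
        show ?case
        proof
          assume t: "0 < t \<and> t < T / 2"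
          then have "t + (2 * \<sigma>)\<^sup>2 / 8 \<le> T" using \<sigma>T by linarith
          moreover have "t < T" using t T by linarith
          ultimately show "(\<integral>\<^sup>+ y\<in>ball x (2 * \<sigma>). u y t \<partial>lebesgue) \<le> ennreal (\<gamma> * (2 * \<sigma>) powr \<theta>)"
            using elim t \<sigma>(1) by simp
        qed
      qed
    qed
    then show "emeasure \<mu> (ball x \<sigma>) \<le> ennreal (\<gamma> * 2 powr \<theta> * \<sigma> powr \<theta>)"
      using \<sigma>(1) by (simp add: powr_mult mult.assoc)
  qed
  show ?thesis
    unfolding \<theta>_def[symmetric]
  proof (intro exI conjI allI impI)
    show "\<gamma> * 2 powr \<theta> > 0" using \<gamma>(1) by simp
  qed (rule main)
qed

theorem theorem1p1:
  fixes D1 D2 p q :: real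
  assumes "D1 > 0" and "D2 > 0" and "0 < p" and "p \<le> q" and "p * q > 1"
  shows "\<exists>\<gamma>>0. \<forall>T>0. \<forall>(u :: 'a::euclidean_space \<Rightarrow> real \<Rightarrow> ennreal) v.
    is_solution D1 D2 p q T u v \<longrightarrow>
      (\<exists>!(\<mu>, \<nu>). radon_measure \<mu> \<and> radon_measure \<nu> \<and>
        is_initial_trace u \<mu> \<and> is_initial_trace v \<nu>) \<and>
      (\<forall>\<mu> \<nu>. radon_measure \<mu> \<and> radon_measure \<nu> \<and>
        is_initial_trace u \<mu> \<and> is_initial_trace v \<nu> \<longrightarrow>
        (\<forall>\<sigma>. 0 < \<sigma> \<and> \<sigma> \<le> T powr (1 / 2) \<longrightarrow>
          (SUP x. emeasure \<mu> (ball x \<sigma>)) \<le>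
            ennreal (\<gamma> * \<sigma> powr (real DIM('a) - 2 * (p + 1) / (p * q - 1))) \<and>
          (SUP x. emeasure \<nu> (ball x \<sigma>)) \<le>
            ennreal (\<gamma> * \<sigma> powr (real DIM('a) - 2 * (q + 1) / (p * q - 1)))))"
proof -
  have q: "q > 0" using assms(3,4) by linarith
  have qp: "q * p > 1" using assms(5) by (simp only: mult.commute)
  from solution_trace_bound[OF assms(1,2,3) q assms(5), where 'a = 'a]
  obtain \<gamma>1 where \<gamma>1: "\<gamma>1 > 0" "\<forall>(u :: 'a \<Rightarrow> real \<Rightarrow> ennreal) v T \<mu> \<sigma>.
    is_solution D1 D2 p q T u v \<longrightarrow> 0 < T \<longrightarrow> radon_measure \<mu> \<longrightarrow> is_initial_trace u \<mu> \<longrightarrow>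
    0 < \<sigma> \<longrightarrow> \<sigma> \<le> T powr (1 / 2) \<longrightarrow>
    (SUP x. emeasure \<mu> (ball x \<sigma>)) \<le> ennreal (\<gamma>1 * \<sigma> powr (real DIM('a) - 2 * (p + 1) / (p * q - 1)))"
    by (elim exE conjE)
  from solution_trace_bound[OF assms(2,1) q assms(3) qp, where 'a = 'a, unfolded mult.commute[of q p]]
  obtain \<gamma>2 where \<gamma>2: "\<gamma>2 > 0" "\<forall>(u :: 'a \<Rightarrow> real \<Rightarrow> ennreal) v T \<mu> \<sigma>.
    is_solution D2 D1 q p T u v \<longrightarrow> 0 < T \<longrightarrow> radon_measure \<mu> \<longrightarrow> is_initial_trace u \<mu> \<longrightarrow>
    0 < \<sigma> \<longrightarrow> \<sigma> \<le> T powr (1 / 2) \<longrightarrow>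
    (SUP x. emeasure \<mu> (ball x \<sigma>)) \<le> ennreal (\<gamma>2 * \<sigma> powr (real DIM('a) - 2 * (q + 1) / (p * q - 1)))"
    by (elim exE conjE)
  define \<gamma> where "\<gamma> = max \<gamma>1 \<gamma>2"
  have weaken: "ennreal (\<gamma>1 * \<sigma> powr a) \<le> ennreal (\<gamma> * \<sigma> powr a)" "ennreal (\<gamma>2 * \<sigma> powr a) \<le> ennreal (\<gamma> * \<sigma> powr a)" for \<sigma> a
    by (auto simp: \<gamma>_def intro!: ennreal_leI mult_right_mono)
  show ?thesis
  proof (intro exI[of _ \<gamma>] conjI allI impI)
    show "\<gamma> > 0" using \<gamma>1(1) by (simp add: \<gamma>_def)
  next
    fix T :: real and u v :: "'a \<Rightarrow> real \<Rightarrow> ennreal"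
    assume T: "T > 0" and sol: "is_solution D1 D2 p q T u v"
    obtain \<mu> where \<mu>: "radon_measure \<mu>" "is_initial_trace u \<mu>"
      using solution_has_trace[OF sol assms(1) T] by blast
    obtain \<nu> where \<nu>: "radon_measure \<nu>" "is_initial_trace v \<nu>"
      using solution_has_trace[OF is_solution_commute[OF sol] assms(2) T] by blast
    show "\<exists>!(\<mu>, \<nu>). radon_measure \<mu> \<and> radon_measure \<nu> \<and> is_initial_trace u \<mu> \<and> is_initial_trace v \<nu>"
    proof (rule ex1I[of _ "(\<mu>, \<nu>)"])
      show "case (\<mu>, \<nu>) of (\<mu>, \<nu>) \<Rightarrow>
          radon_measure \<mu> \<and> radon_measure \<nu> \<and> is_initial_trace u \<mu> \<and> is_initial_trace v \<nu>"
        using \<mu> \<nu> by simp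
      show "z = (\<mu>, \<nu>)" if "case z of (\<mu>, \<nu>) \<Rightarrow>
          radon_measure \<mu> \<and> radon_measure \<nu> \<and> is_initial_trace u \<mu> \<and> is_initial_trace v \<nu>" for z
        using that initial_trace_unique[OF _ \<mu>(1) _ \<mu>(2)] initial_trace_unique[OF _ \<nu>(1) _ \<nu>(2)]
        by (cases z) auto
    qed
  next
    fix T \<sigma> :: real and u v :: "'a \<Rightarrow> real \<Rightarrow> ennreal" and \<mu> \<nu> :: "'a measure"
    assume T: "T > 0" and sol: "is_solution D1 D2 p q T u v"
      and tr: "radon_measure \<mu> \<and> radon_measure \<nu> \<and> is_initial_trace u \<mu> \<and> is_initial_trace v \<nu>"
      and \<sigma>: "0 < \<sigma> \<and> \<sigma> \<le> T powr (1 / 2)"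
    have "(SUP x. emeasure \<mu> (ball x \<sigma>)) \<le> ennreal (\<gamma>1 * \<sigma> powr (real DIM('a) - 2 * (p + 1) / (p * q - 1)))"
      by (rule \<gamma>1(2)[rule_format, OF sol T]) (use tr \<sigma> in auto)
    then show "(SUP x. emeasure \<mu> (ball x \<sigma>)) \<le> ennreal (\<gamma> * \<sigma> powr (real DIM('a) - 2 * (p + 1) / (p * q - 1)))"
      using weaken(1) by (rule order_trans)
    have "(SUP x. emeasure \<nu> (ball x \<sigma>)) \<le> ennreal (\<gamma>2 * \<sigma> powr (real DIM('a) - 2 * (q + 1) / (p * q - 1)))"
      by (rule \<gamma>2(2)[rule_format, OF is_solution_commute[OF sol] T]) (use tr \<sigma> in auto)
    then show "(SUP x. emeasure \<nu> (ball x \<sigma>)) \<le> ennreal (\<gamma> * \<sigma> powr (real DIM('a) - 2 * (q + 1) / (p * q - 1)))"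
      using weaken(2) by (rule order_trans)
  qed
qed

end
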